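(* Let $n\ge 1$, let $f$ be an entire function of finite order on $\mathbb{C}^n$, and let $\mathcal{R}^n[f]\subset\mathcal{M}_0^n$ be the subalgebra generated by $\mathcal{R}^n$ and $f$. Then either $\mathcal{R}^n[f]$ is stable in $\mathcal{M}_0^n$, or $\mathcal{R}^n[f]=\mathcal{R}^n[e^p]$ for some polynomial $p\in\mathcal{P}^n$ and the algebra $\mathcal{R}^n[e^p,e^{-p}]$ is stable in $\mathcal{M}_0^n$.
   Context: $\mathcal{P}^n$ is the ring of polynomials on $\mathbb{C}^n$ (complex coefficients) and $\mathcal{R}^n$ is the field of rational functions on $\mathbb{C}^n$. $\mathcal{M}_0^n$ is the algebra of meromorphic functions on $\mathbb{C}^n$ whose polar variety is algebraic; equivalently, functions of the form $h/q$ with $h$ entire on $\mathbb{C}^n$ and $q\in\mathcal{P}^n$, $q\not\equiv 0$. For functions $g_1,\dots,g_k\in\mathcal{M}_0^n$, $\mathcal{R}^n[g_1,\dots,g_k]$ denotes the subalgebra of $\mathcal{M}_0^n$ generated by $\mathcal{R}^n$ and $g_1,\dots,g_k$. A subalgebra $\mathcal{B}$ of $\mathcal{A}$ (here $\mathcal{A}=\mathcal{M}_0^n$) is called stable in $\mathcal{A}$ if whenever $g,h\in\mathcal{B}$ (with $g\neq 0$) and $h/g\in\mathcal{A}$, then $h/g\in\mathcal{B}$. An entire function $f$ on $\mathbb{C}^n$ has finite order if there are constants $C,\rho>0$ with $|f(z)|\le Ce^{|z|^{\rho}}$ for all $z\in\mathbb{C}^n$. *)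

theory Defs
  imports
    "HOL-Complex_Analysis.Conformal_Mappings"
    "HOL-Computational_Algebra.Fraction_Field"
begin

text \<open>
  $\mathbf{C}^n$ is the type \<^typ>\<open>complex ^ 'n\<close>. A function on it is entire if it is complex
  differentiable everywhere, i.e. its real Frechet derivative, which is the one \<^const>\<open>has_derivative\<close>
  provides, is complex linear at every point.
\<close>

definition entire_fun :: "(complex ^ 'n::finite \<Rightarrow> complex) \<Rightarrow> bool" where
  "entire_fun f \<longleftrightarrow>
     (\<forall>z. \<exists>D. (f has_derivative D) (at z) \<and> (\<forall>c v. D (c *s v) = c * D v))"

lemma entire_fun_const: "entire_fun (\<lambda>z. c)"
  unfolding entire_fun_def by (intro allI exI[of _ "\<lambda>v. 0"]) auto

lemma entire_fun_component: "entire_fun (\<lambda>z. z $ i)"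
  unfolding entire_fun_def
  by (intro allI exI[of _ "\<lambda>v. v $ i"])
     (auto intro!: bounded_linear_imp_has_derivative bounded_linear_vec_nth)

lemma entire_fun_add:
  assumes "entire_fun f" "entire_fun g"
  shows "entire_fun (\<lambda>z. f z + g z)"
  unfolding entire_fun_def
proof
  fix z
  obtain D where D: "(f has_derivative D) (at z)" "\<And>c v. D (c *s v) = c * D v"
    using assms(1) unfolding entire_fun_def by blast
  obtain E where E: "(g has_derivative E) (at z)" "\<And>c v. E (c *s v) = c * E v"
    using assms(2) unfolding entire_fun_def by blast
  show "\<exists>D. ((\<lambda>z. f z + g z) has_derivative D) (at z) \<and> (\<forall>c v. D (c *s v) = c * D v)"
    by (rule exI[of _ "\<lambda>v. D v + E v"]) (auto intro: has_derivative_add D E simp: D E algebra_simps)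
qed

lemma entire_fun_mult:
  assumes "entire_fun f" "entire_fun g"
  shows "entire_fun (\<lambda>z. f z * g z)"
  unfolding entire_fun_def
proof
  fix z
  obtain D where D: "(f has_derivative D) (at z)" "\<And>c v. D (c *s v) = c * D v"
    using assms(1) unfolding entire_fun_def by blast
  obtain E where E: "(g has_derivative E) (at z)" "\<And>c v. E (c *s v) = c * E v"
    using assms(2) unfolding entire_fun_def by blast
  show "\<exists>D. ((\<lambda>z. f z * g z) has_derivative D) (at z) \<and> (\<forall>c v. D (c *s v) = c * D v)"
    using has_derivative_mult[OF D(1) E(1)]
    by (intro exI[of _ "\<lambda>v. f z * E v + D v * g z"]) (simp add: D(2) E(2) distrib_left mult_ac)
qed

lemma entire_fun_uminus:
  assumes "entire_fun f" shows "entire_fun (\<lambda>z. - f z)"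
  using entire_fun_mult[OF entire_fun_const[of "-1"] assms] by simp

lemma entire_fun_diff:
  assumes "entire_fun f" "entire_fun g"
  shows "entire_fun (\<lambda>z. f z - g z)"
  using entire_fun_add[OF assms(1) entire_fun_uminus[OF assms(2)]] by simp

lemma entire_fun_sum:
  assumes "\<And>x. x \<in> A \<Longrightarrow> entire_fun (f x)"
  shows "entire_fun (\<lambda>z. \<Sum>x\<in>A. f x z)"
  using assms
  by (induction A rule: infinite_finite_induct) (auto intro: entire_fun_const entire_fun_add)

lemma entire_fun_prod:
  assumes "\<And>x. x \<in> A \<Longrightarrow> entire_fun (f x)"
  shows "entire_fun (\<lambda>z. \<Prod>x\<in>A. f x z)"
  using assms
  by (induction A rule: infinite_finite_induct) (auto intro: entire_fun_const entire_fun_mult)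

lemma entire_fun_power:
  assumes "entire_fun f" shows "entire_fun (\<lambda>z. f z ^ k)"
  by (induction k) (auto intro: entire_fun_const entire_fun_mult assms)

lemma entire_fun_exp:
  assumes "entire_fun f" shows "entire_fun (\<lambda>z. exp (f z))"
  unfolding entire_fun_def
proof
  fix z
  obtain D where D: "(f has_derivative D) (at z)" "\<And>c v. D (c *s v) = c * D v"
    using assms unfolding entire_fun_def by blast
  have "(exp has_derivative (\<lambda>w. exp (f z) * w)) (at (f z))"
    using DERIV_exp[of "f z"] by (simp add: has_field_derivative_def)
  from has_derivative_compose[OF D(1) this]
  show "\<exists>D. ((\<lambda>z. exp (f z)) has_derivative D) (at z) \<and> (\<forall>c v. D (c *s v) = c * D v)"
    by (intro exI[of _ "\<lambda>v. exp (f z) * D v"]) (simp add: D(2))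
qed

lemma entire_fun_on_line:
  assumes "entire_fun f"
  shows "(\<lambda>t. f (a + t *s v)) holomorphic_on UNIV"
proof -
  have "(\<lambda>t. f (a + t *s v)) field_differentiable (at t)" for t
  proof -
    obtain D where D: "(f has_derivative D) (at (a + t *s v))" "\<And>c v. D (c *s v) = c * D v"
      using assms unfolding entire_fun_def by blast
    have "bounded_linear (\<lambda>t. t *s v)"
      by (rule linear_conv_bounded_linear[THEN iffD1], rule linearI)
         (auto simp: vec_eq_iff algebra_simps)
    hence "((\<lambda>t. a + t *s v) has_derivative (\<lambda>t. 0 + t *s v)) (at t)"
      by (intro has_derivative_add has_derivative_const bounded_linear_imp_has_derivative)
    hence "((\<lambda>t. a + t *s v) has_derivative (\<lambda>t. t *s v)) (at t)"
      by simp
    from has_derivative_compose[OF this D(1)]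
    have "((\<lambda>t. f (a + t *s v)) has_derivative (\<lambda>s. D v * s)) (at t)"
      by (simp add: D mult.commute)
    thus ?thesis
      unfolding field_differentiable_def has_field_derivative_def by blast
  qed
  thus ?thesis
    by (simp add: holomorphic_on_def)
qed

lemma entire_fun_no_zero_divisors:
  assumes "entire_fun f" "entire_fun g" "\<And>z. f z * g z = 0" "f a \<noteq> 0"
  shows "g z = 0"
proof -
  define F where "F = (\<lambda>t. f (a + t *s (z - a)))"
  define G where "G = (\<lambda>t. g (a + t *s (z - a)))"
  have F: "F holomorphic_on UNIV" and G: "G holomorphic_on UNIV"
    unfolding F_def G_def by (rule entire_fun_on_line[OF assms(1)], rule entire_fun_on_line[OF assms(2)])
  have "open (F -` (- {0}))"
    using holomorphic_on_imp_continuous_on[OF F] by (intro open_vimage) auto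
  moreover have "0 \<in> F -` (- {0})"
    using assms(4) by (simp add: F_def)
  moreover have "G t = 0" if "t \<in> F -` (- {0})" for t
    using that assms(3)[of "a + t *s (z - a)"] by (auto simp: F_def G_def)
  ultimately have "G 1 = 0"
    by (intro analytic_continuation_open[of "F -` (- {0})" UNIV G "\<lambda>_. 0" 1])
       (use G in auto)
  thus ?thesis
    by (simp add: G_def)
qed

lemma entire_fun_mult_nonzero:
  assumes "entire_fun f" "entire_fun g" "f \<noteq> (\<lambda>z. 0)" "g \<noteq> (\<lambda>z. 0)"
  shows "(\<lambda>z. f z * g z) \<noteq> (\<lambda>z. 0)"
proof
  assume *: "(\<lambda>z. f z * g z) = (\<lambda>z. 0)"
  obtain a where "f a \<noteq> 0"
    using assms(3) by auto
  hence "g z = 0" for z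
    using entire_fun_no_zero_divisors[OF assms(1,2)] fun_cong[OF *] by blast
  thus False
    using assms(4) by auto
qed

typedef 'n entire = "{f :: complex ^ 'n::finite \<Rightarrow> complex. entire_fun f}"
  morphisms eval_entire Entire
  using entire_fun_const by blast

setup_lifting type_definition_entire

instantiation entire :: (finite) idom
begin

lift_definition zero_entire :: "'a entire" is "\<lambda>z. 0"
  by (rule entire_fun_const)

lift_definition one_entire :: "'a entire" is "\<lambda>z. 1"
  by (rule entire_fun_const)

lift_definition plus_entire :: "'a entire \<Rightarrow> 'a entire \<Rightarrow> 'a entire" is "\<lambda>f g z. f z + g z"
  by (rule entire_fun_add)

lift_definition minus_entire :: "'a entire \<Rightarrow> 'a entire \<Rightarrow> 'a entire" is "\<lambda>f g z. f z - g z"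
  by (rule entire_fun_diff)

lift_definition uminus_entire :: "'a entire \<Rightarrow> 'a entire" is "\<lambda>f z. - f z"
  by (rule entire_fun_uminus)

lift_definition times_entire :: "'a entire \<Rightarrow> 'a entire \<Rightarrow> 'a entire" is "\<lambda>f g z. f z * g z"
  by (rule entire_fun_mult)

instance
proof
  fix f g h :: "'a entire"
  show "f * g * h = f * (g * h)"
    by transfer (simp add: mult.assoc)
  show "f * g = g * f"
    by transfer (simp add: mult.commute)
  show "1 * f = f"
    by transfer simp
  show "f + g + h = f + (g + h)"
    by transfer (simp add: add.assoc)
  show "f + g = g + f"
    by transfer (simp add: add.commute)
  show "0 + f = f"
    by transfer simp
  show "- f + f = 0"
    by transfer simp
  show "f - g = f + - g"
    by transfer simp
  show "(f + g) * h = f * h + g * h"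
    by transfer (simp add: distrib_right)
  show "f * (g + h) = f * g + f * h"
    by transfer (simp add: distrib_left)
  show "0 * f = 0"
    by transfer simp
  show "f * 0 = 0"
    by transfer simp
  show "(0 :: 'a entire) \<noteq> 1"
    by transfer (simp add: fun_eq_iff)
  show "f * g \<noteq> 0" if "f \<noteq> 0" "g \<noteq> 0"
    using that by transfer (rule entire_fun_mult_nonzero)
qed

end

lift_definition const_entire :: "complex \<Rightarrow> 'n::finite entire" is "\<lambda>c z. c"
  by (rule entire_fun_const)

lift_definition exp_entire :: "'n::finite entire \<Rightarrow> 'n entire" is "\<lambda>f z. exp (f z)"
  by (rule entire_fun_exp)

definition finite_order :: "'n::finite entire \<Rightarrow> bool" where
  "finite_order f \<longleftrightarrow>
     (\<exists>C>0. \<exists>\<rho>>0. \<forall>z. norm (eval_entire f z) \<le> C * exp (norm z powr \<rho>))"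

definition polynomial_fun :: "(complex ^ 'n::finite \<Rightarrow> complex) \<Rightarrow> bool" where
  "polynomial_fun p \<longleftrightarrow>
     (\<exists>(A :: ('n \<Rightarrow> nat) set) c. finite A \<and> p = (\<lambda>z. \<Sum>\<alpha>\<in>A. c \<alpha> * (\<Prod>i\<in>UNIV. (z $ i) ^ \<alpha> i)))"

definition polynomials :: "'n::finite entire set" where
  "polynomials = {p. polynomial_fun (eval_entire p)}"

lemma polynomial_fun_imp_entire_fun: "polynomial_fun p \<Longrightarrow> entire_fun p"
  unfolding polynomial_fun_def
  by (auto intro!: entire_fun_sum entire_fun_mult entire_fun_prod entire_fun_power
        entire_fun_const entire_fun_component)

lemma polynomial_fun_const: "polynomial_fun (\<lambda>z. c)"
  unfolding polynomial_fun_def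
  by (rule exI[of _ "{\<lambda>_. 0}"], rule exI[of _ "\<lambda>_. c"]) simp

lemma polynomial_fun_mult:
  fixes p q :: "complex ^ 'n::finite \<Rightarrow> complex"
  assumes "polynomial_fun p" "polynomial_fun q"
  shows "polynomial_fun (\<lambda>z. p z * q z)"
proof -
  obtain A :: "('n \<Rightarrow> nat) set" and c
    where A: "finite A" "p = (\<lambda>z. \<Sum>\<alpha>\<in>A. c \<alpha> * (\<Prod>i\<in>UNIV. (z $ i) ^ \<alpha> i))"
    using assms(1) unfolding polynomial_fun_def by blast
  obtain B :: "('n \<Rightarrow> nat) set" and d
    where B: "finite B" "q = (\<lambda>z. \<Sum>\<beta>\<in>B. d \<beta> * (\<Prod>i\<in>UNIV. (z $ i) ^ \<beta> i))"
    using assms(2) unfolding polynomial_fun_def by blast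
  define s :: "('n \<Rightarrow> nat) \<times> ('n \<Rightarrow> nat) \<Rightarrow> 'n \<Rightarrow> nat" where "s = (\<lambda>(\<alpha>, \<beta>) i. \<alpha> i + \<beta> i)"
  define e where "e = (\<lambda>\<gamma>. \<Sum>x | x \<in> A \<times> B \<and> s x = \<gamma>. c (fst x) * d (snd x))"
  have "p z * q z = (\<Sum>\<gamma>\<in>s ` (A \<times> B). e \<gamma> * (\<Prod>i\<in>UNIV. (z $ i) ^ \<gamma> i))" for z
  proof -
    have "p z * q z = (\<Sum>x\<in>A \<times> B. c (fst x) * d (snd x) * (\<Prod>i\<in>UNIV. (z $ i) ^ s x i))"
      unfolding A(2) B(2) s_def
      by (simp add: sum_product sum.cartesian_product case_prod_unfold power_add prod.distrib mult_ac)
    also have "\<dots> = (\<Sum>\<gamma>\<in>s ` (A \<times> B). \<Sum>x | x \<in> A \<times> B \<and> s x = \<gamma>.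
                       c (fst x) * d (snd x) * (\<Prod>i\<in>UNIV. (z $ i) ^ s x i))"
      using A(1) B(1) by (intro sum.image_gen) auto
    also have "\<dots> = (\<Sum>\<gamma>\<in>s ` (A \<times> B). e \<gamma> * (\<Prod>i\<in>UNIV. (z $ i) ^ \<gamma> i))"
      unfolding e_def sum_distrib_right by (intro sum.cong) auto
    finally show ?thesis .
  qed
  thus ?thesis
    unfolding polynomial_fun_def using A(1) B(1)
    by (intro exI[of _ "s ` (A \<times> B)"] exI[of _ e]) (auto simp: fun_eq_iff)
qed

lemma one_in_polynomials: "1 \<in> polynomials"
  unfolding polynomials_def by (simp add: one_entire.rep_eq polynomial_fun_const)

lemma const_in_polynomials: "const_entire c \<in> polynomials"
  unfolding polynomials_def by (simp add: const_entire.rep_eq polynomial_fun_const)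

lemma mult_in_polynomials: "p \<in> polynomials \<Longrightarrow> q \<in> polynomials \<Longrightarrow> p * q \<in> polynomials"
  unfolding polynomials_def by (simp add: times_entire.rep_eq polynomial_fun_mult)

text \<open>
  Functions $h/q$ are identified when they agree off the zeros of the denominators, that is, they
  are elements of the field of fractions of the integral domain of entire functions, and $0$ in
  this field is the function that vanishes identically. The quotient $h/g$ of two such functions
  is the quotient in this field.
\<close>

type_synonym 'n meromorphic = "'n entire fract"

definition rational_functions :: "'n::finite meromorphic set" where
  "rational_functions = {Fract p q | p q. p \<in> polynomials \<and> q \<in> polynomials \<and> q \<noteq> 0}"

definition merom_alg_poles :: "'n::finite meromorphic set" where
  "merom_alg_poles = {Fract h q | h q. q \<in> polynomials \<and> q \<noteq> 0}"

definition is_subalgebra :: "'n::finite meromorphic set \<Rightarrow> bool" where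
  "is_subalgebra B \<longleftrightarrow>
     1 \<in> B \<and> (\<forall>f\<in>B. \<forall>g\<in>B. f + g \<in> B \<and> f * g \<in> B) \<and>
     (\<forall>c. \<forall>f\<in>B. Fract (const_entire c) 1 * f \<in> B)"

text \<open>
  The generated subalgebra is taken in the field of fractions; it equals the one generated inside
  \<^const>\<open>merom_alg_poles\<close> when the generators lie there, see \<open>rational_alg_subset\<close> below.
\<close>

definition rational_alg :: "'n::finite meromorphic set \<Rightarrow> 'n meromorphic set" where
  "rational_alg G = is_subalgebra hull (rational_functions \<union> G)"

definition stable_in :: "'n::finite meromorphic set \<Rightarrow> 'n meromorphic set \<Rightarrow> bool" where
  "stable_in B A \<longleftrightarrow>
     is_subalgebra B \<and> B \<subseteq> A \<and> (\<forall>g\<in>B. \<forall>h\<in>B. g \<noteq> 0 \<and> h / g \<in> A \<longrightarrow> h / g \<in> B)"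

lemma entire_in_merom_alg_poles: "Fract f 1 \<in> merom_alg_poles"
proof -
  have "(1 :: 'a entire) \<in> polynomials \<and> (1 :: 'a entire) \<noteq> 0"
    using one_in_polynomials by simp
  thus ?thesis
    unfolding merom_alg_poles_def by fast
qed

lemma is_subalgebra_merom_alg_poles: "is_subalgebra merom_alg_poles"
  unfolding is_subalgebra_def
proof (intro conjI ballI allI)
  show "1 \<in> merom_alg_poles"
    using entire_in_merom_alg_poles[of 1] by (simp add: One_fract_def)
next
  fix f g :: "'a meromorphic"
  assume "f \<in> merom_alg_poles" "g \<in> merom_alg_poles"
  then obtain h q h' q' where *: "f = Fract h q" "g = Fract h' q'" "q \<in> polynomials" "q \<noteq> 0"
      "q' \<in> polynomials" "q' \<noteq> 0"
    unfolding merom_alg_poles_def by blast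
  hence "q * q' \<in> polynomials" "q * q' \<noteq> 0"
    by (simp_all add: mult_in_polynomials)
  moreover have "f + g = Fract (h * q' + h' * q) (q * q')" "f * g = Fract (h * h') (q * q')"
    using * by simp_all
  ultimately show "f + g \<in> merom_alg_poles" "f * g \<in> merom_alg_poles"
    unfolding merom_alg_poles_def by blast+
next
  fix c and f :: "'a meromorphic"
  assume "f \<in> merom_alg_poles"
  then obtain h q where *: "f = Fract h q" "q \<in> polynomials" "q \<noteq> 0"
    unfolding merom_alg_poles_def by blast
  hence "Fract (const_entire c) 1 * f = Fract (const_entire c * h) q"
    by simp
  with * show "Fract (const_entire c) 1 * f \<in> merom_alg_poles"
    unfolding merom_alg_poles_def by blast
qed

lemma is_subalgebra_rational_alg: "is_subalgebra (rational_alg G)"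
  unfolding rational_alg_def by (rule hull_in) (auto simp: is_subalgebra_def)

lemma rational_functions_subset: "rational_functions \<subseteq> merom_alg_poles"
  unfolding rational_functions_def merom_alg_poles_def by blast

lemma rational_alg_subset:
  assumes "G \<subseteq> merom_alg_poles"
  shows "rational_alg G \<subseteq> merom_alg_poles"
  unfolding rational_alg_def
  using assms rational_functions_subset is_subalgebra_merom_alg_poles by (intro hull_minimal) auto

end

theory Submission
  imports Defs
    "HOL-Computational_Algebra.Fundamental_Theorem_Algebra"
    "HOL-Computational_Algebra.Polynomial_Factorial"
    "HOL-Computational_Algebra.Field_as_Ring"
begin

text \<open>
  Let $K$ be the field of rational functions and $f \notin K$. Then $f$ is transcendental over $K$ and
  $K[f]$ is a principal ideal domain, so a failure of stability yields a nonconstant monic $P \in K[X]$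
  such that $1/P(f)$ has algebraic poles. Up to a polynomial denominator, $P(f)$ is then an entire
  function of finite order dividing a polynomial, hence $P(f) = a e^u$ with $a \in K$ and a polynomial
  $u$. So all logarithmic derivatives of $P(f)$ lie in $K$, and comparing them with
  $\partial_i P(f) = P^{\partial_i}(f) + P'(f)\,\partial_i f$ gives $\partial_i f = \alpha_i f + \beta_i$ with
  coefficients in $K$; this forces $P(f) = (f - b)^d$ with $b \in K$. Thus $1/(f - b)$ has algebraic poles
  too, and $f - b = a e^p$. For the algebra $K[e^p, e^{-p}]$ the same reasoning applies to $X P(X)$.
\<close>

section \<open>Partial derivatives\<close>

text \<open>Two points carry the weight. The first is that an entire function of finite order
  dividing a polynomial has the form r e^u with polynomials r and u. In one variable the zeros are
  divided out and the logarithm of the rest is a polynomial. In several variables the divisor is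
  restricted to all lines z + t v in one direction v along which the polynomial has a constant
  leading coefficient. The factorizations on these lines are chosen independently and their
  exponents are fixed only up to 2 pi i, so their dependence on z is unknown at first; the
  logarithmic derivative along v recovers it.

  The second is that the partial derivatives of f have algebraic poles but are not known to lie in
  K[f] or to be affine in f. Bezout's identity helps twice: a quotient with algebraic poles passes
  this property on to the inverse of its reduced denominator. This is used for quotients of elements
  of K[f] and again for the derivative of f, written as N(f) / P'(f). The element b is read off from
  the coefficients of P, hence is the same for every partial derivative; so P(f) / (f - b)^d has
  vanishing derivatives in all directions and is constant.\<close>

definition partial_deriv :: "'n::finite \<Rightarrow> (complex ^ 'n \<Rightarrow> complex) \<Rightarrow> complex ^ 'n \<Rightarrow> complex" where
  "partial_deriv i f z = deriv (\<lambda>t. f (z + t *s axis i 1)) 0"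

lemma bounded_linear_vec_scaleC_left: "bounded_linear (\<lambda>t::complex. t *s (v :: complex ^ 'n::finite))"
  by (rule linear_conv_bounded_linear[THEN iffD1], rule linearI)
     (simp_all add: vec_eq_iff distrib_right scaleR_conv_of_real[where 'a = complex])

lemma has_derivative_imp_line_derivative:
  fixes f :: "complex ^ 'n::finite \<Rightarrow> complex"
  assumes "(f has_derivative D) (at (a + t *s v))" "\<And>c v. D (c *s v) = c * D v"
  shows "((\<lambda>t. f (a + t *s v)) has_field_derivative D v) (at t)"
proof -
  have "((\<lambda>t. a + t *s v) has_derivative (\<lambda>t. 0 + t *s v)) (at t)"
    by (intro has_derivative_add has_derivative_const bounded_linear_imp_has_derivative
        bounded_linear_vec_scaleC_left)
  hence "((\<lambda>t. a + t *s v) has_derivative (\<lambda>t. t *s v)) (at t)"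
    by simp
  from has_derivative_compose[OF this assms(1)]
  have "((\<lambda>t. f (a + t *s v)) has_derivative (\<lambda>s. D v * s)) (at t)"
    by (simp add: assms(2) mult.commute)
  thus ?thesis
    unfolding has_field_derivative_def by blast
qed

lemma entire_fun_has_derivative:
  assumes "entire_fun f"
  shows "(f has_derivative (\<lambda>v. \<Sum>i\<in>UNIV. v $ i * partial_deriv i f z)) (at z)"
proof -
  obtain D where D: "(f has_derivative D) (at z)" "\<And>c v. D (c *s v) = c * D v"
    using assms unfolding entire_fun_def by blast
  have pd: "partial_deriv i f z = D (axis i 1)" for i
    unfolding partial_deriv_def
    by (rule DERIV_imp_deriv, rule has_derivative_imp_line_derivative) (use D in simp_all)
  have lin: "linear D"
    using D(1) has_derivative_linear by blast
  have "D v = (\<Sum>i\<in>UNIV. v $ i * partial_deriv i f z)" for v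
  proof -
    have "v = (\<Sum>i\<in>UNIV. v $ i *s axis i 1)"
      by (simp add: basis_expansion)
    hence "D v = D (\<Sum>i\<in>UNIV. v $ i *s axis i 1)" by simp
    also have "\<dots> = (\<Sum>i\<in>UNIV. D (v $ i *s axis i 1))"
      using lin by (rule linear_sum)
    finally show ?thesis by (simp add: D(2) pd)
  qed
  with D(1) show ?thesis by (metis (no_types, lifting) ext)
qed

lemma entire_fun_line_derivative:
  assumes "entire_fun f"
  shows "((\<lambda>t. f (a + t *s v)) has_field_derivative
           (\<Sum>i\<in>UNIV. v $ i * partial_deriv i f (a + t *s v))) (at t)"
  by (rule has_derivative_imp_line_derivative[OF entire_fun_has_derivative[OF assms]])
     (simp add: sum_distrib_left mult.assoc)

lemma entire_fun_imp_continuous: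
  assumes "entire_fun f" shows "continuous_on S f"
  by (meson assms entire_fun_has_derivative has_derivative_continuous continuous_at_imp_continuous_on)

lemma partial_deriv_unique:
  fixes f :: "complex ^ 'n::finite \<Rightarrow> complex"
  assumes "(f has_derivative D) (at z)" "\<And>c v. D (c *s v) = c * D v"
  shows "partial_deriv i f z = D (axis i 1)"
  unfolding partial_deriv_def
  by (rule DERIV_imp_deriv, rule has_derivative_imp_line_derivative) (use assms in simp_all)

section \<open>Cauchy's integral formula and regularity of partial derivatives\<close>

abbreviation unit_circle :: "real \<Rightarrow> complex" where
  "unit_circle x \<equiv> exp (2 * of_real pi * \<i> * of_real x)"

text \<open>Cauchy's formula over the unit circle around \<open>z\<close> in the direction of the
  i-th axis. With a fixed parameter interval, continuity and differentiability in \<open>z\<close>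
  can be passed under the integral sign.\<close>

lemma partial_deriv_eq_integral:
  assumes "entire_fun f"
  shows "partial_deriv i f z =
           integral (cbox 0 1) (\<lambda>x. f (z + unit_circle x *s axis i 1) / unit_circle x)"
proof -
  define F where "F = (\<lambda>t. f (z + t *s axis i 1))"
  have hol: "F holomorphic_on UNIV"
    unfolding F_def by (rule entire_fun_on_line[OF assms])
  have "(F has_field_derivative (1 / (2 * of_real pi * \<i>) *
          contour_integral (circlepath 0 1) (\<lambda>u. F u / (u - 0)^2))) (at 0)"
    by (rule Cauchy_derivative_integral_circlepath)
       (use hol in \<open>auto intro: holomorphic_on_subset holomorphic_on_imp_continuous_on\<close>)
  hence "partial_deriv i f z = 1 / (2 * of_real pi * \<i>) *
          contour_integral (circlepath 0 1) (\<lambda>u. F u / (u - 0)^2)"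
    unfolding partial_deriv_def F_def by (rule DERIV_imp_deriv)
  also have "\<dots> = 1 / (2 * of_real pi * \<i>) *
      integral {0..1} (\<lambda>x. F (unit_circle x) / (unit_circle x)^2 * (2 * of_real pi * \<i> * unit_circle x))"
    by (simp add: contour_integral_integral vector_derivative_circlepath) (simp add: circlepath mult_ac)
  also have "\<dots> = integral {0..1} (\<lambda>x. 1 / (2 * of_real pi * \<i>) *
      (F (unit_circle x) / (unit_circle x)^2 * (2 * of_real pi * \<i> * unit_circle x)))"
    by (rule integral_mult_right[symmetric])
  also have "\<dots> = integral {0..1} (\<lambda>x. F (unit_circle x) / unit_circle x)"
    by (rule arg_cong[where f = "integral _"]) (auto simp: fun_eq_iff field_simps power2_eq_square)
  finally show ?thesis by (simp add: F_def)
qed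

lemma continuous_partial_deriv:
  assumes "entire_fun f" shows "continuous_on UNIV (partial_deriv i f)"
proof -
  have "continuous_on (UNIV \<times> cbox 0 (1::real)) 
      (\<lambda>(z, x). f (z + unit_circle x *s axis i 1) / unit_circle x)"
    unfolding case_prod_unfold
    by (intro continuous_intros continuous_on_compose2[OF entire_fun_imp_continuous[OF assms, of UNIV]]
        bounded_linear.continuous_on[OF bounded_linear_vec_scaleC_left]) auto
  from integral_continuous_on_param[OF this] show ?thesis
    by (simp add: partial_deriv_eq_integral[OF assms, abs_def])
qed

text \<open>The Cauchy integral is differentiated under the integral sign. The Leibniz rule asks for
  a derivative of the integrand that is jointly continuous in point and parameter; mere
  differentiability of \<open>f\<close> does not hand this over, and
  \<open>continuous_partial_deriv\<close> supplies it.\<close>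

lemma entire_fun_partial_deriv:
  fixes f :: "complex ^ 'n::finite \<Rightarrow> complex"
  assumes "entire_fun f" shows "entire_fun (partial_deriv i f)"
  unfolding entire_fun_def
proof
  fix z0 :: "complex ^ 'n"
  define e :: "complex ^ 'n" where "e = axis i 1"
  \<comment> \<open>\<open>leibniz_rule\<close> takes the derivative of the integrand as a bounded
    linear operator, so the linear form with coefficients \<open>c j z x\<close> is assembled from
    coordinate projections.\<close>
  define B where "B = (\<lambda>j. Blinfun (\<lambda>v :: complex ^ 'n. v $ j))"
  define c where "c = (\<lambda>j z x. partial_deriv j f (z + unit_circle x *s e) / unit_circle x)"
  define fx where "fx = (\<lambda>z x. \<Sum>j\<in>UNIV. blinfun_mult_right (c j z x) o\<^sub>L B j)"
  have B: "blinfun_apply (B j) v = v $ j" for j v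
    unfolding B_def by (simp add: bounded_linear_Blinfun_apply bounded_linear_vec_nth)
  have fx: "blinfun_apply (fx z x) v = (\<Sum>j\<in>UNIV. v $ j * c j z x)" for z x v
    by (simp add: fx_def blinfun.sum_left B mult.commute)
  have contc: "continuous_on (UNIV \<times> cbox 0 (1::real)) (\<lambda>(z, x). c j z x)" for j
    unfolding case_prod_unfold c_def
    by (intro continuous_intros continuous_on_compose2[OF continuous_partial_deriv[OF assms, of j]]
        bounded_linear.continuous_on[OF bounded_linear_vec_scaleC_left]) auto
  have contfx: "continuous_on (UNIV \<times> cbox 0 (1::real)) (\<lambda>(z, x). fx z x)"
    using contc unfolding case_prod_unfold fx_def
    by (intro continuous_intros bounded_linear.continuous_on[OF bounded_linear_blinfun_mult_right])
  have "((\<lambda>z. integral (cbox 0 1) (\<lambda>x. f (z + unit_circle x *s e) / unit_circle x)) has_derivative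
      blinfun_apply (integral (cbox 0 1) (fx z0))) (at z0 within UNIV)"
  proof (rule leibniz_rule[OF _ _ contfx])
    fix z :: "complex ^ 'n" and x :: real
    have "((\<lambda>z. f (z + unit_circle x *s e)) has_derivative
        (\<lambda>v. \<Sum>j\<in>UNIV. v $ j * partial_deriv j f (z + unit_circle x *s e))) (at z)"
      by (rule has_derivative_compose[of "\<lambda>z. z + unit_circle x *s e" "\<lambda>v. v", OF _ entire_fun_has_derivative[OF assms]])
         (auto intro!: derivative_eq_intros)
    hence "((\<lambda>z. f (z + unit_circle x *s e) / unit_circle x) has_derivative
        (\<lambda>v. (\<Sum>j\<in>UNIV. v $ j * partial_deriv j f (z + unit_circle x *s e)) / unit_circle x)) (at z)"
      by (rule bounded_linear.has_derivative[OF bounded_linear_divide])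
    moreover have "(\<lambda>v. (\<Sum>j\<in>UNIV. v $ j * partial_deriv j f (z + unit_circle x *s e)) / unit_circle x) =
        blinfun_apply (fx z x)"
      by (simp add: fx c_def sum_divide_distrib fun_eq_iff)
    ultimately show "((\<lambda>z. f (z + unit_circle x *s e) / unit_circle x) has_derivative blinfun_apply (fx z x)) (at z within UNIV)"
      by simp
  next
    fix z :: "complex ^ 'n"
    show "(\<lambda>x. f (z + unit_circle x *s e) / unit_circle x) integrable_on cbox 0 1"
      by (intro integrable_continuous continuous_intros continuous_on_compose2[OF entire_fun_imp_continuous[OF assms, of UNIV]]
        bounded_linear.continuous_on[OF bounded_linear_vec_scaleC_left]) auto
  qed auto
  moreover have "blinfun_apply (integral (cbox 0 1) (fx z0)) v =
       integral (cbox 0 1) (\<lambda>x. \<Sum>j\<in>UNIV. v $ j * c j z0 x)" for v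
  proof -
    have "fx z0 integrable_on cbox 0 1"
      by (intro integrable_continuous continuous_on_compose2[OF contfx, of _ "\<lambda>x. (z0, x)", simplified])
         (auto intro!: continuous_intros)
    from blinfun_apply_integral[OF this, of v] show ?thesis
      by (simp add: fx)
  qed
  ultimately show "\<exists>D. (partial_deriv i f has_derivative D) (at z0) \<and> (\<forall>c v. D (c *s v) = c * D v)"
    by (intro exI[of _ "blinfun_apply (integral (cbox 0 1) (fx z0))"])
       (simp add: partial_deriv_eq_integral[OF assms, abs_def] e_def mult.assoc flip: sum_distrib_left)
qed

section \<open>Polynomial functions\<close>

text \<open>Lagrange interpolation, with one node \<open>x0\<close> removed by synthetic division:
  the top coefficient of a polynomial is that of the quotient, whose values at the other nodes are
  difference quotients. Lower coefficients follow after subtracting the top monomial.\<close>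

lemma coeff_sum_of_values_on_set:
  fixes X :: "'a::field set"
  assumes "card X = Suc M"
  shows "\<exists>a. \<forall>p. degree p \<le> M \<longrightarrow> coeff p j = (\<Sum>x\<in>X. a x * poly p x)"
  using assms
proof (induction M arbitrary: X j)
  case 0
  then obtain x where X: "X = {x}"
    by (auto simp: card_Suc_eq)
  show ?case
  proof (intro exI[of _ "\<lambda>_. if j = 0 then 1 else 0"] allI impI)
    fix p :: "'a poly" assume "degree p \<le> 0"
    then obtain c where "p = [:c:]" by (metis degree_0_id le_zero_eq of_nat_0 degree_eq_zeroE)
    thus "coeff p j = (\<Sum>x\<in>X. (if j = 0 then 1 else 0) * poly p x)"
      by (cases j) (auto simp: X)
  qed
next
  case (Suc M)
  then obtain x0 Y where X: "X = insert x0 Y" "x0 \<notin> Y" and Y: "card Y = Suc M" "finite Y"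
    by (metis card_Suc_eq card.infinite nat.distinct(1))
  obtain b where b: "\<And>p. degree p \<le> M \<Longrightarrow> coeff p M = (\<Sum>y\<in>Y. b y * poly p y)"
    using Suc.IH[OF Y(1), of M] by blast
  \<comment> \<open>The weights of the divided difference on \<open>X\<close>: every difference
    quotient contributes to its own node and, with the opposite sign, to \<open>x0\<close>.\<close>
  define a where "a = (\<lambda>x. if x = x0 then - (\<Sum>y\<in>Y. b y / (y - x0)) else b x / (x - x0))"
  have a: "coeff p (Suc M) = (\<Sum>x\<in>X. a x * poly p x)" if "degree p \<le> Suc M" for p
  proof -
    define r where "r = synthetic_div p x0"
    have p: "p = [:-x0, 1:] * r + [:poly p x0:]"
      unfolding r_def by (rule synthetic_div_correct'[symmetric])
    have "degree r \<le> M" using that by (simp add: r_def degree_synthetic_div)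
    hence "coeff r (Suc M) = 0"
      by (simp add: coeff_eq_0)
    hence "coeff p (Suc M) = coeff r M"
      by (subst p) simp
    also have "\<dots> = (\<Sum>y\<in>Y. b y * poly r y)"
      using b \<open>degree r \<le> M\<close> by blast
    also have "\<dots> = (\<Sum>y\<in>Y. b y * ((poly p y - poly p x0) / (y - x0)))"
    proof (intro sum.cong refl arg_cong2[where f = times])
      fix y assume "y \<in> Y"
      hence "y - x0 \<noteq> 0" using X by auto
      moreover have "poly p y = (y - x0) * poly r y + poly p x0"
        by (subst p) (simp add: algebra_simps)
      ultimately show "poly r y = (poly p y - poly p x0) / (y - x0)" by simp
    qed
    also have "\<dots> = (\<Sum>y\<in>Y. b y / (y - x0) * poly p y) - (\<Sum>y\<in>Y. b y / (y - x0)) * poly p x0"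
      by (simp add: sum_distrib_right sum_subtractf[symmetric] right_diff_distrib diff_divide_distrib)
    also have "(\<Sum>y\<in>Y. b y / (y - x0) * poly p y) = (\<Sum>y\<in>Y. a y * poly p y)"
      using X by (intro sum.cong) (auto simp: a_def)
    finally show ?thesis
      using X Y by (simp add: a_def)
  qed
  show ?case
  proof (cases "j = Suc M")
    case True
    with a show ?thesis by (intro exI[of _ a]) simp
  next
    case False
    obtain b where b: "\<And>p. degree p \<le> M \<Longrightarrow> coeff p j = (\<Sum>y\<in>Y. b y * poly p y)"
      using Suc.IH[OF Y(1), of j] by blast
    \<comment> \<open>\<open>C\<close> is what the formula for degree at most M returns on the
      monomial of degree M + 1; subtracting \<open>C\<close> times the top coefficient corrects that
      formula.\<close>
    define C where "C = (\<Sum>y\<in>Y. b y * y ^ Suc M)"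
    have "coeff p j = (\<Sum>x\<in>X. ((if x \<in> Y then b x else 0) - C * a x) * poly p x)"
      if "degree p \<le> Suc M" for p
    proof -
      define p' where "p' = p - monom (coeff p (Suc M)) (Suc M)"
      have "coeff p' i = 0" if "i > M" for i
        using that \<open>degree p \<le> Suc M\<close> by (cases "i = Suc M") (auto simp: p'_def coeff_eq_0)
      hence "degree p' \<le> M" by (intro degree_le) auto
      have "coeff p j = coeff p' j" using False by (simp add: p'_def)
      also have "\<dots> = (\<Sum>y\<in>Y. b y * poly p' y)" using b \<open>degree p' \<le> M\<close> by blast
      also have "\<dots> = (\<Sum>y\<in>Y. b y * poly p y) - C * coeff p (Suc M)"
        unfolding C_def sum_distrib_right
        by (simp add: p'_def poly_monom right_diff_distrib sum_subtractf mult_ac)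
      also have "(\<Sum>y\<in>Y. b y * poly p y) = (\<Sum>x\<in>X. (if x \<in> Y then b x else 0) * poly p x)"
        unfolding X(1) using X(2) Y(2) by (subst sum.insert) (auto intro!: sum.cong)
      also have "coeff p (Suc M) = (\<Sum>x\<in>X. a x * poly p x)"
        by (rule a[OF that])
      finally show ?thesis
        by (simp add: sum_subtractf left_diff_distrib sum_distrib_left mult.assoc)
    qed
    thus ?thesis
      by (intro exI[of _ "\<lambda>x. (if x \<in> Y then b x else 0) - C * a x"] allI impI)
  qed
qed

text \<open>Nodes and weights are the same for all polynomials. In a family of polynomials the
  coefficients are thus fixed combinations of values at fixed points and inherit holomorphy and
  polynomial growth from them.\<close>

lemma coeff_sum_of_values:
  fixes M j :: nat
  obtains a :: "nat \<Rightarrow> complex" where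
    "\<And>p. degree p \<le> M \<Longrightarrow> coeff p j = (\<Sum>i\<le>M. a i * poly p (of_nat i))"
proof -
  have inj: "inj_on (of_nat :: nat \<Rightarrow> complex) {..M}"
    by (auto simp: inj_on_def)
  hence "card ((of_nat :: nat \<Rightarrow> complex) ` {..M}) = Suc M"
    by (simp add: card_image)
  from coeff_sum_of_values_on_set[OF this, of j] obtain a where
    a: "\<forall>p. degree p \<le> M \<longrightarrow> coeff p j = (\<Sum>x\<in>(of_nat :: nat \<Rightarrow> complex) ` {..M}. a x * poly p x)" ..
  show ?thesis
  proof (rule that[of "\<lambda>i. a (of_nat i)"])
    fix p :: "complex poly" assume "degree p \<le> M"
    with a have "coeff p j = (\<Sum>x\<in>(of_nat :: nat \<Rightarrow> complex) ` {..M}. a x * poly p x)" by simp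
    also have "\<dots> = (\<Sum>i\<le>M. a (of_nat i) * poly p (of_nat i))"
      by (subst sum.reindex[OF inj]) simp
    finally show "coeff p j = (\<Sum>i\<le>M. a (of_nat i) * poly p (of_nat i))" .
  qed
qed

section \<open>Closure properties and characterizations of polynomial functions\<close>

lemma polynomial_fun_monomial:
  "polynomial_fun (\<lambda>z :: complex ^ 'n::finite. c * (\<Prod>i\<in>UNIV. (z $ i) ^ \<alpha> i))"
  unfolding polynomial_fun_def by (rule exI[of _ "{\<alpha>}"], rule exI[of _ "\<lambda>_. c"]) simp

lemma polynomial_fun_add:
  fixes p q :: "complex ^ 'n::finite \<Rightarrow> complex"
  assumes "polynomial_fun p" "polynomial_fun q"
  shows "polynomial_fun (\<lambda>z. p z + q z)"
proof -
  obtain A :: "('n \<Rightarrow> nat) set" and c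
    where A: "finite A" "p = (\<lambda>z. \<Sum>\<alpha>\<in>A. c \<alpha> * (\<Prod>i\<in>UNIV. (z $ i) ^ \<alpha> i))"
    using assms(1) unfolding polynomial_fun_def by blast
  obtain B :: "('n \<Rightarrow> nat) set" and d
    where B: "finite B" "q = (\<lambda>z. \<Sum>\<beta>\<in>B. d \<beta> * (\<Prod>i\<in>UNIV. (z $ i) ^ \<beta> i))"
    using assms(2) unfolding polynomial_fun_def by blast
  define c' where "c' = (\<lambda>\<alpha>. if \<alpha> \<in> A then c \<alpha> else 0)"
  define d' where "d' = (\<lambda>\<alpha>. if \<alpha> \<in> B then d \<alpha> else 0)"
  have "p z = (\<Sum>\<alpha>\<in>A \<union> B. c' \<alpha> * (\<Prod>i\<in>UNIV. (z $ i) ^ \<alpha> i))" for z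
    unfolding A(2) c'_def using A(1) B(1) by (intro sum.mono_neutral_cong_left) auto
  moreover have "q z = (\<Sum>\<alpha>\<in>A \<union> B. d' \<alpha> * (\<Prod>i\<in>UNIV. (z $ i) ^ \<alpha> i))" for z
    unfolding B(2) d'_def using A(1) B(1) by (intro sum.mono_neutral_cong_left) auto
  ultimately have "(\<lambda>z. p z + q z) = (\<lambda>z. \<Sum>\<alpha>\<in>A \<union> B. (c' \<alpha> + d' \<alpha>) * (\<Prod>i\<in>UNIV. (z $ i) ^ \<alpha> i))"
    by (simp add: fun_eq_iff distrib_right sum.distrib)
  thus ?thesis
    unfolding polynomial_fun_def using A(1) B(1) by (intro exI[of _ "A \<union> B"] exI[of _ "\<lambda>\<alpha>. c' \<alpha> + d' \<alpha>"]) auto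
qed

lemma polynomial_fun_component: "polynomial_fun (\<lambda>z :: complex ^ 'n::finite. z $ i)"
proof -
  have "(\<Prod>j\<in>UNIV. (z $ j) ^ (if j = i then 1 else 0)) = z $ i" for z :: "complex ^ 'n"
    by (simp add: if_distrib[of "\<lambda>k. _ ^ k"] prod.delta cong: if_cong)
  thus ?thesis
    using polynomial_fun_monomial[of 1 "\<lambda>j. if j = i then 1 else 0"] by simp
qed

lemma polynomial_fun_sum:
  assumes "\<And>x. x \<in> A \<Longrightarrow> polynomial_fun (f x)"
  shows "polynomial_fun (\<lambda>z. \<Sum>x\<in>A. f x z)"
  using assms
  by (induction A rule: infinite_finite_induct) (auto intro: polynomial_fun_const polynomial_fun_add)

lemma polynomial_fun_power:
  assumes "polynomial_fun f" shows "polynomial_fun (\<lambda>z. f z ^ k)"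
  by (induction k) (auto intro: polynomial_fun_const polynomial_fun_mult assms)

lemma polynomial_fun_uminus:
  assumes "polynomial_fun f" shows "polynomial_fun (\<lambda>z. - f z)"
  using polynomial_fun_mult[OF polynomial_fun_const[of "-1"] assms] by simp

lemma polynomial_fun_induct [consumes 1, case_names const component add mult]:
  fixes p :: "complex ^ 'n::finite \<Rightarrow> complex"
  assumes p: "polynomial_fun p"
    and const: "\<And>c. P (\<lambda>z. c)"
    and component: "\<And>i. P (\<lambda>z. z $ i)"
    and add: "\<And>f g. P f \<Longrightarrow> P g \<Longrightarrow> P (\<lambda>z. f z + g z)"
    and mult: "\<And>f g. P f \<Longrightarrow> P g \<Longrightarrow> P (\<lambda>z. f z * g z)"
  shows "P p"
proof -
  obtain A :: "('n \<Rightarrow> nat) set" and c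
    where A: "finite A" "p = (\<lambda>z. \<Sum>\<alpha>\<in>A. c \<alpha> * (\<Prod>i\<in>UNIV. (z $ i) ^ \<alpha> i))"
    using p unfolding polynomial_fun_def by blast
  have pow: "P (\<lambda>z. (z $ i) ^ k)" for i k
    by (induction k) (auto intro: const component mult)
  have "P (\<lambda>z. \<Prod>i\<in>I. (z $ i) ^ \<alpha> i)" if "finite I" for I and \<alpha> :: "'n \<Rightarrow> nat"
    using that by (induction I rule: finite_induct) (auto intro: const mult pow)
  hence "P (\<lambda>z. c \<alpha> * (\<Prod>i\<in>UNIV. (z $ i) ^ \<alpha> i))" for \<alpha>
    by (intro mult const) auto
  with A(1) show ?thesis
    unfolding A(2) by (induction A rule: finite_induct) (auto intro: const add)
qed

lemma entire_fun_affine: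
  assumes "entire_fun (g :: complex ^ 'n::finite \<Rightarrow> complex)"
  shows "entire_fun (\<lambda>z. g (c *s z + w))"
  unfolding entire_fun_def
proof
  fix z :: "complex ^ 'n"
  have "bounded_linear (\<lambda>z :: complex ^ 'n. c *s z)"
    by (rule linear_conv_bounded_linear[THEN iffD1], rule linearI)
       (simp_all add: vec_eq_iff distrib_left scaleR_conv_of_real[where 'a = complex])
  hence "((\<lambda>z. c *s z + w) has_derivative (\<lambda>v. c *s v)) (at z)"
    using bounded_linear_imp_has_derivative by (auto intro!: derivative_eq_intros)
  from has_derivative_compose[OF this entire_fun_has_derivative[OF assms]]
  show "\<exists>D. ((\<lambda>z. g (c *s z + w)) has_derivative D) (at z) \<and> (\<forall>c v. D (c *s v) = c * D v)"
    by (intro exI[of _ "\<lambda>v. \<Sum>i\<in>UNIV. (c *s v) $ i * partial_deriv i g (c *s z + w)"])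
       (auto simp: sum_distrib_left mult_ac)
qed

lemma partial_deriv_scale:
  assumes "entire_fun (g :: complex ^ 'n::finite \<Rightarrow> complex)"
  shows "partial_deriv i (\<lambda>z. g (c *s z)) z = c * partial_deriv i g (c *s z)"
proof -
  have "bounded_linear (\<lambda>z :: complex ^ 'n. c *s z)"
    by (rule linear_conv_bounded_linear[THEN iffD1], rule linearI)
       (simp_all add: vec_eq_iff distrib_left scaleR_conv_of_real[where 'a = complex])
  hence "((\<lambda>z. c *s z) has_derivative (\<lambda>v. c *s v)) (at z)"
    by (rule bounded_linear_imp_has_derivative)
  from has_derivative_compose[OF this entire_fun_has_derivative[OF assms]]
  have "partial_deriv i (\<lambda>z. g (c *s z)) z = (\<Sum>j\<in>UNIV. (c *s axis i 1) $ j * partial_deriv j g (c *s z))"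
    by (rule partial_deriv_unique) (auto simp: sum_distrib_left mult_ac)
  also have "\<dots> = (\<Sum>j\<in>UNIV. if j = i then c * partial_deriv j g (c *s z) else 0)"
    by (intro sum.cong) (auto simp: axis_def)
  finally show ?thesis by simp
qed

lemma partial_deriv_cmult:
  assumes "entire_fun (g :: complex ^ 'n::finite \<Rightarrow> complex)"
  shows "partial_deriv i (\<lambda>z. c * g z) z = c * partial_deriv i g z"
proof -
  have "((\<lambda>z. c * g z) has_derivative (\<lambda>v. c * (\<Sum>j\<in>UNIV. v $ j * partial_deriv j g z))) (at z)"
    using entire_fun_has_derivative[OF assms] by (rule has_derivative_mult_right)
  hence "partial_deriv i (\<lambda>z. c * g z) z = c * (\<Sum>j\<in>UNIV. axis i 1 $ j * partial_deriv j g z)"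
    by (rule partial_deriv_unique) (auto simp: sum_distrib_left mult_ac)
  also have "(\<Sum>j\<in>UNIV. axis i 1 $ j * partial_deriv j g z) = (\<Sum>j\<in>UNIV. if j = i then partial_deriv j g z else 0)"
    by (intro sum.cong) (auto simp: axis_def)
  finally show ?thesis by simp
qed

text \<open>Euler's formula reduces the degree.\<close>

lemma polynomial_fun_homogeneous:
  fixes g :: "complex ^ 'n::finite \<Rightarrow> complex"
  assumes "entire_fun g" "\<And>t z. t \<noteq> 0 \<Longrightarrow> g (t *s z) = t ^ k * g z"
  shows "polynomial_fun g"
  using assms
proof (induction k arbitrary: g)
  case 0
  have "g z = g 0" for z
  proof -
    have "(\<lambda>t. g (t *s z)) \<midarrow>0\<rightarrow> g (0 *s z)"
      using DERIV_isCont[OF entire_fun_line_derivative[OF "0.prems"(1), of 0 z 0]]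
      by (simp add: isCont_def)
    moreover have "(\<lambda>t. g (t *s z)) \<midarrow>0\<rightarrow> g z"
      by (rule tendsto_eventually) (auto simp: eventually_at "0.prems"(2) intro!: exI[of _ 1])
    ultimately show ?thesis
      using LIM_unique by fastforce
  qed
  hence "g = (\<lambda>z. g 0)" by blast
  thus ?case using polynomial_fun_const by metis
next
  case (Suc k)
  have pd: "polynomial_fun (partial_deriv i g)" for i
  proof (rule Suc.IH)
    show "entire_fun (partial_deriv i g)" by (rule entire_fun_partial_deriv[OF Suc.prems(1)])
    fix t z assume t: "(t :: complex) \<noteq> 0"
    have "(\<lambda>z. g (t *s z)) = (\<lambda>z. t ^ Suc k * g z)"
      using t Suc.prems(2) by blast
    hence "t * partial_deriv i g (t *s z) = t ^ Suc k * partial_deriv i g z"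
      by (metis partial_deriv_scale[OF Suc.prems(1)] partial_deriv_cmult[OF Suc.prems(1)])
    thus "partial_deriv i g (t *s z) = t ^ k * partial_deriv i g z"
      using t by simp
  qed
  have "g z = 1 / of_nat (Suc k) * (\<Sum>i\<in>UNIV. z $ i * partial_deriv i g z)" for z
  proof -
    have "((\<lambda>t. g (0 + t *s z)) has_field_derivative (\<Sum>i\<in>UNIV. z $ i * partial_deriv i g (0 + 1 *s z))) (at 1)"
      by (rule entire_fun_line_derivative[OF Suc.prems(1)])
    hence 1: "((\<lambda>t. g (t *s z)) has_field_derivative (\<Sum>i\<in>UNIV. z $ i * partial_deriv i g z)) (at 1)"
      by simp
    have "((\<lambda>t. t ^ Suc k * g z) has_field_derivative (of_nat (Suc k) * 1 ^ k) * g z) (at 1)"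
      by (auto intro!: derivative_eq_intros simp del: power_Suc)
    moreover have "\<forall>\<^sub>F t in nhds 1. t ^ Suc k * g z = g (t *s z)"
      unfolding eventually_nhds
      by (intro exI[of _ "- {0}"] conjI ballI Suc.prems(2)[symmetric]) auto
    ultimately have "((\<lambda>t. g (t *s z)) has_field_derivative (of_nat (Suc k) * 1 ^ k) * g z) (at 1)"
      by (rule DERIV_cong_ev[OF refl _ refl, THEN iffD1, rotated])
    from DERIV_unique[OF 1 this] show ?thesis by (simp add: field_simps del: of_nat_Suc)
  qed
  hence "g = (\<lambda>z. 1 / of_nat (Suc k) * (\<Sum>i\<in>UNIV. z $ i * partial_deriv i g z))" by blast
  moreover have "polynomial_fun \<dots>"
    by (intro polynomial_fun_mult polynomial_fun_const polynomial_fun_sum polynomial_fun_component pd)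
  ultimately show ?case by simp
qed

text \<open>The coefficient of t^j in g(t z) is entire in z, by interpolation with a degree bound
  common to all lines, and homogeneous of degree j, hence a polynomial. At t = 1 the finitely many
  coefficients add up to g.\<close>

lemma polynomial_fun_if_polynomial_on_lines:
  fixes g :: "complex ^ 'n::finite \<Rightarrow> complex"
  assumes g: "entire_fun g"
    and lines: "\<And>z. \<exists>p. degree p \<le> M \<and> (\<forall>t. g (t *s z) = poly p t)"
  shows "polynomial_fun g"
proof -
  obtain P where P: "\<And>z. degree (P z) \<le> M" "\<And>z t. g (t *s z) = poly (P z) t"
    using lines by metis
  have "polynomial_fun (\<lambda>z. coeff (P z) j)" for j
  proof -
    obtain a where a: "\<And>p. degree p \<le> M \<Longrightarrow> coeff p j = (\<Sum>i\<le>M. a i * poly p (of_nat i :: complex))"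
      using coeff_sum_of_values by blast
    show ?thesis
    proof (rule polynomial_fun_homogeneous)
      have "(\<lambda>z. coeff (P z) j) = (\<lambda>z. \<Sum>i\<le>M. a i * g (of_nat i *s z + 0))"
        by (simp add: a P)
      moreover have "entire_fun \<dots>"
        by (intro entire_fun_sum entire_fun_mult entire_fun_const entire_fun_affine g)
      ultimately show "entire_fun (\<lambda>z. coeff (P z) j)" by simp
    next
      fix t z
      have "poly (P (t *s z)) s = poly (pcompose (P z) [:0, t:]) s" for s
        using P(2)[of s "t *s z"] P(2)[of "s * t" z] by (simp add: poly_pcompose)
      hence "P (t *s z) = pcompose (P z) [:0, t:]"
        by (intro poly_eq_poly_eq_iff[THEN iffD1] ext)
      thus "coeff (P (t *s z)) j = t ^ j * coeff (P z) j"
        by (simp add: coeff_pcompose_linear)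
    qed
  qed
  moreover have "g z = (\<Sum>j\<le>M. coeff (P z) j)" for z
  proof -
    have "g z = poly (P z) 1" using P(2)[of 1 z] by simp
    also have "\<dots> = (\<Sum>j\<le>degree (P z). coeff (P z) j)" by (simp add: poly_altdef)
    also have "\<dots> = (\<Sum>j\<le>M. coeff (P z) j)"
      using P(1) by (intro sum.mono_neutral_left) (auto simp: coeff_eq_0)
    finally show ?thesis .
  qed
  ultimately have "polynomial_fun (\<lambda>z. \<Sum>j\<le>M. coeff (P z) j)" by (intro polynomial_fun_sum)
  thus ?thesis using \<open>\<And>z. g z = _ z\<close> by presburger
qed

section \<open>Growth\<close>

lemma holomorphic_polynomial_growth:
  assumes "f holomorphic_on UNIV" "\<And>t. A \<le> norm t \<Longrightarrow> norm (f t) \<le> B * norm t ^ n"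
  shows "\<exists>p. degree p \<le> n \<and> f = poly p"
proof -
  define p where "p = (\<Sum>k\<le>n. monom ((deriv ^^ k) f 0 / fact k) k)"
  have "degree p \<le> n"
    unfolding p_def by (intro degree_sum_le) (auto intro: order.trans[OF degree_monom_le])
  moreover have "f = poly p"
    unfolding p_def by (rule ext, subst Liouville_polynomial[OF assms]) (auto simp: poly_sum poly_monom)
  ultimately show ?thesis by blast
qed

text \<open>
  Borel--Caratheodory: the Schwarz lemma applied to $w/(2A-w)$ bounds $|w|$ by $2A$ on half the disc
  on which the real part of $w$ is less than $A$.
\<close>

lemma norm_bound_from_Re_bound:
  assumes hol: "w holomorphic_on UNIV" and w0: "w 0 = 0" and R: "R > 0"
    and Re: "\<And>t. norm t < R \<Longrightarrow> Re (w t) < A" and t: "2 * norm t \<le> R"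
  shows "norm (w t) \<le> 2 * A"
proof -
  have A: "A > 0" using Re[of 0] w0 R by simp
  define \<phi> where "\<phi> = (\<lambda>s. w (of_real R * s) / (2 * of_real A - w (of_real R * s)))"
  have lt: "norm (w s) < norm (2 * of_real A - w s)" if "norm s < R" for s
  proof -
    have "Re (w s) < A" by (rule Re[OF that])
    hence "A * Re (w s) < A * A" using A by simp
    hence "(Re (w s))\<^sup>2 < (2 * A - Re (w s))\<^sup>2"
      by (simp add: power2_eq_square algebra_simps)
    thus ?thesis
      unfolding cmod_def by (intro real_sqrt_less_mono) simp
  qed
  have inball: "norm (of_real R * s) < R" if "norm s < 1" for s :: complex
    using that R by (simp add: norm_mult)
  have nz: "2 * of_real A - w (of_real R * s) \<noteq> 0" if "norm s < 1" for s
    using lt[OF inball[OF that]] by auto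
  have "\<phi> holomorphic_on ball 0 1"
    unfolding \<phi>_def using nz
    by (intro holomorphic_intros holomorphic_on_compose_gen[OF _ hol, unfolded o_def]) auto
  moreover have "\<phi> 0 = 0" by (simp add: \<phi>_def w0)
  moreover have "norm (\<phi> s) < 1" if "norm s < 1" for s
  proof -
    have "norm (w (of_real R * s)) < norm (2 * of_real A - w (of_real R * s))"
      by (rule lt[OF inball[OF that]])
    thus ?thesis unfolding \<phi>_def norm_divide
      by (subst divide_less_eq_1_pos) (auto intro: le_less_trans[OF norm_ge_zero])
  qed
  moreover define s where "s = t / of_real R"
  have s: "norm s \<le> 1 / 2" "of_real R * s = t"
    using t R by (auto simp: s_def norm_divide field_simps)
  ultimately have "norm (\<phi> s) \<le> norm s"
    by (intro Schwarz_Lemma(1)) auto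
  hence "norm (\<phi> s) \<le> 1 / 2" using s by simp
  moreover have "norm (\<phi> s) = norm (w t) / norm (2 * of_real A - w t)"
    by (simp add: \<phi>_def s norm_divide)
  moreover have "2 * of_real A - w t \<noteq> 0" using nz[of s] s by simp
  ultimately have "2 * norm (w t) \<le> norm (2 * of_real A - w t)"
    by (simp add: field_simps)
  also have "\<dots> \<le> 2 * A + norm (w t)"
    using A by (intro order.trans[OF norm_triangle_ineq4]) (simp add: norm_mult)
  finally show ?thesis by simp
qed

text \<open>On the disc of radius 2 |t|, Borel-Caratheodory turns the one-sided bound on the real
  part into a bound of the same order on the modulus at t, and Liouville's theorem for polynomial
  growth applies.\<close>

lemma polynomial_if_Re_bounded:
  assumes hol: "w holomorphic_on UNIV" and C: "C \<ge> 0" and Re: "\<And>t. Re (w t) \<le> C * (1 + norm t) ^ N"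
  shows "\<exists>p. degree p \<le> N \<and> w = poly p"
proof -
  define v where "v = (\<lambda>t. w t - w 0)"
  have holv: "v holomorphic_on UNIV" unfolding v_def by (intro holomorphic_intros hol)
  \<comment> \<open>The modulus of \<open>w 0\<close> pays for the normalization
    \<open>v 0 = 0\<close>; the extra 1 makes the bound strict, as
    \<open>norm_bound_from_Re_bound\<close> asks.\<close>
  define D where "D = norm (w 0) + 1"
  have D: "D > 0" by (simp add: D_def add_nonneg_pos)
  have Rev: "Re (v t) < C * (1 + norm t) ^ N + D" for t
    using Re[of t] abs_Re_le_cmod[of "w 0"] by (simp add: v_def D_def)
  have "norm (v t) \<le> (2 * (C * 3 ^ N + D)) * norm t ^ N" if t: "1 \<le> norm t" for t
  proof -
    have "norm (v t) \<le> 2 * (C * (1 + 2 * norm t) ^ N + D)"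
    proof (rule norm_bound_from_Re_bound[OF holv])
      fix s :: complex assume s: "norm s < 2 * norm t"
      have "(1 + norm s) ^ N \<le> (1 + 2 * norm t) ^ N"
        using s by (intro power_mono) auto
      with C have "C * (1 + norm s) ^ N \<le> C * (1 + 2 * norm t) ^ N"
        by (rule mult_left_mono[rotated])
      with Rev[of s] show "Re (v s) < C * (1 + 2 * norm t) ^ N + D" by linarith
    qed (use t in \<open>auto simp: v_def\<close>)
    also have "(1 + 2 * norm t) ^ N \<le> (3 * norm t) ^ N"
      using t by (intro power_mono) auto
    hence "2 * (C * (1 + 2 * norm t) ^ N + D) \<le> 2 * (C * (3 * norm t) ^ N + D * norm t ^ N)"
      using C D t by (intro mult_left_mono add_mono) (auto simp: mult_le_cancel_left1)
    also have "\<dots> = (2 * (C * 3 ^ N + D)) * norm t ^ N"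
      by (simp add: power_mult_distrib algebra_simps)
    finally show ?thesis .
  qed
  from holomorphic_polynomial_growth[OF holv this] obtain p where p: "degree p \<le> N" "v = poly p"
    by blast
  have "w = poly (p + [:w 0:])"
  proof
    fix t
    have "w t - w 0 = poly p t"
      using fun_cong[OF p(2), of t] unfolding v_def .
    thus "w t = poly (p + [:w 0:]) t"
      by (metis diff_add_cancel poly_add poly_pCons poly_0 mult_zero_right add.right_neutral)
  qed
  moreover have "degree (p + [:w 0:]) \<le> N"
    using p by (intro degree_add_le) auto
  ultimately show ?thesis by blast
qed

text \<open>Every zero of \<open>F\<close> is a zero of \<open>q\<close>, so zeros are divided out
  of \<open>F\<close> and \<open>q\<close> together while \<open>h\<close> stays fixed. The constant
  \<open>C\<close> may grow at each division but the exponent \<open>N\<close> does not, and so it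
  still bounds the degree of \<open>w\<close> at the end, when \<open>F\<close> has no zeros and the
  real part of its logarithm has polynomial growth.\<close>

lemma finite_order_divisor_of_polynomial:
  fixes F h :: "complex \<Rightarrow> complex"
  assumes "F holomorphic_on UNIV" "h holomorphic_on UNIV" "C \<ge> 0"
    and "\<And>t. norm (F t) \<le> exp (C * (1 + norm t) ^ N)"
    and "\<And>t. F t * h t = poly q t" "q \<noteq> 0"
  shows "\<exists>r w s. lead_coeff r = 1 \<and> degree w \<le> N \<and> q = r * s \<and>
           (\<forall>t. F t = poly r t * exp (poly w t)) \<and> (\<forall>t. h t = poly s t * exp (- poly w t))"
  using assms
proof (induction "degree q" arbitrary: q F C rule: less_induct)
  case less
  show ?case
  proof (cases "\<exists>a. F a = 0")
    case False
    obtain g where g: "g holomorphic_on UNIV" "\<And>t. exp (g t) = F t"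
      using holomorphic_logarithm_exists[of UNIV F 0] less.prems(1) False by auto
    have "Re (g t) \<le> C * (1 + norm t) ^ N" for t
      using less.prems(4)[of t] by (simp flip: g(2))
    with polynomial_if_Re_bounded[OF g(1) less.prems(3)] obtain w
      where w: "degree w \<le> N" "g = poly w" by blast
    have F: "F t = exp (poly w t)" for t using g(2)[of t] w by simp
    have "h t = poly q t * exp (- poly w t)" for t
      using less.prems(5)[of t] by (simp add: F exp_minus field_simps)
    thus ?thesis using w F by (intro exI[of _ 1] exI[of _ w] exI[of _ q]) auto
  next
    case True
    then obtain a where a: "F a = 0" by blast
    hence "poly q a = 0" using less.prems(5)[of a] by simp
    then obtain q1 where q1: "q = [:-a, 1:] * q1" by (auto simp: poly_eq_0_iff_dvd)
    with less.prems(6) have "q1 \<noteq> 0" by auto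
    hence deg: "degree q1 < degree q" unfolding q1 by (subst degree_mult_eq) auto
    define F1 where "F1 = (\<lambda>z. if z = a then deriv F a else (F z - F a) / (z - a))"
    have hol1: "F1 holomorphic_on UNIV"
      unfolding F1_def using pole_lemma[OF less.prems(1), of a] by simp
    have F: "F t = (t - a) * F1 t" for t by (simp add: F1_def a)
    have "compact (F1 ` cball a 1)"
      using hol1 by (intro compact_continuous_image)
        (auto intro: continuous_on_subset holomorphic_on_imp_continuous_on)
    then obtain K where K: "\<And>t. t \<in> cball a 1 \<Longrightarrow> norm (F1 t) \<le> K"
      by (meson bounded_iff compact_imp_bounded image_eqI)
    \<comment> \<open>Within distance 1 of the zero, division by t - a may enlarge the function;
      there the compactness bound \<open>K\<close> is absorbed into the constant. Elsewhere the
      division does not increase the modulus.\<close>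
    define C' where "C' = C + max K 0"
    have C': "C' \<ge> 0" "C \<le> C'" using less.prems(3) by (auto simp: C'_def)
    have bound: "norm (F1 t) \<le> exp (C' * (1 + norm t) ^ N)" for t
    proof (cases "t \<in> cball a 1")
      case True
      have "1 \<le> (1 + norm t) ^ N" by simp
      have "norm (F1 t) \<le> max K 0" using K[OF True] by simp
      also have "\<dots> \<le> C' * 1" using less.prems(3) by (simp add: C'_def)
      also have "\<dots> \<le> C' * (1 + norm t) ^ N" using C' by (intro mult_left_mono) auto
      also have "\<dots> \<le> exp (C' * (1 + norm t) ^ N)"
        using exp_ge_add_one_self[of "C' * (1 + norm t) ^ N"] by linarith
      finally show ?thesis .
    next
      case False
      hence "1 \<le> norm (t - a)" by (simp add: dist_norm norm_minus_commute)
      hence "norm (F1 t) \<le> norm (t - a) * norm (F1 t)"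
        by (simp add: mult_le_cancel_right1)
      also have "\<dots> = norm (F t)" by (simp add: F norm_mult)
      also have "\<dots> \<le> exp (C * (1 + norm t) ^ N)" by (rule less.prems(4))
      also have "\<dots> \<le> exp (C' * (1 + norm t) ^ N)" using C' by (simp add: mult_right_mono)
      finally show ?thesis .
    qed
    have prod: "F1 t * h t = poly q1 t" for t
    proof -
      have ne: "F1 s * h s = poly q1 s" if "s \<noteq> a" for s
      proof -
        have "(s - a) * (F1 s * h s) = (s - a) * poly q1 s"
          using less.prems(5)[of s] by (simp add: F q1 algebra_simps)
        with that show ?thesis by simp
      qed
      \<comment> \<open>At \<open>a\<close> itself the factor t - a cannot be cancelled, and the
        identity extends to this point by continuity.\<close>
      have "(\<lambda>s. F1 s * h s) \<midarrow>a\<rightarrow> F1 a * h a"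
        using holomorphic_on_imp_continuous_on[OF hol1] holomorphic_on_imp_continuous_on[OF less.prems(2)]
        by (intro tendsto_mult isContD) (auto simp: continuous_on_eq_continuous_at)
      moreover have "(\<lambda>s. F1 s * h s) \<midarrow>a\<rightarrow> poly q1 a"
        by (rule Lim_transform_eventually[OF isContD[OF poly_isCont]])
           (auto simp: eventually_at ne intro!: exI[of _ 1])
      ultimately have "F1 a * h a = poly q1 a" by (rule LIM_unique)
      with ne show ?thesis by (cases "t = a") auto
    qed
    from less.hyps[OF deg hol1 less.prems(2) C'(1) bound prod \<open>q1 \<noteq> 0\<close>]
    obtain r w s where *: "lead_coeff r = 1" "degree w \<le> N" "q1 = r * s"
      "\<forall>t. F1 t = poly r t * exp (poly w t)" "\<forall>t. h t = poly s t * exp (- poly w t)" by blast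
    have "lead_coeff ([:-a, 1:] * r) = 1" using * by (subst lead_coeff_mult) auto
    moreover have "q = ([:-a, 1:] * r) * s" by (simp only: q1 * mult.assoc)
    moreover have "\<forall>t. F t = poly ([:-a, 1:] * r) t * exp (poly w t)"
      using *(4) by (simp add: F algebra_simps)
    ultimately show ?thesis using * by blast
  qed
qed

section \<open>Polynomial growth, and exponentials of it\<close>

definition poly_bounded :: "('a::real_normed_vector \<Rightarrow> real) \<Rightarrow> bool" where
  "poly_bounded g \<longleftrightarrow> (\<exists>C N. C \<ge> 0 \<and> (\<forall>z. g z \<le> C * (1 + norm z) ^ N))"

lemma poly_bounded_const: "poly_bounded (\<lambda>z. c)"
  unfolding poly_bounded_def by (intro exI[of _ "max c 0"] exI[of _ 0]) auto

lemma poly_bounded_norm: "poly_bounded norm"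
  unfolding poly_bounded_def by (intro exI[of _ 1] exI[of _ 1]) auto

lemma poly_bounded_mono: "poly_bounded g \<Longrightarrow> (\<And>z. h z \<le> g z) \<Longrightarrow> poly_bounded h"
  unfolding poly_bounded_def by (meson order.trans)

lemma poly_bounded_add:
  assumes "poly_bounded g" "poly_bounded h"
  shows "poly_bounded (\<lambda>z. g z + h z)"
proof -
  obtain C N D M where *: "C \<ge> 0" "\<And>z. g z \<le> C * (1 + norm z) ^ N" "D \<ge> 0" "\<And>z. h z \<le> D * (1 + norm z) ^ M"
    using assms unfolding poly_bounded_def by blast
  have "g z + h z \<le> (C + D) * (1 + norm z) ^ (N + M)" for z
  proof -
    have "C * (1 + norm z) ^ N \<le> C * (1 + norm z) ^ (N + M)" "D * (1 + norm z) ^ M \<le> D * (1 + norm z) ^ (N + M)"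
      using *(1,3) by (auto intro!: mult_left_mono power_increasing)
    with *(2,4)[of z] show ?thesis by (simp add: distrib_right)
  qed
  thus ?thesis unfolding poly_bounded_def using * by (intro exI[of _ "C + D"] exI) auto
qed

text \<open>Nonnegativity is required because \<open>poly_bounded\<close> is a bound from above
  only. The one-sided form is chosen to admit exponents that may be negative, such as those
  involving \<open>ln C\<close>.\<close>

lemma poly_bounded_mult:
  assumes "poly_bounded g" "poly_bounded h" "\<And>z. g z \<ge> 0" "\<And>z. h z \<ge> 0"
  shows "poly_bounded (\<lambda>z. g z * h z)"
proof -
  obtain C N D M where *: "C \<ge> 0" "\<And>z. g z \<le> C * (1 + norm z) ^ N" "D \<ge> 0" "\<And>z. h z \<le> D * (1 + norm z) ^ M"
    using assms(1,2) unfolding poly_bounded_def by blast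
  have "g z * h z \<le> (C * D) * (1 + norm z) ^ (N + M)" for z
  proof -
    have "g z * h z \<le> (C * (1 + norm z) ^ N) * (D * (1 + norm z) ^ M)"
      using * assms(3,4) by (intro mult_mono) auto
    thus ?thesis by (simp add: power_add mult_ac)
  qed
  thus ?thesis unfolding poly_bounded_def using * by (intro exI[of _ "C * D"] exI) auto
qed

lemma poly_bounded_sum:
  assumes "\<And>x. x \<in> A \<Longrightarrow> poly_bounded (f x)"
  shows "poly_bounded (\<lambda>z. \<Sum>x\<in>A. f x z)"
  using assms
  by (induction A rule: infinite_finite_induct) (auto intro: poly_bounded_const poly_bounded_add)

lemma poly_bounded_power:
  assumes "poly_bounded g" "\<And>z. g z \<ge> 0"
  shows "poly_bounded (\<lambda>z. g z ^ k)"
proof (induction k)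
  case (Suc k)
  show ?case unfolding power_Suc
    by (rule poly_bounded_mult[OF assms(1) Suc assms(2)]) (simp add: assms(2))
qed (simp add: poly_bounded_const)

lemma poly_bounded_compose:
  assumes "poly_bounded g" "poly_bounded (\<lambda>z. norm (h z))"
  shows "poly_bounded (\<lambda>z. g (h z))"
proof -
  obtain C N where *: "C \<ge> 0" "\<And>z. g z \<le> C * (1 + norm z) ^ N"
    using assms unfolding poly_bounded_def by blast
  have "poly_bounded (\<lambda>z. C * (1 + norm (h z)) ^ N)"
    using * by (intro poly_bounded_mult poly_bounded_power poly_bounded_add poly_bounded_const assms) auto
  thus ?thesis by (rule poly_bounded_mono) (rule *)
qed

lemma poly_bounded_polynomial_fun:
  assumes "polynomial_fun p" shows "poly_bounded (\<lambda>z. norm (p z))"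
  using assms
proof (induction rule: polynomial_fun_induct)
  case (component i)
  show ?case by (rule poly_bounded_mono[OF poly_bounded_norm]) (rule Finite_Cartesian_Product.norm_nth_le)
next
  case (add f g)
  show ?case by (rule poly_bounded_mono[OF poly_bounded_add[OF add]]) (rule norm_triangle_ineq)
next
  case (mult f g)
  show ?case unfolding norm_mult by (intro poly_bounded_mult mult) auto
qed (rule poly_bounded_const)

lemma vec_norm_scaleC: "norm (c *s (z :: complex ^ 'n::finite)) = norm c * norm z"
  by (simp add: norm_vec_def L2_set_def norm_mult power_mult_distrib sum_distrib_left[symmetric] real_sqrt_mult)

text \<open>Liouville's theorem on each line through 0, where the exponent \<open>N\<close> bounds
  the degree on all lines at once.\<close>

lemma polynomial_fun_if_poly_bounded:
  assumes "entire_fun g" "poly_bounded (\<lambda>z. norm (g z))"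
  shows "polynomial_fun g"
proof -
  obtain C N where *: "C \<ge> 0" "\<And>z. norm (g z) \<le> C * (1 + norm z) ^ N"
    using assms(2) unfolding poly_bounded_def by blast
  show ?thesis
  proof (rule polynomial_fun_if_polynomial_on_lines[OF assms(1)])
    fix z
    have hol: "(\<lambda>t. g (t *s z)) holomorphic_on UNIV"
      using entire_fun_on_line[OF assms(1), of 0 z] by simp
    have "norm (g (t *s z)) \<le> (C * (1 + norm z) ^ N) * norm t ^ N" if t: "1 \<le> norm t" for t
    proof -
      have "1 + norm t * norm z \<le> norm t * (1 + norm z)" using t by (simp add: algebra_simps)
      hence "(1 + norm t * norm z) ^ N \<le> (norm t * (1 + norm z)) ^ N" by (intro power_mono) auto
      hence "C * (1 + norm t * norm z) ^ N \<le> C * (norm t * (1 + norm z)) ^ N"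
        using * by (intro mult_left_mono)
      with *(2)[of "t *s z"] show ?thesis by (simp add: vec_norm_scaleC power_mult_distrib mult_ac)
    qed
    from holomorphic_polynomial_growth[OF hol this]
    show "\<exists>p. degree p \<le> N \<and> (\<forall>t. g (t *s z) = poly p t)" by metis
  qed
qed

text \<open>
  This is finite order with the bound on the exponent relaxed to polynomial growth, which makes the
  notion visibly closed under sums and products.
\<close>

definition exp_poly_bounded :: "(complex ^ 'n::finite \<Rightarrow> complex) \<Rightarrow> bool" where
  "exp_poly_bounded f \<longleftrightarrow> (\<exists>g. poly_bounded g \<and> (\<forall>z. norm (f z) \<le> exp (g z)))"

lemma exp_poly_boundedE:
  assumes "exp_poly_bounded f"
  obtains C N where "C \<ge> 0" "\<And>z. norm (f z) \<le> exp (C * (1 + norm z) ^ N)"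
proof -
  obtain g where g: "poly_bounded g" "\<And>z. norm (f z) \<le> exp (g z)"
    using assms unfolding exp_poly_bounded_def by blast
  then obtain C N where CN: "C \<ge> 0" "\<And>z. g z \<le> C * (1 + norm z) ^ N"
    unfolding poly_bounded_def by blast
  have "norm (f z) \<le> exp (C * (1 + norm z) ^ N)" for z
    using g(2)[of z] CN(2)[of z] exp_le_cancel_iff order.trans by blast
  with CN(1) show ?thesis by (rule that)
qed

lemma exp_poly_bounded_polynomial_fun:
  assumes "polynomial_fun p" shows "exp_poly_bounded p"
proof -
  have "norm (p z) \<le> exp (norm (p z))" for z
    using exp_ge_add_one_self[of "norm (p z)"] by linarith
  with poly_bounded_polynomial_fun[OF assms] show ?thesis
    unfolding exp_poly_bounded_def by (intro exI[of _ "\<lambda>z. norm (p z)"]) auto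
qed

lemma exp_poly_bounded_mult:
  assumes "exp_poly_bounded f" "exp_poly_bounded g" shows "exp_poly_bounded (\<lambda>z. f z * g z)"
proof -
  obtain a b where *: "poly_bounded a" "\<And>z. norm (f z) \<le> exp (a z)" "poly_bounded b" "\<And>z. norm (g z) \<le> exp (b z)"
    using assms unfolding exp_poly_bounded_def by blast
  have "norm (f z * g z) \<le> exp (a z + b z)" for z
    unfolding norm_mult exp_add using * by (intro mult_mono) auto
  with poly_bounded_add[OF *(1,3)] show ?thesis unfolding exp_poly_bounded_def by blast
qed

lemma exp_poly_bounded_add:
  assumes "exp_poly_bounded f" "exp_poly_bounded g" shows "exp_poly_bounded (\<lambda>z. f z + g z)"
proof -
  \<comment> \<open>These explicit exponents are nonnegative, so each exponential is at most the
    exponential of their sum. The resulting factor 2 is absorbed by \<open>exp 1\<close>.\<close>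
  obtain C N where f: "C \<ge> 0" "\<And>z. norm (f z) \<le> exp (C * (1 + norm z) ^ N)"
    using exp_poly_boundedE[OF assms(1)] by blast
  obtain D M where g: "D \<ge> 0" "\<And>z. norm (g z) \<le> exp (D * (1 + norm z) ^ M)"
    using exp_poly_boundedE[OF assms(2)] by blast
  note * = f g
  let ?a = "\<lambda>z. C * (1 + norm z) ^ N" and ?b = "\<lambda>z. D * (1 + norm z) ^ M"
  have "norm (f z + g z) \<le> exp (1 + ?a z + ?b z)" for z
  proof -
    have ab: "0 \<le> ?a z" "0 \<le> ?b z" using * by auto
    have "norm (f z + g z) \<le> norm (f z) + norm (g z)" by (rule norm_triangle_ineq)
    also have "\<dots> \<le> exp (?a z) + exp (?b z)" by (intro add_mono *)
    also have "\<dots> \<le> exp (?a z + ?b z) + exp (?a z + ?b z)" using ab by (intro add_mono) auto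
    also have "\<dots> = 2 * exp (?a z + ?b z)" by simp
    also have "\<dots> \<le> exp 1 * exp (?a z + ?b z)"
      using exp_ge_add_one_self[of 1] by (intro mult_right_mono) auto
    also have "\<dots> = exp (1 + ?a z + ?b z)" by (simp add: exp_add)
    finally show ?thesis .
  qed
  moreover have "poly_bounded (\<lambda>z. 1 + ?a z + ?b z)"
    using * by (intro poly_bounded_add poly_bounded_mult poly_bounded_power poly_bounded_const poly_bounded_norm) auto
  ultimately show ?thesis unfolding exp_poly_bounded_def by (intro exI[of _ "\<lambda>z. 1 + ?a z + ?b z"]) auto
qed

lemma exp_poly_bounded_if_finite_order:
  assumes "finite_order f" shows "exp_poly_bounded (eval_entire f)"
proof -
  obtain C \<rho> where *: "C > 0" "\<rho> > 0" "\<And>z. norm (eval_entire f z) \<le> C * exp (norm z powr \<rho>)"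
    using assms unfolding finite_order_def by blast
  \<comment> \<open>Raising the exponent from \<rho> to \<open>N\<close> requires a base of at least
    1, hence the passage from \<open>norm z\<close> to \<open>1 + norm z\<close>.\<close>
  define N where "N = nat \<lceil>\<rho>\<rceil>"
  have "norm z powr \<rho> \<le> (1 + norm z) ^ N" for z :: "complex ^ 'a"
  proof -
    have "norm z powr \<rho> \<le> (1 + norm z) powr \<rho>" using *(2) by (intro powr_mono2) auto
    also have "\<dots> \<le> (1 + norm z) powr (real N)"
    proof (rule powr_mono)
      show "\<rho> \<le> real N" unfolding N_def using *(2) by linarith
    qed simp
    finally show ?thesis by (simp add: powr_realpow add_pos_nonneg)
  qed
  hence "norm (eval_entire f z) \<le> exp (ln C + (1 + norm z) ^ N)" for z
  proof -
    have "C * exp (norm z powr \<rho>) \<le> C * exp ((1 + norm z) ^ N)"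
      using *(1) \<open>norm z powr \<rho> \<le> _\<close> by simp
    with *(3)[of z] have "norm (eval_entire f z) \<le> C * exp ((1 + norm z) ^ N)"
      by (rule order.trans)
    with *(1) show ?thesis by (simp add: exp_add)
  qed
  moreover have "poly_bounded (\<lambda>z :: complex ^ 'a. ln C + (1 + norm z) ^ N)"
    by (intro poly_bounded_add poly_bounded_power poly_bounded_const poly_bounded_norm) auto
  ultimately show ?thesis unfolding exp_poly_bounded_def by (intro exI[of _ "\<lambda>z. ln C + (1 + norm z) ^ N"]) auto
qed

section \<open>Entire divisors of polynomials\<close>

lemma entire_fun_compose:
  assumes "entire_fun f" "\<And>z. (g has_field_derivative g' z) (at (f z))"
  shows "entire_fun (\<lambda>z. g (f z))"
  unfolding entire_fun_def
proof
  fix z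
  obtain D where D: "(f has_derivative D) (at z)" "\<And>c v. D (c *s v) = c * D v"
    using assms(1) unfolding entire_fun_def by blast
  have "(g has_derivative (\<lambda>w. g' z * w)) (at (f z))"
    using assms(2)[of z] by (simp add: has_field_derivative_def)
  from has_derivative_compose[OF D(1) this]
  show "\<exists>D. ((\<lambda>z. g (f z)) has_derivative D) (at z) \<and> (\<forall>c v. D (c *s v) = c * D v)"
    by (intro exI[of _ "\<lambda>v. g' z * D v"]) (simp add: D(2))
qed

lemma entire_fun_divide:
  assumes "entire_fun f" "entire_fun g" "\<And>z. g z \<noteq> 0"
  shows "entire_fun (\<lambda>z. f z / g z)"
proof -
  have "entire_fun (\<lambda>z. inverse (g z))"
    by (rule entire_fun_compose[OF assms(2) DERIV_inverse]) (rule assms(3))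
  from entire_fun_mult[OF assms(1) this] show ?thesis by (simp add: divide_inverse)
qed

text \<open>Contractibility of the space gives a continuous logarithm \<open>u\<close>. Near
  \<open>z0\<close> it coincides with \<open>u z0 + Ln (G z / G z0)\<close>, which is complex
  differentiable at \<open>z0\<close>.\<close>

lemma entire_fun_logarithm:
  fixes G :: "complex ^ 'n::finite \<Rightarrow> complex"
  assumes "entire_fun G" "\<And>z. G z \<noteq> 0"
  obtains u where "entire_fun u" "\<And>z. G z = exp (u z)"
proof -
  obtain u where u: "continuous_on UNIV u" "\<And>z. G z = exp (u z)"
    using continuous_logarithm_on_contractible[of UNIV G] entire_fun_imp_continuous[OF assms(1)] assms(2)
      contractible_UNIV by auto
  have "entire_fun u"
    unfolding entire_fun_def
  proof
    fix z0
    have "entire_fun (\<lambda>z. G z / G z0)"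
      by (intro entire_fun_divide assms entire_fun_const)
    then obtain D where D: "((\<lambda>z. G z / G z0) has_derivative D) (at z0)" "\<And>c v. D (c *s v) = c * D v"
      unfolding entire_fun_def by blast
    have "(Ln has_field_derivative inverse 1) (at 1)"
      by (rule has_field_derivative_Ln) simp
    moreover have one: "G z0 / G z0 = 1"
      using assms(2)[of z0] by (rule divide_self)
    moreover have "(*) (inverse (1 :: complex)) = (\<lambda>w. w)"
      by (rule ext) simp
    ultimately have "(Ln has_derivative (\<lambda>w. w)) (at (G z0 / G z0))"
      unfolding has_field_derivative_def by (simp only:)
    from has_derivative_add[OF has_derivative_const has_derivative_compose[OF D(1) this], of "u z0"]
    have L: "((\<lambda>z. u z0 + Ln (G z / G z0)) has_derivative D) (at z0)"
      by simp
    \<comment> \<open>On this set the imaginary part of \<open>u z - u z0\<close> is below pi in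
      absolute value, so the principal branch \<open>Ln\<close> inverts \<open>exp\<close>.\<close>
    have "open (u -` ball (u z0) pi)"
      using u(1) by (intro open_vimage) auto
    moreover have "u z0 + Ln (G z / G z0) = u z" if "z \<in> u -` ball (u z0) pi" for z
    proof -
      have "\<bar>Im (u z - u z0)\<bar> < pi"
        using that abs_Im_le_cmod[of "u z - u z0"] by (simp add: dist_norm norm_minus_commute)
      hence "Ln (exp (u z - u z0)) = u z - u z0" by (intro Ln_exp) auto
      thus ?thesis by (simp add: u(2) exp_diff)
    qed
    ultimately have "(u has_derivative D) (at z0)"
      using has_derivative_transform_within_open[OF L, of "u -` ball (u z0) pi" u] by simp
    with D(2) show "\<exists>D. (u has_derivative D) (at z0) \<and> (\<forall>c v. D (c *s v) = c * D v)" by blast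
  qed
  with u(2) show ?thesis by (rule that[rotated])
qed

section \<open>Restriction of polynomials to parallel lines\<close>

lemma coeff_mult_top:
  assumes "degree p \<le> m" "degree q \<le> n"
  shows "coeff (p * q) (m + n) = coeff p m * coeff q n"
proof (cases "degree p = m \<and> degree q = n")
  case True
  thus ?thesis using coeff_mult_degree_sum[of p q] by simp
next
  case False
  hence "coeff p m = 0 \<or> coeff q n = 0" using assms by (metis coeff_eq_0 le_neq_implies_less)
  moreover have "degree (p * q) < m + n"
    using False assms degree_mult_le[of p q] by linarith
  ultimately show ?thesis by (auto simp: coeff_eq_0)
qed

text \<open>The product is the monomial with exponents \<alpha> restricted to the line a + t b. Its
  degree may drop, since some \<open>b i\<close> can vanish, but the coefficient in the formal top
  degree is always the monomial at b.\<close>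

lemma linear_powers_prod_poly:
  fixes a b :: "'i \<Rightarrow> 'a::comm_ring_1"
  assumes "finite I"
  shows "degree (\<Prod>i\<in>I. [:a i, b i:] ^ \<alpha> i) \<le> sum \<alpha> I \<and>
         coeff (\<Prod>i\<in>I. [:a i, b i:] ^ \<alpha> i) (sum \<alpha> I) = (\<Prod>i\<in>I. b i ^ \<alpha> i)"
  using assms
proof (induction I rule: finite_induct)
  case (insert i I)
  have 1: "degree ([:a i, b i:] ^ k) \<le> k \<and> coeff ([:a i, b i:] ^ k) k = b i ^ k" for k
  proof (induction k)
    case (Suc k)
    have d: "degree [:a i, b i:] \<le> 1" by simp
    from coeff_mult_top[OF d, of "[:a i, b i:] ^ k" k] Suc
    have "coeff ([:a i, b i:] ^ Suc k) (Suc k) = b i ^ Suc k"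
      by (simp del: mult_pCons_left)
    moreover have "degree ([:a i, b i:] ^ Suc k) \<le> Suc k"
      using degree_mult_le[of "[:a i, b i:]" "[:a i, b i:] ^ k"] d Suc by (simp del: mult_pCons_left)
    ultimately show ?case by blast
  qed simp
  show ?case
    using coeff_mult_top[OF conjunct1[OF 1, of "\<alpha> i"] conjunct1[OF insert.IH]] insert 1
      order.trans[OF degree_mult_le add_mono[OF conjunct1[OF 1, of "\<alpha> i"] conjunct1[OF insert.IH]]]
    by simp
qed auto

text \<open>Any \<open>v\<close> at which the top homogeneous part of \<open>q\<close> does not
  vanish will do: along z + t v the coefficient of t^m is the top part at \<open>v\<close>, whatever
  the base point z.\<close>

lemma polynomial_fun_monic_on_lines:
  fixes q :: "complex ^ 'n::finite \<Rightarrow> complex"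
  assumes "polynomial_fun q" "q \<noteq> (\<lambda>z. 0)"
  obtains v P c m where "c \<noteq> 0" "\<And>z. degree (P z) = m" "\<And>z. lead_coeff (P z) = c"
    "\<And>z t. q (z + t *s v) = poly (P z) t"
proof -
  define rep where "rep = (\<lambda>m (A :: ('n \<Rightarrow> nat) set) c. finite A \<and> (\<forall>\<alpha>\<in>A. sum \<alpha> UNIV \<le> m) \<and>
     q = (\<lambda>z. \<Sum>\<alpha>\<in>A. c \<alpha> * (\<Prod>i\<in>UNIV. (z $ i) ^ \<alpha> i)))"
  have "\<exists>m A c. rep m A c"
  proof -
    obtain A :: "('n \<Rightarrow> nat) set" and c
      where A: "finite A" "q = (\<lambda>z. \<Sum>\<alpha>\<in>A. c \<alpha> * (\<Prod>i\<in>UNIV. (z $ i) ^ \<alpha> i))"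
      using assms(1) unfolding polynomial_fun_def by blast
    hence "rep (Max (insert 0 ((\<lambda>\<alpha>. sum \<alpha> UNIV) ` A))) A c"
      unfolding rep_def by auto
    thus ?thesis by blast
  qed
  hence ex: "\<exists>m. \<exists>A c. rep m A c" by blast
  \<comment> \<open>The least bound on the total degree over all representations of
    \<open>q\<close>. If the terms of total degree \<open>m\<close> summed to the zero function,
    dropping them would leave a representation with a smaller bound, or show that \<open>q\<close>
    is zero.\<close>
  define m where "m = (LEAST m. \<exists>A c. rep m A c)"
  obtain A c where rep: "rep m A c"
    using LeastI_ex[OF ex] unfolding m_def by blast
  have least: "\<not> rep k B d" if "k < m" for k B d
    using not_less_Least[of k "\<lambda>m. \<exists>A c. rep m A c"] that unfolding m_def by blast
  from rep have A: "finite A" "\<And>\<alpha>. \<alpha> \<in> A \<Longrightarrow> sum \<alpha> UNIV \<le> m"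
    and q: "\<And>z. q z = (\<Sum>\<alpha>\<in>A. c \<alpha> * (\<Prod>i\<in>UNIV. (z $ i) ^ \<alpha> i))"
    unfolding rep_def by auto
  define T where "T = {\<alpha>\<in>A. sum \<alpha> UNIV = m}"
  define top where "top = (\<lambda>z :: complex ^ 'n. \<Sum>\<alpha>\<in>T. c \<alpha> * (\<Prod>i\<in>UNIV. (z $ i) ^ \<alpha> i))"
  have "\<exists>v. top v \<noteq> 0"
  proof (rule ccontr)
    assume "\<nexists>v. top v \<noteq> 0"
    moreover have "q z = top z + (\<Sum>\<alpha>\<in>A - T. c \<alpha> * (\<Prod>i\<in>UNIV. (z $ i) ^ \<alpha> i))" for z
    proof -
      have "T \<subseteq> A" by (auto simp: T_def)
      from sum.subset_diff[OF this A(1)] show ?thesis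
        unfolding q top_def by (simp only: add.commute)
    qed
    ultimately have q': "q = (\<lambda>z. \<Sum>\<alpha>\<in>A - T. c \<alpha> * (\<Prod>i\<in>UNIV. (z $ i) ^ \<alpha> i))" by auto
    have less: "sum \<alpha> UNIV < m" if "\<alpha> \<in> A - T" for \<alpha>
      using A(2)[of \<alpha>] that by (auto simp: T_def order.strict_iff_order)
    show False
    proof (cases m)
      case 0
      hence empty: "A - T = {}" using less by blast
      have "q = (\<lambda>z. 0)" by (subst q') (simp only: empty sum.empty)
      with assms(2) show False by contradiction
    next
      case (Suc k)
      have "\<forall>\<alpha>\<in>A - T. sum \<alpha> UNIV \<le> k"
        using less unfolding Suc less_Suc_eq_le by blast
      hence "rep k (A - T) c" unfolding rep_def using A(1) by (intro conjI finite_Diff q')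
      moreover have "k < m" using Suc by simp
      ultimately show False using least by blast
    qed
  qed
  then obtain v where v: "top v \<noteq> 0" by blast
  define P where "P = (\<lambda>z :: complex ^ 'n. \<Sum>\<alpha>\<in>A. smult (c \<alpha>) (\<Prod>i\<in>UNIV. [:z $ i, v $ i:] ^ \<alpha> i))"
  have deg: "degree (P z) \<le> m" for z
    unfolding P_def
    using linear_powers_prod_poly[of UNIV "\<lambda>i. z $ i" "\<lambda>i. v $ i"] A(2)
    by (intro degree_sum_le A(1)) (meson degree_smult_le finite order.trans)
  have top: "coeff (P z) m = top v" for z
  proof -
    have "coeff (P z) m = (\<Sum>\<alpha>\<in>A. c \<alpha> * coeff (\<Prod>i\<in>UNIV. [:z $ i, v $ i:] ^ \<alpha> i) m)"
      by (simp add: P_def coeff_sum)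
    also have "\<dots> = (\<Sum>\<alpha>\<in>T. c \<alpha> * coeff (\<Prod>i\<in>UNIV. [:z $ i, v $ i:] ^ \<alpha> i) m)"
    proof (rule sum.mono_neutral_right)
      show "\<forall>\<alpha>\<in>A - T. c \<alpha> * coeff (\<Prod>i\<in>UNIV. [:z $ i, v $ i:] ^ \<alpha> i) m = 0"
      proof
        fix \<alpha> assume "\<alpha> \<in> A - T"
        hence "sum \<alpha> UNIV < m" using A(2)[of \<alpha>] by (auto simp: T_def order.strict_iff_order)
        with linear_powers_prod_poly[of UNIV "\<lambda>i. z $ i" "\<lambda>i. v $ i" \<alpha>]
        show "c \<alpha> * coeff (\<Prod>i\<in>UNIV. [:z $ i, v $ i:] ^ \<alpha> i) m = 0"
          by (auto intro!: coeff_eq_0)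
      qed
    qed (use A(1) in \<open>auto simp: T_def\<close>)
    also have "\<dots> = top v"
      unfolding top_def
      using linear_powers_prod_poly[of UNIV "\<lambda>i. z $ i" "\<lambda>i. v $ i"]
      by (intro sum.cong) (auto simp: T_def)
    finally show ?thesis .
  qed
  have degP: "degree (P z) = m" for z
    using deg[of z] top[of z] v by (metis coeff_eq_0 le_neq_implies_less)
  show ?thesis
  proof (rule that[of "top v" P m v])
    show "lead_coeff (P z) = top v" for z using degP top by simp
    show "q (z + t *s v) = poly (P z) t" for z t
      by (simp add: q P_def poly_sum poly_prod poly_power mult.commute)
  qed (use v degP in auto)
qed

lemma entire_fun_coeff_on_lines:
  assumes F: "\<And>t. entire_fun (\<lambda>z. F z t)"
    and P: "\<And>z. degree (P z) \<le> M" "\<And>z t. F z t = poly (P z) t"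
  shows "entire_fun (\<lambda>z. coeff (P z) j)"
proof -
  obtain a where a: "\<And>p. degree p \<le> M \<Longrightarrow> coeff p j = (\<Sum>i\<le>M. a i * poly p (of_nat i :: complex))"
    using coeff_sum_of_values by blast
  have "(\<lambda>z. coeff (P z) j) = (\<lambda>z. \<Sum>i\<le>M. a i * F z (of_nat i))"
    by (simp add: a P)
  moreover have "entire_fun \<dots>"
    by (intro entire_fun_sum entire_fun_mult entire_fun_const F)
  ultimately show ?thesis by simp
qed

lemma poly_bounded_coeff_on_lines:
  assumes F: "\<And>t. poly_bounded (\<lambda>z. norm (F z t))"
    and P: "\<And>z. degree (P z) \<le> M" "\<And>z t. F z t = poly (P z) t"
  shows "poly_bounded (\<lambda>z. norm (coeff (P z) j :: complex))"
proof -
  obtain a where a: "\<And>p. degree p \<le> M \<Longrightarrow> coeff p j = (\<Sum>i\<le>M. a i * poly p (of_nat i :: complex))"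
    using coeff_sum_of_values by blast
  have "poly_bounded (\<lambda>z. \<Sum>i\<le>M. norm (a i) * norm (F z (of_nat i)))"
    by (intro poly_bounded_sum poly_bounded_mult poly_bounded_const F) auto
  moreover have "norm (coeff (P z) j) \<le> (\<Sum>i\<le>M. norm (a i) * norm (F z (of_nat i)))" for z
  proof -
    have "coeff (P z) j = (\<Sum>i\<le>M. a i * F z (of_nat i))" by (simp add: a P)
    thus ?thesis using norm_sum[of "\<lambda>i. a i * F z (of_nat i)" "{..M}"] by (simp add: norm_mult)
  qed
  ultimately show ?thesis by (rule poly_bounded_mono)
qed

text \<open>Cauchy's root bound. For |x| > 1 every lower power of x is at most the one just below
  the leading power, and solving the equation for the leading term gives |x| <= S.\<close>

lemma monic_root_bound:
  fixes q :: "complex poly"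
  assumes "lead_coeff q = 1" "poly q x = 0"
  shows "norm x \<le> 1 + (\<Sum>j<degree q. norm (coeff q j))"
proof (rule ccontr)
  define S where "S = (\<Sum>j<degree q. norm (coeff q j))"
  assume "\<not> norm x \<le> 1 + (\<Sum>j<degree q. norm (coeff q j))"
  hence x: "norm x > 1 + S" by (simp add: S_def)
  have S: "S \<ge> 0" unfolding S_def by (intro sum_nonneg) auto
  have "degree q \<noteq> 0"
  proof
    assume "degree q = 0"
    then obtain c where "q = [:c:]" by (rule degree_eq_zeroE)
    with assms show False by simp
  qed
  then obtain m where m: "degree q = Suc m" using not0_implies_Suc by blast
  have "poly q x = (\<Sum>j<Suc (Suc m). coeff q j * x ^ j)"
    by (simp only: poly_altdef m lessThan_Suc_atMost)
  also have "\<dots> = (\<Sum>j<Suc m. coeff q j * x ^ j) + x ^ Suc m"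
    using assms(1) by (subst sum.lessThan_Suc) (simp only: m mult_1)
  finally have "x ^ Suc m = - (\<Sum>j<Suc m. coeff q j * x ^ j)"
    using assms(2) by (metis add.commute add_eq_0_iff)
  hence "norm x ^ Suc m = norm (\<Sum>j<Suc m. coeff q j * x ^ j)"
    by (metis norm_minus_cancel norm_power)
  also have "\<dots> \<le> (\<Sum>j<Suc m. norm (coeff q j) * norm x ^ m)"
  proof (rule sum_norm_le)
    fix j assume "j \<in> {..<Suc m}"
    hence "j \<le> m" by simp
    hence "norm x ^ j \<le> norm x ^ m" by (rule power_increasing) (use x S in linarith)
    thus "norm (coeff q j * x ^ j) \<le> norm (coeff q j) * norm x ^ m"
      unfolding norm_mult norm_power by (intro mult_left_mono norm_ge_zero)
  qed
  also have "\<dots> = S * norm x ^ m" unfolding S_def m sum_distrib_right ..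
  also have "\<dots> < norm x * norm x ^ m"
  proof (rule mult_strict_right_mono)
    show "0 < norm x ^ m" using x S by (intro zero_less_power) linarith
  qed (use x in linarith)
  finally show False by (simp only: power_Suc less_irrefl)
qed

text \<open>Up to sign, \<open>poly r 0\<close> is the product of the roots; linear factors are
  split off one by one. The upper bound will control the polynomial factor of a divisor, the lower
  bound its zero-free factor.\<close>

lemma monic_poly_0_bounds:
  fixes r :: "complex poly"
  assumes "lead_coeff r = 1"
  shows "(\<And>x. poly r x = 0 \<Longrightarrow> norm x \<le> B) \<Longrightarrow> norm (poly r 0) \<le> B ^ degree r"
    and "(\<And>x. poly r x = 0 \<Longrightarrow> norm x \<ge> 1) \<Longrightarrow> norm (poly r 0) \<ge> 1"
proof -
  have "((\<forall>x. poly r x = 0 \<longrightarrow> norm x \<le> B) \<longrightarrow> norm (poly r 0) \<le> B ^ degree r) \<and>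
        ((\<forall>x. poly r x = 0 \<longrightarrow> norm x \<ge> 1) \<longrightarrow> norm (poly r 0) \<ge> 1)"
    using assms
  proof (induction "degree r" arbitrary: r)
    case 0
    obtain c where c: "r = [:c:]" using degree_eq_zeroE[OF "0.hyps"[symmetric]] .
    have "c = 1" using "0.prems" unfolding c by simp
    show ?case unfolding c \<open>c = 1\<close> by simp
  next
    case (Suc d)
    hence "degree r \<noteq> 0" by linarith
    hence "\<not> constant (poly r)" by (simp add: constant_degree)
    then obtain a where "poly r a = 0" using fundamental_theorem_of_algebra by blast
    then obtain s where s: "r = [:-a, 1:] * s" by (auto simp: poly_eq_0_iff_dvd)
    have s0: "s \<noteq> 0" using \<open>degree r \<noteq> 0\<close> s by auto
    have deg: "degree r = Suc (degree s)" unfolding s using s0 by (subst degree_mult_eq) auto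
    have "lead_coeff s = 1" using Suc.prems unfolding s lead_coeff_mult by simp
    moreover have "d = degree s" using Suc.hyps(2) deg by linarith
    ultimately have IH: "(\<forall>x. poly s x = 0 \<longrightarrow> norm x \<le> B) \<Longrightarrow> norm (poly s 0) \<le> B ^ degree s"
      "(\<forall>x. poly s x = 0 \<longrightarrow> norm x \<ge> 1) \<Longrightarrow> norm (poly s 0) \<ge> 1"
      using Suc.hyps(1)[of s] by blast+
    have r0: "norm (poly r 0) = norm a * norm (poly s 0)" by (simp add: s norm_mult)
    have roots: "poly r x = 0 \<longleftrightarrow> x = a \<or> poly s x = 0" for x by (auto simp: s)
    show ?case
    proof (intro conjI impI)
      assume *: "\<forall>x. poly r x = 0 \<longrightarrow> norm x \<le> B"
      hence "norm a \<le> B" "norm (poly s 0) \<le> B ^ degree s" using IH roots by auto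
      moreover from this have "B \<ge> 0" by (meson norm_ge_zero order.trans)
      ultimately show "norm (poly r 0) \<le> B ^ degree r"
        unfolding r0 deg power_Suc by (intro mult_mono) auto
    next
      assume *: "\<forall>x. poly r x = 0 \<longrightarrow> norm x \<ge> 1"
      hence "norm a \<ge> 1" "norm (poly s 0) \<ge> 1" using IH roots by auto
      thus "norm (poly r 0) \<ge> 1" unfolding r0 using mult_mono[of 1 "norm a" 1] by force
    qed
  qed
  thus "(\<And>x. poly r x = 0 \<Longrightarrow> norm x \<le> B) \<Longrightarrow> norm (poly r 0) \<le> B ^ degree r"
    "(\<And>x. poly r x = 0 \<Longrightarrow> norm x \<ge> 1) \<Longrightarrow> norm (poly r 0) \<ge> 1" by auto
qed

section \<open>Polynomials with entire coefficients and division by monic ones\<close>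

lemma eval_entire_sum: "eval_entire (sum f A) z = (\<Sum>x\<in>A. eval_entire (f x) z)"
  by (induction A rule: infinite_finite_induct) (simp_all add: zero_entire.rep_eq plus_entire.rep_eq)

text \<open>Specialization of the coefficients at \<open>z\<close>. Division by a monic polynomial
  over the ring of entire functions is carried out once for all \<open>z\<close>, which makes
  quotient and remainder holomorphic in \<open>z\<close>.\<close>

definition eval_poly :: "complex ^ 'n::finite \<Rightarrow> 'n entire poly \<Rightarrow> complex poly" where
  "eval_poly z = map_poly (\<lambda>g. eval_entire g z)"

lemma coeff_eval_poly: "coeff (eval_poly z P) j = eval_entire (coeff P j) z"
  by (simp add: eval_poly_def coeff_map_poly zero_entire.rep_eq)

lemma eval_poly_add: "eval_poly z (P + Q) = eval_poly z P + eval_poly z Q"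
  by (intro poly_eqI) (simp add: coeff_eval_poly plus_entire.rep_eq)

lemma eval_poly_mult: "eval_poly z (P * Q) = eval_poly z P * eval_poly z Q"
  by (intro poly_eqI) (simp add: coeff_eval_poly coeff_mult eval_entire_sum times_entire.rep_eq)

lemma degree_eval_poly_le: "degree (eval_poly z P) \<le> degree P"
  by (rule degree_le) (simp add: coeff_eval_poly coeff_eq_0 zero_entire.rep_eq)

lemma eval_poly_of_entire_coeffs:
  fixes P :: "complex ^ 'n::finite \<Rightarrow> complex poly"
  assumes "\<And>z. degree (P z) \<le> M" "\<And>j. entire_fun (\<lambda>z. coeff (P z) j)"
  obtains Q where "\<And>z. eval_poly z Q = P z" "\<And>j. coeff Q j = Entire (\<lambda>z. coeff (P z) j)" "degree Q \<le> M"
proof -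
  define Q where "Q = (\<Sum>j\<le>M. monom (Entire (\<lambda>z. coeff (P z) j)) j)"
  have coeff_Q: "coeff Q j = (if j \<le> M then Entire (\<lambda>z. coeff (P z) j) else 0)" for j
    unfolding Q_def coeff_sum coeff_monom by (subst sum.delta) auto
  have "coeff Q j = Entire (\<lambda>z. coeff (P z) j)" for j
  proof (cases "j \<le> M")
    case False
    hence "(\<lambda>z. coeff (P z) j) = (\<lambda>z. 0)"
      using assms(1) by (intro ext coeff_eq_0) (meson le_less_trans not_le)
    with False show ?thesis by (simp add: coeff_Q zero_entire_def)
  qed (simp add: coeff_Q)
  moreover from this have "eval_poly z Q = P z" for z
    using assms(2) by (intro poly_eqI) (simp add: coeff_eval_poly Entire_inverse)
  moreover have "degree Q \<le> M"
    unfolding Q_def by (intro degree_sum_le) (auto intro: order.trans[OF degree_monom_le])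
  ultimately show ?thesis using that by blast
qed

text \<open>Distinct quotients would give a nonzero multiple of \<open>q\<close> of degree below
  that of \<open>q\<close>. The alternative of a zero remainder covers a divisor of degree 0, where
  no degree is smaller.\<close>

lemma poly_euclidean_unique:
  fixes q :: "'a::idom poly"
  assumes "q \<noteq> 0" "q * a + b = q * a' + b'"
    and "degree b < degree q \<or> b = 0" "degree b' < degree q \<or> b' = 0"
  shows "a = a' \<and> b = b'"
proof -
  have eq: "q * (a - a') = b' - b"
    using assms(2) by (simp add: algebra_simps)
  have "a = a'"
  proof (rule ccontr)
    assume "a \<noteq> a'"
    hence nz: "q * (a - a') \<noteq> 0" and "degree q \<le> degree (q * (a - a'))"
      using assms(1) by (simp_all add: degree_mult_eq)
    with eq have "degree q \<le> degree (b' - b)" by simp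
    moreover have "degree (b' - b) < degree q"
    proof (cases "degree q = 0")
      case True
      with assms(3,4) eq nz show ?thesis by auto
    next
      case False
      with assms(3,4) show ?thesis
        using degree_diff_le_max[of b' b] by auto
    qed
    ultimately show False by simp
  qed
  with assms(2) show ?thesis by simp
qed

text \<open>This turns the number of roots of \<open>r\<close> into a coefficient, a quantity whose
  dependence on a parameter can be controlled.\<close>

lemma coeff_pderiv_mult_monic:
  fixes r s :: "complex poly"
  assumes "lead_coeff r = 1" "lead_coeff s = 1" "degree (r * s) = Suc n"
  shows "coeff (s * pderiv r) n = of_nat (degree r)"
proof (cases "degree r")
  case 0
  then obtain c where "r = [:c:]" by (rule degree_eq_zeroE)
  with 0 show ?thesis by (simp add: pderiv_pCons)
next
  case (Suc k)
  have nz: "r \<noteq> 0" "s \<noteq> 0" using assms by auto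
  have n: "degree s + k = n"
    using assms(3) degree_mult_eq[OF nz] Suc by simp
  have "degree (pderiv r) = k" by (simp add: degree_pderiv Suc)
  hence "coeff (s * pderiv r) (degree s + k) = coeff s (degree s) * coeff (pderiv r) k"
    using coeff_mult_degree_sum[of s "pderiv r"] by simp
  also have "\<dots> = of_nat (Suc k)" using assms(1,2) Suc by (simp add: coeff_pderiv)
  finally show ?thesis using n Suc by simp
qed

text \<open>
  Writing $E(z+tv) = r_z(t)\,e^{w_z(t)}$ and $H(z+tv) = s_z(t)\,e^{-w_z(t)}$, the polynomial
  $H \cdot D_v E$ equals $q_z w_z' + s_z r_z'$ on the line. Division by the monic $q_z = r_z s_z$ over
  the ring of entire functions separates the two terms, so both depend holomorphically on $z$.
\<close>

locale line_factorization =
  fixes E H :: "complex ^ 'n::finite \<Rightarrow> complex" and v :: "complex ^ 'n" and N m :: nat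
    and q r s w :: "complex ^ 'n \<Rightarrow> complex poly"
  assumes E: "entire_fun E" and H: "entire_fun H"
    and q: "\<And>z t. E (z + t *s v) * H (z + t *s v) = poly (q z) t"
      "\<And>z. degree (q z) = m" "\<And>z. lead_coeff (q z) = 1"
    and r: "\<And>z. lead_coeff (r z) = 1" and w: "\<And>z. degree (w z) \<le> N"
    and rs: "\<And>z. q z = r z * s z"
    and Eline: "\<And>z t. E (z + t *s v) = poly (r z) t * exp (poly (w z) t)"
    and Hline: "\<And>z t. H (z + t *s v) = poly (s z) t * exp (- poly (w z) t)"
begin

lemma nonzero: "q z \<noteq> 0" "r z \<noteq> 0" "s z \<noteq> 0"
  using q(3)[of z] rs[of z] by auto

lemma degree_rs: "degree (r z) + degree (s z) = m"
  using q(2)[of z] rs[of z] nonzero[of z] by (simp add: degree_mult_eq)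

lemma s_monic: "lead_coeff (s z) = 1"
  using q(3)[of z] r[of z] by (simp add: rs lead_coeff_mult)

lemma entire_fun_line: "entire_fun F \<Longrightarrow> entire_fun (\<lambda>z. F (z + t *s v))"
  using entire_fun_affine[of F 1 "t *s v"] by simp

lemma log_derivative_data:
  shows "\<And>j. entire_fun (\<lambda>z. coeff (pderiv (w z)) j)"
    and "\<And>j. entire_fun (\<lambda>z. coeff (s z * pderiv (r z)) j)"
proof -
  \<comment> \<open>\<open>H\<close> times the derivative of \<open>E\<close> along
    \<open>v\<close>: on each line the exponentials of the two factorizations cancel and the
    polynomial \<open>P z\<close> remains.\<close>
  define M where "M = (\<lambda>z. H z * (\<Sum>i\<in>UNIV. v $ i * partial_deriv i E z))"
  define P where "P = (\<lambda>z. q z * pderiv (w z) + s z * pderiv (r z))"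
  have M: "entire_fun M"
    unfolding M_def by (intro entire_fun_mult entire_fun_sum entire_fun_const entire_fun_partial_deriv E H)
  have MP: "M (z + t *s v) = poly (P z) t" for z t
  proof -
    have "((\<lambda>t. E (z + t *s v)) has_field_derivative
        (\<Sum>i\<in>UNIV. v $ i * partial_deriv i E (z + t *s v))) (at t)"
      by (rule entire_fun_line_derivative[OF E])
    moreover have "((\<lambda>t. E (z + t *s v)) has_field_derivative
        (poly (pderiv (r z)) t + poly (r z) t * poly (pderiv (w z)) t) * exp (poly (w z) t)) (at t)"
      unfolding Eline by (auto intro!: derivative_eq_intros poly_DERIV simp: algebra_simps)
    ultimately have "(\<Sum>i\<in>UNIV. v $ i * partial_deriv i E (z + t *s v)) =
        (poly (pderiv (r z)) t + poly (r z) t * poly (pderiv (w z)) t) * exp (poly (w z) t)"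
      by (rule DERIV_unique)
    thus ?thesis
      by (simp add: M_def P_def Hline rs exp_minus field_simps)
  qed
  have dpw: "degree (pderiv (w z)) \<le> N" for z
    using w[of z] by (simp add: degree_pderiv)
  have degP: "degree (P z) \<le> m + N" for z
  proof -
    have "degree (q z * pderiv (w z)) \<le> m + N"
      using degree_mult_le[of "q z" "pderiv (w z)"] q(2)[of z] dpw[of z] by linarith
    moreover have "degree (s z * pderiv (r z)) \<le> m + N"
      using degree_mult_le[of "s z" "pderiv (r z)"] degree_rs[of z] by (simp add: degree_pderiv)
    ultimately show ?thesis unfolding P_def by (rule degree_add_le)
  qed
  have "entire_fun (\<lambda>z. coeff (P z) j)" for j
    by (rule entire_fun_coeff_on_lines[OF entire_fun_line[OF M] degP MP])
  from eval_poly_of_entire_coeffs[OF degP this] obtain Pe where Pe: "\<And>z. eval_poly z Pe = P z" by blast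
  have "entire_fun (\<lambda>z. coeff (q z) j)" for j
    by (rule entire_fun_coeff_on_lines[OF entire_fun_mult[OF entire_fun_line[OF E] entire_fun_line[OF H]]
          eq_imp_le[OF q(2)] q(1)])
  from eval_poly_of_entire_coeffs[OF eq_imp_le[OF q(2)] this] obtain qe
    where qe: "\<And>z. eval_poly z qe = q z" "\<And>j. coeff qe j = Entire (\<lambda>z. coeff (q z) j)" "degree qe \<le> m"
    by blast
  have top: "coeff qe m = 1"
    using q(2,3) by (simp add: qe(2) one_entire_def)
  hence "degree qe = m" using qe(3) le_degree[of qe m] by simp
  obtain Qe Se where QS: "pseudo_divmod Pe qe = (Qe, Se)" by (cases "pseudo_divmod Pe qe")
  have "qe \<noteq> 0" using top by auto
  \<comment> \<open>Since \<open>qe\<close> is monic, the power of its leading coefficient in the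
    pseudo-division is 1.\<close>
  from pseudo_divmod[OF this QS] top \<open>degree qe = m\<close>
  have div: "Pe = qe * Qe + Se" and degS: "Se = 0 \<or> degree Se < m" by auto
  have *: "pderiv (w z) = eval_poly z Qe \<and> s z * pderiv (r z) = eval_poly z Se" for z
  proof (rule poly_euclidean_unique[OF nonzero(1)[of z]])
    show "q z * pderiv (w z) + s z * pderiv (r z) = q z * eval_poly z Qe + eval_poly z Se"
      using Pe[of z] by (simp add: div eval_poly_add eval_poly_mult qe(1) P_def)
    \<comment> \<open>A constant \<open>r z\<close> has derivative zero; otherwise differentiation
      lowers the degree of the product below \<open>m\<close>.\<close>
    show "degree (s z * pderiv (r z)) < degree (q z) \<or> s z * pderiv (r z) = 0"
    proof (cases "degree (r z) = 0")
      case True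
      then obtain c where "r z = [:c:]" by (rule degree_eq_zeroE)
      thus ?thesis by (simp add: pderiv_pCons)
    next
      case False
      have "degree (s z * pderiv (r z)) \<le> degree (s z) + (degree (r z) - 1)"
        using degree_mult_le[of "s z" "pderiv (r z)"] by (simp only: degree_pderiv)
      hence "degree (s z * pderiv (r z)) < m" using False degree_rs[of z] by linarith
      thus ?thesis by (simp add: q(2))
    qed
    show "degree (eval_poly z Se) < degree (q z) \<or> eval_poly z Se = 0"
      using degS degree_eval_poly_le[of z Se] by (auto simp: q(2) eval_poly_def)
  qed
  show "entire_fun (\<lambda>z. coeff (pderiv (w z)) j)" for j
    using eval_entire[of "coeff Qe j"] * by (simp add: coeff_eval_poly)
  show "entire_fun (\<lambda>z. coeff (s z * pderiv (r z)) j)" for j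
    using eval_entire[of "coeff Se j"] * by (simp add: coeff_eval_poly)
qed

text \<open>The degree is a continuous function of $z$, being a coefficient of $s_z r_z'$.\<close>

lemma degree_r_constant: "degree (r z) = degree (r z')"
proof (cases m)
  case 0
  thus ?thesis using degree_rs by (metis add_eq_0_iff_both_eq_0)
next
  case (Suc n)
  have eq: "coeff (s z * pderiv (r z)) n = of_nat (degree (r z))" for z
    using q(2)[of z] Suc by (intro coeff_pderiv_mult_monic r s_monic) (simp flip: rs)
  define d where "d = (\<lambda>z. of_nat (degree (r z)) :: complex)"
  have "continuous_on UNIV d"
    using entire_fun_imp_continuous[OF log_derivative_data(2)[of n]] by (simp add: eq d_def)
  moreover have "finite (d ` UNIV)"
  proof (rule finite_subset)
    show "d ` UNIV \<subseteq> of_nat ` {..m}"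
      using degree_rs unfolding d_def by (metis atMost_iff image_eqI image_subsetI le_add1)
  qed simp
  ultimately have "d constant_on UNIV"
    by (rule continuous_finite_range_constant[OF convex_connected[OF convex_UNIV]])
  hence "d z = d z'" unfolding constant_on_def by auto
  thus ?thesis by (simp add: d_def)
qed

text \<open>
  $E(z+tv)\,e^{w_z(0)-w_z(t)} = e^{w_z(0)} r_z(t)$ is entire in $z$ and has leading coefficient
  $e^{w_z(0)}$ in $t$.
\<close>

lemma entire_fun_exp_w0: "entire_fun (\<lambda>z. exp (poly (w z) 0))"
proof -
  define k where "k = degree (r 0)"
  have k: "degree (r z) = k" for z unfolding k_def by (rule degree_r_constant)
  have coeff_w: "entire_fun (\<lambda>z. coeff (w z) (Suc j))" for j
  proof -
    have "(\<lambda>z. coeff (w z) (Suc j)) = (\<lambda>z. 1 / of_nat (Suc j) * coeff (pderiv (w z)) j)"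
      by (simp add: coeff_pderiv del: of_nat_Suc)
    moreover have "entire_fun \<dots>"
      by (intro entire_fun_mult entire_fun_const log_derivative_data)
    ultimately show ?thesis by simp
  qed
  \<comment> \<open>The \<open>w z\<close> are chosen line by line, so their constant terms are
    fixed only up to multiples of 2 pi i and need not be continuous in \<open>z\<close>.
    \<open>W\<close> omits them and keeps the part determined by
    \<open>pderiv (w z)\<close>.\<close>
  define W where "W = (\<lambda>z t. \<Sum>j<N. coeff (w z) (Suc j) * t ^ Suc j)"
  have W: "poly (w z) t = poly (w z) 0 + W z t" for z t
  proof -
    have "poly (w z) t = (\<Sum>j\<le>N. coeff (w z) j * t ^ j)"
      unfolding poly_altdef using w by (intro sum.mono_neutral_left) (auto simp: coeff_eq_0)
    also have "\<dots> = coeff (w z) 0 + W z t"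
      unfolding W_def by (simp add: sum.atMost_shift)
    finally show ?thesis by (simp add: poly_0_coeff_0)
  qed
  define F where "F = (\<lambda>z t. E (z + t *s v) * exp (- W z t))"
  have F: "entire_fun (\<lambda>z. F z t)" for t
    unfolding F_def W_def
    by (rule entire_fun_mult[OF entire_fun_line[OF E]])
       (intro entire_fun_exp entire_fun_uminus entire_fun_sum entire_fun_mult coeff_w entire_fun_const)
  have "F z t = poly (smult (exp (poly (w z) 0)) (r z)) t" for z t
    by (simp add: F_def Eline W[of z t] exp_add exp_minus)
  hence "entire_fun (\<lambda>z. coeff (smult (exp (poly (w z) 0)) (r z)) k)"
    by (intro entire_fun_coeff_on_lines[OF F, of _ k]) (auto simp: k)
  moreover have "coeff (r z) k = 1" for z
    using r[of z] unfolding k .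
  ultimately show ?thesis by simp
qed

text \<open>At t = 0 the line factorizations give E = R G with G zero-free. Up to sign, R(z) is a
  product of roots of \<open>q z\<close>, which are polynomially bounded in z. For G the maximum
  principle is applied on a circle in the direction \<open>v\<close> so large that |R| >= 1 on it;
  there the growth of E bounds G.\<close>

lemma factorization:
  assumes q_bound: "\<And>z t. poly_bounded (\<lambda>z. norm (poly (q z) t))" and E_bound: "exp_poly_bounded E"
  shows "\<exists>R u. polynomial_fun R \<and> polynomial_fun u \<and> (\<forall>z. E z = R z * exp (u z))"
proof -
  define G where "G = (\<lambda>z. exp (poly (w z) 0))"
  define R where "R = (\<lambda>z. poly (r z) 0)"
  have G: "entire_fun G" unfolding G_def by (rule entire_fun_exp_w0)
  have ERG: "E z = R z * G z" for z
    using Eline[of z 0] by (simp add: R_def G_def)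
  define B where "B = (\<lambda>z. 1 + (\<Sum>j<m. norm (coeff (q z) j)))"
  have B1: "B z \<ge> 1" for z unfolding B_def by (simp add: sum_nonneg)
  have B: "poly_bounded B"
    unfolding B_def using q(2)
    by (intro poly_bounded_add poly_bounded_const poly_bounded_sum
        poly_bounded_coeff_on_lines[of "\<lambda>z t. poly (q z) t" q m] q_bound) auto
  have root: "norm x \<le> B z" if "poly (q z) x = 0" for z x
    using monic_root_bound[OF q(3) that] by (simp add: B_def q(2))
  have "polynomial_fun R"
  proof (rule polynomial_fun_if_poly_bounded)
    have "R = (\<lambda>z. E z / G z)" using ERG by (auto simp: G_def)
    thus "entire_fun R" using entire_fun_divide[OF E G] by (simp add: G_def)
    have "norm (R z) \<le> B z ^ m" for z
    proof -
      have "norm (R z) \<le> B z ^ degree (r z)"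
        unfolding R_def by (rule monic_poly_0_bounds(1)[OF r]) (simp add: root rs)
      also have "\<dots> \<le> B z ^ m"
        using B1[of z] degree_rs[of z] by (intro power_increasing) auto
      finally show ?thesis .
    qed
    moreover have "poly_bounded (\<lambda>z. B z ^ m)"
      using B1 by (intro poly_bounded_power B) (meson order.trans zero_le_one)
    ultimately show "poly_bounded (\<lambda>z. norm (R z))" by (rule poly_bounded_mono[rotated])
  qed
  obtain C L where CL: "C \<ge> 0" "\<And>z. norm (E z) \<le> exp (C * (1 + norm z) ^ L)"
    using exp_poly_boundedE[OF E_bound] by blast
  define A where "A = (\<lambda>z. C * (1 + (norm z + (B z + 1) * norm v)) ^ L)"
  have B0: "0 \<le> B z + 1" for z using B1[of z] by simp
  have "poly_bounded A"
    unfolding A_def using CL(1)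
    by (intro poly_bounded_mult poly_bounded_power poly_bounded_add poly_bounded_const poly_bounded_norm B)
       (auto intro!: zero_le_power add_nonneg_nonneg mult_nonneg_nonneg B0)
  then obtain D K where DK: "D \<ge> 0" "\<And>z. A z \<le> D * (1 + norm z) ^ K"
    unfolding poly_bounded_def by blast
  have Gbound: "norm (G z) \<le> exp (A z)" for z
  proof -
    \<comment> \<open>Moving the base point by t v shifts the roots by -t. The roots of
      \<open>q z\<close> have modulus at most \<open>B z\<close>, so on the circle of radius
      \<open>B z + 1\<close> all shifted roots have modulus at least 1.\<close>
    have circle: "norm (G (z + t *s v)) \<le> exp (A z)" if t: "norm (t - 0) = B z + 1" for t
    proof -
      have "norm (poly (r (z + t *s v)) 0) \<ge> 1"
      proof (rule monic_poly_0_bounds(2)[OF r])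
        fix x assume "poly (r (z + t *s v)) x = 0"
        hence "poly (q (z + t *s v)) x = 0" by (simp add: rs)
        moreover have "poly (q (z + t *s v)) x = poly (q z) (t + x)"
          using q(1)[of "z + t *s v" x] q(1)[of z "t + x"]
          by (simp add: vector_sadd_rdistrib add.assoc)
        ultimately have "norm (t + x) \<le> B z" using root by simp
        moreover have "norm t \<le> norm (t + x) + norm x"
          using norm_triangle_ineq4[of "t + x" x] by simp
        ultimately show "norm x \<ge> 1" using t by simp
      qed
      hence "norm (G (z + t *s v)) \<le> norm (R (z + t *s v)) * norm (G (z + t *s v))"
        by (simp add: R_def mult_le_cancel_right1)
      also have "\<dots> = norm (E (z + t *s v))" by (simp add: ERG norm_mult)
      also have "\<dots> \<le> exp (C * (1 + norm (z + t *s v)) ^ L)" by (rule CL)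
      also have "\<dots> \<le> exp (A z)"
      proof -
        have "norm (z + t *s v) \<le> norm z + (B z + 1) * norm v"
          using norm_triangle_ineq[of z "t *s v"] t by (simp add: vec_norm_scaleC)
        hence "(1 + norm (z + t *s v)) ^ L \<le> (1 + (norm z + (B z + 1) * norm v)) ^ L"
          by (intro power_mono) auto
        thus ?thesis using CL(1) by (simp add: A_def mult_left_mono)
      qed
      finally show ?thesis .
    qed
    have hol: "(\<lambda>t. G (z + t *s v)) holomorphic_on UNIV" by (rule entire_fun_on_line[OF G])
    \<comment> \<open>Cauchy's inequality for the derivative of order 0 serves as the maximum
      principle.\<close>
    have "norm ((deriv ^^ 0) (\<lambda>t. G (z + t *s v)) 0) \<le> fact 0 * exp (A z) / (B z + 1) ^ 0"
      using hol B1[of z] circle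
      by (intro Cauchy_inequality)
         (auto intro: holomorphic_on_subset continuous_on_subset[OF holomorphic_on_imp_continuous_on])
    thus ?thesis by simp
  qed
  obtain u where u: "entire_fun u" "\<And>z. G z = exp (u z)"
    using entire_fun_logarithm[OF G] by (auto simp: G_def)
  have Reu: "Re (u z) \<le> D * (1 + norm z) ^ K" for z
  proof -
    have "exp (Re (u z)) \<le> exp (A z)" using Gbound[of z] by (simp add: u(2))
    with DK(2)[of z] show ?thesis by simp
  qed
  have "polynomial_fun u"
  proof (rule polynomial_fun_if_polynomial_on_lines[OF u(1)])
    fix z
    have "(\<lambda>t. u (t *s z)) holomorphic_on UNIV"
      using entire_fun_on_line[OF u(1), of 0 z] by simp
    moreover have "Re (u (t *s z)) \<le> (D * (1 + norm z) ^ K) * (1 + norm t) ^ K" for t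
    proof -
      have "1 + norm t * norm z \<le> (1 + norm z) * (1 + norm t)" by (simp add: algebra_simps)
      hence "(1 + norm t * norm z) ^ K \<le> ((1 + norm z) * (1 + norm t)) ^ K" by (intro power_mono) auto
      hence "D * (1 + norm t * norm z) ^ K \<le> D * ((1 + norm z) * (1 + norm t)) ^ K"
        using DK(1) by (rule mult_left_mono)
      with Reu[of "t *s z"] show ?thesis by (simp add: vec_norm_scaleC power_mult_distrib mult_ac)
    qed
    ultimately have "\<exists>p. degree p \<le> K \<and> (\<lambda>t. u (t *s z)) = poly p"
      using DK(1) by (intro polynomial_if_Re_bounded[of _ "D * (1 + norm z) ^ K"]) auto
    thus "\<exists>p. degree p \<le> K \<and> (\<forall>t. u (t *s z) = poly p t)" by metis
  qed
  with \<open>polynomial_fun R\<close> ERG u(2) show ?thesis by (intro exI[of _ R] exI[of _ u]) auto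
qed

end

text \<open>The one-variable factorization is applied on every line parallel to a direction in which
  \<open>q\<close> has a constant leading coefficient, and \<open>line_factorization\<close>
  assembles the results.\<close>

lemma entire_divisor_of_polynomial:
  fixes E H q :: "complex ^ 'n::finite \<Rightarrow> complex"
  assumes E: "entire_fun E" and H: "entire_fun H" and q: "polynomial_fun q" "q \<noteq> (\<lambda>z. 0)"
    and EH: "\<And>z. E z * H z = q z" and E_bound: "exp_poly_bounded E"
  obtains r u where "polynomial_fun r" "polynomial_fun u" "\<And>z. E z = r z * exp (u z)"
proof -
  obtain v P c m where P: "c \<noteq> 0" "\<And>z. degree (P z) = m" "\<And>z. lead_coeff (P z) = c"
    "\<And>z t. q (z + t *s v) = poly (P z) t"
    using polynomial_fun_monic_on_lines[OF q] by metis
  \<comment> \<open>The leading coefficient \<open>c\<close> is moved into the cofactor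
    \<open>H\<close>, so \<open>E\<close> stays untouched.\<close>
  define q' where "q' = (\<lambda>z. smult (inverse c) (P z))"
  define H' where "H' = (\<lambda>z. inverse c * H z)"
  have H': "entire_fun H'" unfolding H'_def by (intro entire_fun_mult entire_fun_const H)
  have q': "degree (q' z) = m" "lead_coeff (q' z) = 1" for z
    using P(1-3) by (simp_all add: q'_def)
  have EH': "E (z + t *s v) * H' (z + t *s v) = poly (q' z) t" for z t
    using EH[of "z + t *s v"] P(4)[of z t] by (simp add: H'_def q'_def)
  obtain C N where CN: "C \<ge> 0" "\<And>z. norm (E z) \<le> exp (C * (1 + norm z) ^ N)"
    using exp_poly_boundedE[OF E_bound] by blast
  have "\<exists>r w s. lead_coeff r = 1 \<and> degree w \<le> N \<and> q' z = r * s \<and>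
           (\<forall>t. E (z + t *s v) = poly r t * exp (poly w t)) \<and>
           (\<forall>t. H' (z + t *s v) = poly s t * exp (- poly w t))" for z
  proof (rule finite_order_divisor_of_polynomial)
    show "(\<lambda>t. E (z + t *s v)) holomorphic_on UNIV" "(\<lambda>t. H' (z + t *s v)) holomorphic_on UNIV"
      by (rule entire_fun_on_line, fact)+
    show "E (z + t *s v) * H' (z + t *s v) = poly (q' z) t" for t by (rule EH')
    show "q' z \<noteq> 0" using q'(2)[of z] by auto
    \<comment> \<open>The constant comes from 1 + |z + t v| <= (1 + |z| + |v|) (1 + |t|). It depends
      on \<open>z\<close> but the exponent does not, so the degrees of all \<open>w z\<close> share
      the bound \<open>N\<close>.\<close>
    show "0 \<le> C * (1 + norm z + norm v) ^ N" using CN(1) by simp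
    show "norm (E (z + t *s v)) \<le> exp (C * (1 + norm z + norm v) ^ N * (1 + norm t) ^ N)" for t
    proof -
      have "norm (z + t *s v) \<le> norm z + norm t * norm v"
        using norm_triangle_ineq[of z "t *s v"] by (simp add: vec_norm_scaleC)
      moreover have "1 + (norm z + norm t * norm v) \<le> (1 + norm z + norm v) * (1 + norm t)"
        by (simp add: algebra_simps)
      ultimately have "1 + norm (z + t *s v) \<le> (1 + norm z + norm v) * (1 + norm t)" by linarith
      hence "(1 + norm (z + t *s v)) ^ N \<le> ((1 + norm z + norm v) * (1 + norm t)) ^ N"
        by (intro power_mono) auto
      hence "C * (1 + norm (z + t *s v)) ^ N \<le> C * ((1 + norm z + norm v) * (1 + norm t)) ^ N"
        using CN(1) by (rule mult_left_mono)
      with CN(2)[of "z + t *s v"] show ?thesis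
        by (simp add: power_mult_distrib mult.assoc order.trans[OF _ exp_le_cancel_iff[THEN iffD2]])
    qed
  qed
  then obtain r w s where rws: "\<And>z. lead_coeff (r z) = 1" "\<And>z. degree (w z) \<le> N" "\<And>z. q' z = r z * s z"
    "\<And>z t. E (z + t *s v) = poly (r z) t * exp (poly (w z) t)"
    "\<And>z t. H' (z + t *s v) = poly (s z) t * exp (- poly (w z) t)"
    by metis
  interpret L: line_factorization E H' v N m q' r s w
    by unfold_locales (fact E H' EH' q' rws)+
  have "poly_bounded (\<lambda>z. norm (poly (q' z) t))" for t
  proof -
    have "poly_bounded (\<lambda>z. norm (q (z + t *s v)))"
    proof (rule poly_bounded_compose[OF poly_bounded_polynomial_fun[OF q(1)]])
      show "poly_bounded (\<lambda>z. norm (z + t *s v))"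
        by (rule poly_bounded_mono[OF poly_bounded_add[OF poly_bounded_norm poly_bounded_const]])
           (rule norm_triangle_ineq)
    qed
    hence "poly_bounded (\<lambda>z. norm (inverse c) * norm (q (z + t *s v)))"
      by (intro poly_bounded_mult poly_bounded_const) auto
    thus ?thesis by (simp add: q'_def P(4) norm_mult)
  qed
  from L.factorization[OF this E_bound] that show ?thesis by blast
qed

section \<open>Derivations and the field of rational functions\<close>

lemma eval_entire_eqI: "(\<And>z. eval_entire f z = eval_entire g z) \<Longrightarrow> f = g"
  by (metis eval_entire_inject ext)

lemma entire_fun_eval: "entire_fun (eval_entire f)"
  using eval_entire[of f] by simp

lemma eval_entire_power: "eval_entire (f ^ k) z = eval_entire f z ^ k"
  by (induction k) (simp_all add: one_entire.rep_eq times_entire.rep_eq)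

lemma add_in_polynomials: "p \<in> polynomials \<Longrightarrow> q \<in> polynomials \<Longrightarrow> p + q \<in> polynomials"
  unfolding polynomials_def by (simp add: plus_entire.rep_eq polynomial_fun_add)

lemma uminus_in_polynomials: "p \<in> polynomials \<Longrightarrow> - p \<in> polynomials"
  unfolding polynomials_def by (simp add: uminus_entire.rep_eq polynomial_fun_uminus)

lemma diff_in_polynomials: "p \<in> polynomials \<Longrightarrow> q \<in> polynomials \<Longrightarrow> p - q \<in> polynomials"
  using add_in_polynomials[of p "- q"] uminus_in_polynomials[of q] by simp

lemma zero_in_polynomials: "0 \<in> polynomials"
  unfolding polynomials_def by (simp add: zero_entire.rep_eq polynomial_fun_const)

section \<open>Rules for partial derivatives\<close>

lemma partial_deriv_DERIV:
  assumes "entire_fun f"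
  shows "((\<lambda>t. f (z + t *s axis i 1)) has_field_derivative partial_deriv i f z) (at 0)"
proof -
  have "(\<lambda>t. f (z + t *s axis i 1)) field_differentiable (at 0)"
    unfolding field_differentiable_def
    using entire_fun_line_derivative[OF assms, of z "axis i 1" 0] ..
  thus ?thesis
    unfolding partial_deriv_def by (rule field_differentiable_derivI)
qed

lemma partial_deriv_eqI:
  "((\<lambda>t. f (z + t *s axis i 1)) has_field_derivative D) (at 0) \<Longrightarrow> partial_deriv i f z = D"
  unfolding partial_deriv_def by (rule DERIV_imp_deriv)

lemma partial_deriv_const: "partial_deriv i (\<lambda>z. c) z = 0"
  by (rule partial_deriv_eqI) simp

lemma partial_deriv_add:
  assumes "entire_fun f" "entire_fun g"
  shows "partial_deriv i (\<lambda>z. f z + g z) z = partial_deriv i f z + partial_deriv i g z"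
  by (rule partial_deriv_eqI, rule DERIV_add; rule partial_deriv_DERIV, rule assms)

lemma partial_deriv_mult:
  assumes "entire_fun f" "entire_fun g"
  shows "partial_deriv i (\<lambda>z. f z * g z) z = partial_deriv i f z * g z + f z * partial_deriv i g z"
  using DERIV_mult[OF partial_deriv_DERIV[OF assms(1), of z i] partial_deriv_DERIV[OF assms(2), of z i]]
  by (intro partial_deriv_eqI) (simp add: mult.commute add.commute)

lemma partial_deriv_exp:
  assumes "entire_fun f"
  shows "partial_deriv i (\<lambda>z. exp (f z)) z = partial_deriv i f z * exp (f z)"
  using DERIV_fun_exp[OF partial_deriv_DERIV[OF assms, of z i]]
  by (intro partial_deriv_eqI) (simp add: mult.commute)

lemma partial_deriv_component: "partial_deriv i (\<lambda>z. z $ j) z = (if i = j then 1 else 0)"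
proof (rule partial_deriv_eqI)
  have "(\<lambda>t. (z + t *s axis i 1) $ j) = (\<lambda>t. z $ j + t * (if i = j then 1 else 0))"
    by (rule ext) (simp add: axis_def eq_commute)
  moreover have "((\<lambda>t. z $ j + t * (if i = j then 1 else 0)) has_field_derivative (if i = j then 1 else 0)) (at 0)"
    by (auto intro!: derivative_eq_intros)
  ultimately show "((\<lambda>t. (z + t *s axis i 1) $ j) has_field_derivative (if i = j then 1 else 0)) (at 0)"
    by simp
qed

lemma polynomial_fun_partial_deriv:
  assumes "polynomial_fun p" shows "polynomial_fun (partial_deriv i p)"
proof -
  have "polynomial_fun p \<and> polynomial_fun (partial_deriv i p)"
    using assms
  proof (induction rule: polynomial_fun_induct)
    case (const c)
    have "partial_deriv i (\<lambda>z. c) = (\<lambda>z. 0)" by (rule ext) (rule partial_deriv_const)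
    thus ?case by (simp add: polynomial_fun_const)
  next
    case (component j)
    have "partial_deriv i (\<lambda>z. z $ j) = (\<lambda>z. if i = j then 1 else 0)"
      by (rule ext) (rule partial_deriv_component)
    thus ?case by (simp add: polynomial_fun_const polynomial_fun_component)
  next
    case (add f g)
    have "partial_deriv i (\<lambda>z. f z + g z) = (\<lambda>z. partial_deriv i f z + partial_deriv i g z)"
      using add by (intro ext partial_deriv_add polynomial_fun_imp_entire_fun) auto
    thus ?case using add by (simp add: polynomial_fun_add)
  next
    case (mult f g)
    have "partial_deriv i (\<lambda>z. f z * g z) = (\<lambda>z. partial_deriv i f z * g z + f z * partial_deriv i g z)"
      using mult by (intro ext partial_deriv_mult polynomial_fun_imp_entire_fun) auto
    thus ?case using mult by (simp add: polynomial_fun_add polynomial_fun_mult)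
  qed
  thus ?thesis ..
qed

section \<open>The induced derivations of the field of fractions\<close>

lift_definition pd :: "'n::finite \<Rightarrow> 'n entire \<Rightarrow> 'n entire" is partial_deriv
  by (rule entire_fun_partial_deriv)

lemma pd_add: "pd i (f + g) = pd i f + pd i g"
  by transfer (intro ext partial_deriv_add)

lemma pd_mult: "pd i (f * g) = pd i f * g + f * pd i g"
  by transfer (intro ext partial_deriv_mult)

lemma pd_zero: "pd i 0 = 0"
  by transfer (intro ext partial_deriv_const)

lemma pd_one: "pd i 1 = 0"
  by transfer (intro ext partial_deriv_const)

lemma pd_exp: "pd i (exp_entire f) = pd i f * exp_entire f"
  by transfer (intro ext partial_deriv_exp)

lemma pd_in_polynomials: "p \<in> polynomials \<Longrightarrow> pd i p \<in> polynomials"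
  unfolding polynomials_def by (simp add: pd.rep_eq polynomial_fun_partial_deriv)

text \<open>The quotient rule for an arbitrarily chosen representative; \<open>der_Fract\<close>
  shows that the choice does not matter.\<close>

definition der :: "'n::finite \<Rightarrow> 'n meromorphic \<Rightarrow> 'n meromorphic" where
  "der i x = (let (a, b) = (SOME (a, b). b \<noteq> 0 \<and> x = Fract a b)
              in Fract (pd i a * b - a * pd i b) (b * b))"

lemma der_Fract:
  assumes "b \<noteq> 0"
  shows "der i (Fract a b) = Fract (pd i a * b - a * pd i b) (b * b)"
proof -
  define ab where "ab = (SOME (a', b'). b' \<noteq> 0 \<and> Fract a b = Fract a' b')"
  obtain a' b' where ab': "ab = (a', b')" by (cases ab)
  have "(case ab of (a', b') \<Rightarrow> b' \<noteq> 0 \<and> Fract a b = Fract a' b')"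
    unfolding ab_def by (rule someI[of _ "(a, b)"]) (use assms in simp)
  hence b': "b' \<noteq> 0" and "Fract a b = Fract a' b'" by (simp_all add: ab')
  hence eq: "a * b' = a' * b" using assms by (simp add: eq_fract)
  have "pd i (a * b') = pd i (a' * b)" by (simp add: eq)
  hence deq: "pd i a * b' + a * pd i b' = pd i a' * b + a' * pd i b"
    by (simp only: pd_mult)
  \<comment> \<open>The difference of the cross products is a combination of
    \<open>a * b' - a' * b\<close> and of its derivative.\<close>
  have "(pd i a' * b' - a' * pd i b') * (b * b) - (pd i a * b - a * pd i b) * (b' * b') =
      b * b' * ((pd i a' * b + a' * pd i b) - (pd i a * b' + a * pd i b'))
      + (a * b' - a' * b) * (pd i b * b' + b * pd i b')"
    by (simp add: algebra_simps)
  also have "\<dots> = 0" by (simp add: eq deq)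
  finally have "(pd i a' * b' - a' * pd i b') * (b * b) = (pd i a * b - a * pd i b) * (b' * b')"
    by (simp only: right_minus_eq)
  moreover have "der i (Fract a b) = Fract (pd i a' * b' - a' * pd i b') (b' * b')"
    unfolding der_def ab_def[symmetric] ab' by simp
  ultimately show ?thesis using assms b' by (simp add: eq_fract)
qed

lemma der_add: "der i (x + y) = der i x + der i y"
proof -
  obtain a b where x: "x = Fract a b" "b \<noteq> 0" by (rule Fract_cases)
  obtain c d where y: "y = Fract c d" "d \<noteq> 0" by (rule Fract_cases)
  show ?thesis
    using x(2) y(2)
    by (simp add: x(1) y(1) der_Fract eq_fract pd_add pd_mult) (simp add: algebra_simps)
qed

lemma der_mult: "der i (x * y) = der i x * y + x * der i y"
proof -
  obtain a b where x: "x = Fract a b" "b \<noteq> 0" by (rule Fract_cases)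
  obtain c d where y: "y = Fract c d" "d \<noteq> 0" by (rule Fract_cases)
  show ?thesis
    using x(2) y(2)
    by (simp add: x(1) y(1) der_Fract eq_fract pd_add pd_mult) (simp add: algebra_simps)
qed

lemma der_Fract_one: "der i (Fract a 1) = Fract (pd i a) 1"
  by (simp add: der_Fract pd_one)

lemma der_zero: "der i 0 = 0"
  unfolding Zero_fract_def der_Fract_one by (simp add: pd_zero)

lemma der_power: "der i (x ^ Suc k) = of_nat (Suc k) * x ^ k * der i x"
proof (induction k)
  case (Suc k)
  have "der i (x ^ Suc (Suc k)) = der i x * x ^ Suc k + x * der i (x ^ Suc k)"
    unfolding power_Suc[of x "Suc k"] by (rule der_mult)
  also have "\<dots> = of_nat (Suc (Suc k)) * x ^ Suc k * der i x"
    unfolding Suc by (simp add: algebra_simps)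
  finally show ?case .
qed simp

text \<open>The logarithmic derivative of a quotient is the difference of the logarithmic
  derivatives.\<close>

lemma der_divide_eq_zero:
  assumes "y \<noteq> 0" "der i x = s * x" "der i y = s * y"
  shows "der i (x / y) = 0"
proof -
  have "x = (x / y) * y" using assms(1) by simp
  hence "der i x = der i (x / y) * y + (x / y) * der i y" by (metis der_mult)
  hence "der i (x / y) * y = 0" using assms by simp
  thus ?thesis using assms(1) by simp
qed

text \<open>On the line from a point \<open>z0\<close> with b(z0) nonzero to an arbitrary z, the
  Wronskian of numerator and denominator vanishes. Their quotient is constant on a small disc free
  of zeros of the denominator; the zeros further along the line are passed by the identity theorem
  for the entire function A - c B.\<close>

lemma constant_if_ders_zero:
  fixes x :: "'n::finite meromorphic"
  assumes "\<And>i. der i x = 0"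
  shows "\<exists>c. x = Fract (const_entire c) 1"
proof -
  obtain a b where x: "x = Fract a b" "b \<noteq> 0" by (rule Fract_cases)
  have "pd i a * b - a * pd i b = 0" for i
  proof -
    have "Fract (pd i a * b - a * pd i b) (b * b) = Fract 0 1"
      using assms[of i] x by (simp add: der_Fract Zero_fract_def)
    thus ?thesis using x(2) by (simp add: eq_fract)
  qed
  hence "pd i a * b = a * pd i b" for i by simp
  hence pd: "partial_deriv i (eval_entire a) z * eval_entire b z = eval_entire a z * partial_deriv i (eval_entire b) z" for i z
    by (metis pd.rep_eq times_entire.rep_eq)
  have "\<exists>z0. eval_entire b z0 \<noteq> 0"
    using x(2) by (metis eval_entire_eqI zero_entire.rep_eq)
  then obtain z0 where z0: "eval_entire b z0 \<noteq> 0" ..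
  define c where "c = eval_entire a z0 / eval_entire b z0"
  have "eval_entire a z = c * eval_entire b z" for z
  proof -
    define A where "A = (\<lambda>t. eval_entire a (z0 + t *s (z - z0)))"
    define B where "B = (\<lambda>t. eval_entire b (z0 + t *s (z - z0)))"
    define A' where "A' = (\<lambda>t. \<Sum>i\<in>UNIV. (z - z0) $ i * partial_deriv i (eval_entire a) (z0 + t *s (z - z0)))"
    define B' where "B' = (\<lambda>t. \<Sum>i\<in>UNIV. (z - z0) $ i * partial_deriv i (eval_entire b) (z0 + t *s (z - z0)))"
    have hol: "A holomorphic_on UNIV" "B holomorphic_on UNIV"
      unfolding A_def B_def by (rule entire_fun_on_line[OF entire_fun_eval])+
    have DA: "(A has_field_derivative A' t) (at t)" for t
      unfolding A_def A'_def by (rule entire_fun_line_derivative[OF entire_fun_eval])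
    have DB: "(B has_field_derivative B' t) (at t)" for t
      unfolding B_def B'_def by (rule entire_fun_line_derivative[OF entire_fun_eval])
    have W: "A' t * B t = A t * B' t" for t
      unfolding A_def A'_def B_def B'_def sum_distrib_right sum_distrib_left
      by (intro sum.cong refl) (simp add: mult.assoc mult.left_commute pd)
    have B0: "B 0 \<noteq> 0" using z0 by (simp add: B_def)
    have "open (B -` (- {0}))"
      using holomorphic_on_imp_continuous_on[OF hol(2)] by (intro open_vimage) auto
    moreover have "0 \<in> B -` (- {0})" using B0 by simp
    ultimately obtain e where e: "e > 0" "ball 0 e \<subseteq> B -` (- {0})"
      by (rule openE)
    hence nz: "B t \<noteq> 0" if "t \<in> ball 0 e" for t using that by auto
    have "\<exists>k. \<forall>t\<in>ball 0 e. A t / B t = k"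
    proof (rule has_field_derivative_zero_constant)
      show "((\<lambda>t. A t / B t) has_field_derivative 0) (at s within ball 0 e)" if "s \<in> ball 0 e" for s
      proof -
        have "((\<lambda>t. A t / B t) has_field_derivative (A' s * B s - A s * B' s) / (B s * B s)) (at s)"
          by (rule DERIV_divide[OF DA DB nz[OF that]])
        thus ?thesis using W[of s] by (simp add: has_field_derivative_at_within)
      qed
    qed simp
    hence "A t / B t = A 0 / B 0" if "t \<in> ball 0 e" for t
      using that e(1) by (metis centre_in_ball)
    hence near: "A t - c * B t = 0" if "t \<in> ball 0 e" for t
    proof -
      have "A t / B t = c" using \<open>\<And>t. t \<in> ball 0 e \<Longrightarrow> A t / B t = _\<close>[OF that] by (simp add: c_def A_def B_def)
      thus ?thesis using nz[OF that] by (simp add: divide_eq_eq)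
    qed
    have "A 1 - c * B 1 = 0"
      by (rule analytic_continuation_open[of "ball 0 e" UNIV "\<lambda>t. A t - c * B t" "\<lambda>_. 0" 1])
         (use e near in \<open>auto intro!: holomorphic_intros hol\<close>)
    thus ?thesis by (simp add: A_def B_def)
  qed
  hence "a = const_entire c * b"
    by (intro eval_entire_eqI) (simp add: times_entire.rep_eq const_entire.rep_eq)
  hence "x = Fract (const_entire c) 1" using x by (simp add: eq_fract)
  thus ?thesis ..
qed

section \<open>The field of rational functions\<close>

lemma rational_functionsI: "p \<in> polynomials \<Longrightarrow> q \<in> polynomials \<Longrightarrow> q \<noteq> 0 \<Longrightarrow> Fract p q \<in> rational_functions"
  unfolding rational_functions_def by blast

lemma rational_functionsE:
  assumes "x \<in> rational_functions"
  obtains p q where "x = Fract p q" "p \<in> polynomials" "q \<in> polynomials" "q \<noteq> 0"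
  using assms unfolding rational_functions_def by blast

lemma zero_in_rational_functions: "0 \<in> rational_functions"
  unfolding Zero_fract_def by (intro rational_functionsI zero_in_polynomials one_in_polynomials) simp

lemma one_in_rational_functions: "1 \<in> rational_functions"
  unfolding One_fract_def by (intro rational_functionsI one_in_polynomials) simp

lemma rational_functions_closed:
  assumes "x \<in> rational_functions" "y \<in> rational_functions"
  shows "x + y \<in> rational_functions" "x * y \<in> rational_functions" "x - y \<in> rational_functions"
    "- x \<in> rational_functions" "inverse x \<in> rational_functions" "der i x \<in> rational_functions"
proof -
  obtain a b where x: "x = Fract a b" "a \<in> polynomials" "b \<in> polynomials" "b \<noteq> 0"
    using assms(1) by (rule rational_functionsE)
  obtain c d where y: "y = Fract c d" "c \<in> polynomials" "d \<in> polynomials" "d \<noteq> 0"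
    using assms(2) by (rule rational_functionsE)
  note intros = rational_functionsI add_in_polynomials diff_in_polynomials mult_in_polynomials
    uminus_in_polynomials pd_in_polynomials x(2-4) y(2-4) no_zero_divisors
  show "x + y \<in> rational_functions" "x * y \<in> rational_functions" "x - y \<in> rational_functions"
    "- x \<in> rational_functions"
    using x(4) y(4) by (simp_all add: x(1) y(1)) (intro intros)+
  show "der i x \<in> rational_functions"
    unfolding x(1) der_Fract[OF x(4)] by (intro intros)
  show "inverse x \<in> rational_functions"
  proof (cases "a = 0")
    case True
    hence "x = 0" using x by (simp add: fract_collapse)
    thus ?thesis using zero_in_rational_functions by simp
  next
    case False
    have "inverse x = Fract b a" unfolding x(1) by simp
    thus ?thesis using False by (simp only:) (intro intros)
  qed
qed

text \<open>The field K becomes a type of its own so that K[X] is a polynomial type with gcds and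
  Bezout coefficients.\<close>

typedef 'n ratfun = "rational_functions :: 'n::finite meromorphic set"
  morphisms of_ratfun Abs_ratfun
  using zero_in_rational_functions by blast

setup_lifting type_definition_ratfun

instantiation ratfun :: (finite) field
begin

lift_definition zero_ratfun :: "'a ratfun" is 0 by (rule zero_in_rational_functions)
lift_definition one_ratfun :: "'a ratfun" is 1 by (rule one_in_rational_functions)
lift_definition plus_ratfun :: "'a ratfun \<Rightarrow> 'a ratfun \<Rightarrow> 'a ratfun" is "(+)"
  by (rule rational_functions_closed)
lift_definition minus_ratfun :: "'a ratfun \<Rightarrow> 'a ratfun \<Rightarrow> 'a ratfun" is "(-)"
  by (rule rational_functions_closed)
lift_definition uminus_ratfun :: "'a ratfun \<Rightarrow> 'a ratfun" is uminus
  by (rule rational_functions_closed)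
lift_definition times_ratfun :: "'a ratfun \<Rightarrow> 'a ratfun \<Rightarrow> 'a ratfun" is "(*)"
  by (rule rational_functions_closed)
lift_definition inverse_ratfun :: "'a ratfun \<Rightarrow> 'a ratfun" is inverse
  by (rule rational_functions_closed)
definition divide_ratfun :: "'a ratfun \<Rightarrow> 'a ratfun \<Rightarrow> 'a ratfun" where
  "divide_ratfun x y = x * inverse y"

instance
proof
  fix x y z :: "'a ratfun"
  show "x * y * z = x * (y * z)" by transfer (rule mult.assoc)
  show "x * y = y * x" by transfer (rule mult.commute)
  show "1 * x = x" by transfer (rule mult_1)
  show "x + y + z = x + (y + z)" by transfer (rule add.assoc)
  show "x + y = y + x" by transfer (rule add.commute)
  show "0 + x = x" by transfer (rule add_0)
  show "- x + x = 0" by transfer (rule ab_left_minus)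
  show "x - y = x + - y" by transfer (rule diff_conv_add_uminus)
  show "(x + y) * z = x * z + y * z" by transfer (rule distrib_right)
  show "(0 :: 'a ratfun) \<noteq> 1" by transfer (rule zero_neq_one)
  show "inverse x * x = 1" if "x \<noteq> 0" using that by transfer (rule left_inverse)
  show "x div y = x * inverse y" by (rule divide_ratfun_def)
  show "inverse (0 :: 'a ratfun) = 0" by transfer (rule inverse_zero)
qed

end

text \<open>The trivial Euclidean structure, in which every nonzero element is a unit; the gcd on
  polynomials over the field rests on it.\<close>

instantiation ratfun :: (finite)
  "{unique_euclidean_ring, normalization_euclidean_semiring, normalization_semidom_multiplicative}"
begin

definition [simp]: "normalize_ratfun = (normalize_field :: 'a ratfun \<Rightarrow> _)"
definition [simp]: "unit_factor_ratfun = (unit_factor_field :: 'a ratfun \<Rightarrow> _)"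
definition [simp]: "modulo_ratfun = (mod_field :: 'a ratfun \<Rightarrow> _)"
definition [simp]: "euclidean_size_ratfun = (euclidean_size_field :: 'a ratfun \<Rightarrow> _)"
definition [simp]: "division_segment (x :: 'a ratfun) = 1"

instance
  by standard
    (simp_all add: dvd_field_iff field_split_simps split: if_splits)

end

instantiation ratfun :: (finite) euclidean_ring_gcd
begin

definition gcd_ratfun :: "'a ratfun \<Rightarrow> 'a ratfun \<Rightarrow> 'a ratfun" where
  "gcd_ratfun = Euclidean_Algorithm.gcd"
definition lcm_ratfun :: "'a ratfun \<Rightarrow> 'a ratfun \<Rightarrow> 'a ratfun" where
  "lcm_ratfun = Euclidean_Algorithm.lcm"
definition Gcd_ratfun :: "'a ratfun set \<Rightarrow> 'a ratfun" where
  "Gcd_ratfun = Euclidean_Algorithm.Gcd"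
definition Lcm_ratfun :: "'a ratfun set \<Rightarrow> 'a ratfun" where
  "Lcm_ratfun = Euclidean_Algorithm.Lcm"

instance
  by standard (simp_all add: gcd_ratfun_def lcm_ratfun_def Gcd_ratfun_def Lcm_ratfun_def)

end

instance ratfun :: (finite) field_gcd ..

lift_definition rder :: "'n::finite \<Rightarrow> 'n ratfun \<Rightarrow> 'n ratfun" is der
  by (rule rational_functions_closed)

lemma rder_zero: "rder i 0 = 0"
  by transfer (rule der_zero)

text \<open>Characteristic 0 ensures that nonconstant polynomials have nonzero derivatives and
  permits division by the degree in the definition of b.\<close>

instance ratfun :: (finite) field_char_0
proof
  have of_nat: "of_ratfun (of_nat n :: 'a ratfun) = of_nat n" for n
    by (induction n) (simp_all add: zero_ratfun.rep_eq one_ratfun.rep_eq plus_ratfun.rep_eq)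
  have of_nat': "(of_nat n :: 'a meromorphic) = Fract (const_entire (of_nat n)) 1" for n
  proof (induction n)
    case 0
    have "const_entire 0 = (0 :: 'a entire)" by transfer simp
    thus ?case by (simp add: Zero_fract_def)
  next
    case (Suc n)
    have "const_entire (of_nat (Suc n)) = (1 + const_entire (of_nat n) :: 'a entire)" by transfer simp
    thus ?case by (simp add: Suc One_fract_def)
  qed
  show "inj (of_nat :: nat \<Rightarrow> 'a ratfun)"
  proof (rule injI)
    fix m n assume "(of_nat m :: 'a ratfun) = of_nat n"
    hence "(of_nat m :: 'a meromorphic) = of_nat n" using of_nat by metis
    hence "const_entire (of_nat m) = (const_entire (of_nat n) :: 'a entire)"
      by (simp add: of_nat' eq_fract)
    hence "eval_entire (const_entire (of_nat m) :: 'a entire) 0 = eval_entire (const_entire (of_nat n) :: 'a entire) 0"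
      by (rule arg_cong)
    thus "m = n" by (simp add: const_entire.rep_eq)
  qed
qed

section \<open>Evaluation of polynomials over the rational functions\<close>

definition rpoly :: "'n::finite ratfun poly \<Rightarrow> 'n meromorphic \<Rightarrow> 'n meromorphic" where
  "rpoly P x = poly (map_poly of_ratfun P) x"

lemma rpoly_0 [simp]: "rpoly 0 x = 0"
  by (simp add: rpoly_def)

lemma rpoly_pCons [simp]: "rpoly (pCons a P) x = of_ratfun a + x * rpoly P x"
  by (simp add: rpoly_def map_poly_pCons zero_ratfun.rep_eq)

lemma rpoly_1 [simp]: "rpoly 1 x = 1"
  using rpoly_pCons[of 1 0 x] by (simp add: one_ratfun.rep_eq one_pCons)

lemma rpoly_add: "rpoly (P + Q) x = rpoly P x + rpoly Q x"
  by (induction P Q rule: poly_induct2) (simp_all add: plus_ratfun.rep_eq algebra_simps)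

lemma rpoly_smult: "rpoly (smult c P) x = of_ratfun c * rpoly P x"
  by (induction P) (simp_all add: times_ratfun.rep_eq algebra_simps)

lemma rpoly_mult: "rpoly (P * Q) x = rpoly P x * rpoly Q x"
  by (induction P) (simp_all add: rpoly_add rpoly_smult zero_ratfun.rep_eq algebra_simps)

lemma rpoly_uminus: "rpoly (- P) x = - rpoly P x"
  by (induction P) (simp_all add: uminus_ratfun.rep_eq algebra_simps)

lemma rpoly_diff: "rpoly (P - Q) x = rpoly P x - rpoly Q x"
  using rpoly_add[of P "- Q" x] by (simp add: rpoly_uminus)

lemma rpoly_power: "rpoly (P ^ k) x = rpoly P x ^ k"
  by (induction k) (simp_all add: rpoly_mult)

lemma map_poly_rder_pCons: "map_poly (rder i) (pCons a P) = pCons (rder i a) (map_poly (rder i) P)"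
  by (rule map_poly_pCons) (rule rder_zero)

lemma der_rpoly:
  "der i (rpoly P x) = rpoly (map_poly (rder i) P) x + rpoly (pderiv P) x * der i x"
proof (induction P)
  case 0
  show ?case by (simp add: der_zero)
next
  case (pCons a P)
  have "der i (rpoly (pCons a P) x) = der i (of_ratfun a) + (der i x * rpoly P x + x * der i (rpoly P x))"
    by (simp add: der_add der_mult)
  also have "der i (of_ratfun a) = of_ratfun (rder i a)" by (simp add: rder.rep_eq)
  finally show ?case
    unfolding pCons.IH by (simp add: map_poly_rder_pCons pderiv_pCons rpoly_add zero_ratfun.rep_eq algebra_simps)
qed

lemma of_ratfun_in_rational: "of_ratfun a \<in> rational_functions"
  by (rule of_ratfun)

lemma rational_functions_eq_range: "rational_functions = range of_ratfun"
  by (metis Abs_ratfun_inverse of_ratfun rangeI subsetI subset_antisym image_subset_iff rangeE)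

section \<open>Algebras generated over the rational functions\<close>

lemma merom_closed:
  assumes "x \<in> merom_alg_poles" "y \<in> merom_alg_poles"
  shows "x + y \<in> merom_alg_poles" "x * y \<in> merom_alg_poles"
  using is_subalgebra_merom_alg_poles assms unfolding is_subalgebra_def by blast+

lemma one_in_merom: "1 \<in> merom_alg_poles"
  using is_subalgebra_merom_alg_poles unfolding is_subalgebra_def by blast

lemma merom_power: "x \<in> merom_alg_poles \<Longrightarrow> x ^ k \<in> merom_alg_poles"
  by (induction k) (simp_all add: one_in_merom merom_closed)

lemma of_ratfun_in_merom: "of_ratfun a \<in> merom_alg_poles"
  using of_ratfun_in_rational rational_functions_subset by blast

lemma rpoly_in_merom: "x \<in> merom_alg_poles \<Longrightarrow> rpoly P x \<in> merom_alg_poles"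
proof (induction P)
  case 0
  show ?case using of_ratfun_in_merom[of 0] by (simp add: zero_ratfun.rep_eq)
qed (simp add: merom_closed of_ratfun_in_merom)

lemma rational_alg_closed:
  assumes "x \<in> rational_alg G" "y \<in> rational_alg G"
  shows "x + y \<in> rational_alg G" "x * y \<in> rational_alg G"
  using is_subalgebra_rational_alg assms unfolding is_subalgebra_def by blast+

lemma rational_alg_generators: "rational_functions \<subseteq> rational_alg G" "G \<subseteq> rational_alg G"
  unfolding rational_alg_def using hull_subset[of "rational_functions \<union> G" is_subalgebra] by auto

lemma rational_alg_subsetI: "G \<subseteq> rational_alg G' \<Longrightarrow> rational_alg G \<subseteq> rational_alg G'"
  unfolding rational_alg_def[of G]
  by (rule hull_minimal) (use rational_alg_generators is_subalgebra_rational_alg in auto)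

lemma is_subalgebraI:
  assumes "rational_functions \<subseteq> B" "\<And>f g. f \<in> B \<Longrightarrow> g \<in> B \<Longrightarrow> f + g \<in> B"
    "\<And>f g. f \<in> B \<Longrightarrow> g \<in> B \<Longrightarrow> f * g \<in> B"
  shows "is_subalgebra B"
proof -
  have "Fract (const_entire c) 1 \<in> B" for c
    using assms(1) rational_functionsI[OF const_in_polynomials one_in_polynomials] by auto
  with assms one_in_rational_functions show ?thesis unfolding is_subalgebra_def by blast
qed

lemma rpoly_X [simp]: "rpoly [:0, 1:] x = x"
  by (simp add: zero_ratfun.rep_eq one_ratfun.rep_eq)

lemma rpoly_linear: "rpoly [:- b, 1:] x = x - of_ratfun b"
  by (simp add: uminus_ratfun.rep_eq one_ratfun.rep_eq)

lemma rpoly_in_rational_alg: "x \<in> rational_alg G \<Longrightarrow> rpoly P x \<in> rational_alg G"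
proof (induction P)
  case 0
  show ?case by (simp add: subsetD[OF rational_alg_generators(1)] zero_in_rational_functions)
next
  case (pCons a P)
  have "of_ratfun a \<in> rational_alg G"
    using rational_alg_generators(1) of_ratfun_in_rational by blast
  with pCons show ?case by (simp add: rational_alg_closed)
qed

lemma rational_alg_single: "rational_alg {x} = range (\<lambda>P. rpoly P x)"
proof
  show "range (\<lambda>P. rpoly P x) \<subseteq> rational_alg {x}"
    using rational_alg_generators(2)[of "{x}"] rpoly_in_rational_alg[of x] by blast
  have rat: "of_ratfun a \<in> range (\<lambda>P. rpoly P x)" for a
    by (rule range_eqI[of _ _ "[:a:]"]) simp
  have "is_subalgebra (range (\<lambda>P. rpoly P x))"
  proof (rule is_subalgebraI)
    show "rational_functions \<subseteq> range (\<lambda>P. rpoly P x)"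
      unfolding rational_functions_eq_range using rat by blast
    show "f + g \<in> range (\<lambda>P. rpoly P x)" "f * g \<in> range (\<lambda>P. rpoly P x)"
      if "f \<in> range (\<lambda>P. rpoly P x)" "g \<in> range (\<lambda>P. rpoly P x)" for f g
    proof -
      obtain P Q where "f = rpoly P x" "g = rpoly Q x" using \<open>f \<in> _\<close> \<open>g \<in> _\<close> by blast
      hence "f + g = rpoly (P + Q) x" "f * g = rpoly (P * Q) x"
        by (simp_all add: rpoly_add rpoly_mult)
      thus "f + g \<in> range (\<lambda>P. rpoly P x)" "f * g \<in> range (\<lambda>P. rpoly P x)" by auto
    qed
  qed
  moreover have "x \<in> range (\<lambda>P. rpoly P x)"
    by (rule range_eqI) (rule rpoly_X[symmetric])
  ultimately show "rational_alg {x} \<subseteq> range (\<lambda>P. rpoly P x)"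
    unfolding rational_alg_def rational_functions_eq_range
    by (intro hull_minimal) (use rat in auto)
qed

lemma rational_alg_inverse_pair:
  fixes x :: "'a::finite meromorphic"
  assumes "x \<noteq> 0"
  shows "rational_alg {x, inverse x} = {rpoly P x / x ^ k | P k. True}" (is "_ = ?B")
proof
  have x: "x \<in> rational_alg {x, inverse x}" "inverse x \<in> rational_alg {x, inverse x}"
    using rational_alg_generators(2)[of "{x, inverse x}"] by auto
  have "inverse x ^ k \<in> rational_alg {x, inverse x}" for k
  proof (induction k)
    case 0
    show ?case by (simp add: subsetD[OF rational_alg_generators(1)] one_in_rational_functions)
  next
    case (Suc k)
    show ?case unfolding power_Suc by (intro rational_alg_closed Suc x)
  qed
  thus "?B \<subseteq> rational_alg {x, inverse x}"
    using rpoly_in_rational_alg[OF x(1)]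
    by (auto simp: divide_inverse power_inverse intro!: rational_alg_closed)
  have I: "rpoly P x / x ^ k \<in> ?B" for P k by blast
  have add: "rpoly P x / x ^ k + rpoly Q x / x ^ l \<in> ?B" for P Q k l
  proof -
    have eq: "rpoly P x / x ^ k + rpoly Q x / x ^ l = rpoly (P * [:0, 1:] ^ l + Q * [:0, 1:] ^ k) x / x ^ (k + l)"
      unfolding rpoly_add rpoly_mult rpoly_power rpoly_X using assms by (simp add: add_frac_eq power_add)
    show ?thesis unfolding eq by (rule I)
  qed
  have mult: "(rpoly P x / x ^ k) * (rpoly Q x / x ^ l) \<in> ?B" for P Q k l
  proof -
    have eq: "(rpoly P x / x ^ k) * (rpoly Q x / x ^ l) = rpoly (P * Q) x / x ^ (k + l)"
      unfolding rpoly_mult by (simp add: power_add)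
    show ?thesis unfolding eq by (rule I)
  qed
  have rat: "rational_functions \<subseteq> ?B"
  proof
    fix y :: "'a meromorphic" assume "y \<in> rational_functions"
    then obtain a where "y = of_ratfun a" unfolding rational_functions_eq_range by blast
    hence y: "y = rpoly [:a:] x / x ^ 0" by simp
    show "y \<in> ?B" unfolding y by (rule I)
  qed
  have "is_subalgebra ?B"
    by (rule is_subalgebraI[OF rat]) (use add mult in auto)
  moreover have "x \<in> ?B"
    using I[of "[:0, 1:]" 0] unfolding rpoly_X by simp
  moreover have "inverse x \<in> ?B"
    using I[of 1 1] by (simp add: inverse_eq_divide)
  ultimately show "rational_alg {x, inverse x} \<subseteq> ?B"
    unfolding rational_alg_def by (intro hull_minimal) (use rat in auto)
qed

text \<open>Horner's scheme with cleared denominators: sums and products with polynomials keep the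
  numerator within the growth class that the theorem on divisors of polynomials requires.\<close>

lemma rpoly_finite_order:
  assumes "exp_poly_bounded (eval_entire f)"
  shows "\<exists>E q. rpoly P (Fract f 1) = Fract E q \<and> exp_poly_bounded (eval_entire E) \<and> q \<in> polynomials \<and> q \<noteq> 0"
proof (induction P)
  case 0
  have "exp_poly_bounded (eval_entire (0 :: 'a entire))"
    by (intro exp_poly_bounded_polynomial_fun) (simp add: zero_entire.rep_eq polynomial_fun_const)
  thus ?case
    by (intro exI[of _ 0] exI[of _ 1]) (simp add: Zero_fract_def one_in_polynomials)
next
  case (pCons a P)
  obtain E q where Eq: "rpoly P (Fract f 1) = Fract E q" "exp_poly_bounded (eval_entire E)"
    "q \<in> polynomials" "q \<noteq> 0" using pCons.IH by blast
  obtain b c where bc: "of_ratfun a = Fract b c" "b \<in> polynomials" "c \<in> polynomials" "c \<noteq> 0"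
    using of_ratfun_in_rational[of a] by (rule rational_functionsE)
  have "rpoly (pCons a P) (Fract f 1) = Fract (b * q + f * E * c) (c * q)"
    using Eq bc by (simp add: mult_ac)
  moreover have "exp_poly_bounded (eval_entire (b * q + f * E * c))"
    unfolding plus_entire.rep_eq times_entire.rep_eq
    by (intro exp_poly_bounded_add exp_poly_bounded_mult Eq assms exp_poly_bounded_polynomial_fun)
       (use bc Eq in \<open>simp_all add: polynomials_def\<close>)
  moreover have "c * q \<in> polynomials" "c * q \<noteq> 0"
    using bc Eq by (simp_all add: mult_in_polynomials)
  ultimately show ?case by blast
qed

text \<open>If 1/x = h/p, then E h = q p, so the numerator \<open>E\<close> is an entire divisor of
  a polynomial.\<close>

lemma exp_form_if_inverse_in_merom:
  assumes x: "x = Fract E q" "exp_poly_bounded (eval_entire E)" "q \<in> polynomials" "q \<noteq> 0"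
    and "x \<noteq> 0" "inverse x \<in> merom_alg_poles"
  obtains a u where "a \<noteq> 0" "u \<in> polynomials" "x = of_ratfun a * Fract (exp_entire u) 1"
proof -
  obtain h p where hp: "inverse x = Fract h p" "p \<in> polynomials" "p \<noteq> 0"
    using assms(6) unfolding merom_alg_poles_def by blast
  have "x * inverse x = 1" using assms(5) by simp
  hence "Fract E q * Fract h p = 1" using hp(1) x(1) by metis
  hence "Fract (E * h) (q * p) = Fract 1 1" by (simp only: mult_fract One_fract_def)
  hence Eh: "E * h = q * p" using x(4) hp(3) by (simp add: eq_fract)
  have "q * p \<in> polynomials" "q * p \<noteq> 0" using x hp by (simp_all add: mult_in_polynomials)
  have "polynomial_fun (eval_entire (q * p))"
    using \<open>q * p \<in> polynomials\<close> by (simp add: polynomials_def)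
  moreover have "eval_entire (q * p) \<noteq> (\<lambda>z. 0)"
  proof
    assume "eval_entire (q * p) = (\<lambda>z. 0)"
    hence "q * p = 0" by (intro eval_entire_eqI) (simp only: zero_entire.rep_eq)
    with \<open>q * p \<noteq> 0\<close> show False by contradiction
  qed
  moreover have "eval_entire E z * eval_entire h z = eval_entire (q * p) z" for z
    unfolding Eh[symmetric] by (simp add: times_entire.rep_eq)
  ultimately obtain r u where ru: "polynomial_fun r" "polynomial_fun u" "\<And>z. eval_entire E z = r z * exp (u z)"
    using entire_divisor_of_polynomial[OF entire_fun_eval entire_fun_eval _ _ _ x(2)] by blast
  define R where "R = Entire r"
  define U where "U = Entire u"
  have R: "eval_entire R = r" unfolding R_def
    using ru(1) by (simp add: Entire_inverse polynomial_fun_imp_entire_fun)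
  have U: "eval_entire U = u" unfolding U_def
    using ru(2) by (simp add: Entire_inverse polynomial_fun_imp_entire_fun)
  have RU: "R \<in> polynomials" "U \<in> polynomials" using ru by (simp_all add: polynomials_def R U)
  have "E = R * exp_entire U"
    by (rule eval_entire_eqI) (simp add: times_entire.rep_eq exp_entire.rep_eq R U ru(3))
  hence xE: "x = Fract R q * Fract (exp_entire U) 1" unfolding x(1) by simp
  define a where "a = Abs_ratfun (Fract R q)"
  have a: "of_ratfun a = Fract R q"
    unfolding a_def using rational_functionsI[OF RU(1) x(3,4)] by (rule Abs_ratfun_inverse)
  have "a \<noteq> 0"
  proof
    assume "a = 0"
    hence "Fract R q = 0" using a by (simp only: zero_ratfun.rep_eq)
    hence "x = 0" using xE by (simp only: mult_zero_left)
    with assms(5) show False by contradiction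
  qed
  with RU(2) xE a show ?thesis by (intro that) auto
qed

lemma log_derivative_exp_form:
  assumes "x = of_ratfun a * Fract (exp_entire u) 1" "a \<noteq> 0" "u \<in> polynomials"
  shows "\<exists>s. der i x = of_ratfun s * x"
proof -
  let ?e = "Fract (exp_entire u) 1"
  have nz: "of_ratfun a \<noteq> 0" using assms(2) by (metis of_ratfun_inject zero_ratfun.rep_eq)
  have "der i ?e = Fract (pd i u) 1 * ?e"
    by (simp add: der_Fract_one pd_exp)
  hence "der i x = (der i (of_ratfun a) * inverse (of_ratfun a) + Fract (pd i u) 1) * x"
    unfolding assms(1) der_mult using nz by (simp add: field_simps)
  moreover have "der i (of_ratfun a) * inverse (of_ratfun a) + Fract (pd i u) 1 \<in> rational_functions"
    by (rule rational_functions_closed(1)[OF rational_functions_closed(2)[OF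
          rational_functions_closed(6) rational_functions_closed(5)]])
       (rule of_ratfun_in_rational rational_functionsI pd_in_polynomials assms(3) one_in_polynomials one_neq_zero)+
  ultimately show ?thesis unfolding rational_functions_eq_range by (metis rangeE)
qed

lemma common_denominator:
  "\<exists>p. p \<in> polynomials \<and> p \<noteq> 0 \<and> (\<forall>j. \<exists>c\<in>polynomials. of_ratfun (coeff P j) * Fract p 1 = Fract c 1)"
proof (induction P)
  case 0
  show ?case
    by (intro exI[of _ 1]) (auto simp: zero_ratfun.rep_eq one_in_polynomials Zero_fract_def[symmetric] intro!: bexI[of _ 0] zero_in_polynomials)
next
  case (pCons a P)
  obtain p where p: "p \<in> polynomials" "p \<noteq> 0"
    "\<And>j. \<exists>c\<in>polynomials. of_ratfun (coeff P j) * Fract p 1 = Fract c 1"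
    using pCons.IH by blast
  obtain b c where bc: "of_ratfun a = Fract b c" "b \<in> polynomials" "c \<in> polynomials" "c \<noteq> 0"
    using of_ratfun_in_rational[of a] by (rule rational_functionsE)
  have "\<exists>e\<in>polynomials. of_ratfun (coeff (pCons a P) j) * Fract (c * p) 1 = Fract e 1" for j
  proof (cases j)
    case 0
    have "of_ratfun (coeff (pCons a P) j) * Fract (c * p) 1 = Fract (b * p) 1"
      using bc(4) by (simp add: 0 bc(1) eq_fract)
    thus ?thesis using mult_in_polynomials[OF bc(2) p(1)] by blast
  next
    case (Suc k)
    obtain e where e: "e \<in> polynomials" "of_ratfun (coeff P k) * Fract p 1 = Fract e 1"
      using p(3) by blast
    have "of_ratfun (coeff (pCons a P) j) * Fract (c * p) 1 = Fract c 1 * (of_ratfun (coeff P k) * Fract p 1)"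
      by (simp add: Suc mult.left_commute)
    also have "\<dots> = Fract (c * e) 1" by (simp add: e)
    finally show ?thesis using mult_in_polynomials[OF bc(3) e(1)] by blast
  qed
  moreover have "c * p \<in> polynomials" "c * p \<noteq> 0" using bc p by (simp_all add: mult_in_polynomials)
  ultimately show ?case by blast
qed

lemma rpoly_altdef: "rpoly P x = (\<Sum>j\<le>degree P. of_ratfun (coeff P j) * x ^ j)"
proof -
  have "degree (map_poly of_ratfun P) = degree P"
    by (rule degree_map_poly) (metis of_ratfun_inject zero_ratfun.rep_eq)
  thus ?thesis by (simp add: rpoly_def poly_altdef coeff_map_poly zero_ratfun.rep_eq)
qed

lemma Fract_one_sum: "Fract (sum g A) 1 = (\<Sum>j\<in>A. Fract (g j) 1)"
proof (induction A rule: infinite_finite_induct)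
  case (insert a A)
  have "Fract (g a + sum g A) 1 = Fract (g a) 1 + Fract (sum g A) 1" by simp
  with insert show ?case by simp
qed (simp_all add: Zero_fract_def)

lemma Fract_one_power: "Fract (f ^ k) 1 = Fract f 1 ^ k"
proof (induction k)
  case (Suc k)
  have "Fract (f * f ^ k) 1 = Fract f 1 * Fract (f ^ k) 1" by simp
  with Suc show ?case by (simp only: power_Suc)
qed (simp add: One_fract_def)

text \<open>
  If $c_d f^d + \dots + c_0 = 0$ with polynomials $c_j$ and $c_d \neq 0$, then $c_d f$ is integral over the
  polynomials, hence of polynomial growth, hence a polynomial.
\<close>

lemma rational_if_algebraic:
  assumes "rpoly P (Fract f 1) = 0" "P \<noteq> 0"
  shows "Fract f 1 \<in> rational_functions"
proof -
  define d where "d = degree P"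
  obtain p where p: "p \<in> polynomials" "p \<noteq> 0"
    "\<forall>j. \<exists>c. c \<in> polynomials \<and> of_ratfun (coeff P j) * Fract p 1 = Fract c 1"
    using common_denominator[of P] by blast
  then obtain c where c: "\<And>j. c j \<in> polynomials" "\<And>j. of_ratfun (coeff P j) * Fract p 1 = Fract (c j) 1"
    by metis
  have pnz: "Fract p 1 \<noteq> 0" using p(2) by (simp add: Zero_fract_def eq_fract)
  have "coeff P d \<noteq> 0" using assms(2) by (simp add: d_def)
  hence "Fract (c d) 1 \<noteq> 0"
    using pnz unfolding c(2)[symmetric] by (metis mult_eq_0_iff of_ratfun_inject zero_ratfun.rep_eq)
  hence cd: "c d \<noteq> 0" by (auto simp: Zero_fract_def)
  have "Fract (\<Sum>j\<le>d. c j * f ^ j) 1 = (\<Sum>j\<le>d. of_ratfun (coeff P j) * Fract f 1 ^ j) * Fract p 1"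
    unfolding Fract_one_sum sum_distrib_right
  proof (intro sum.cong refl)
    fix j
    have "Fract (c j * f ^ j) 1 = Fract (c j) 1 * Fract f 1 ^ j"
      by (simp flip: Fract_one_power)
    thus "Fract (c j * f ^ j) 1 = of_ratfun (coeff P j) * Fract f 1 ^ j * Fract p 1"
      unfolding c(2)[symmetric] by (simp only: mult_ac)
  qed
  also have "\<dots> = 0" using assms(1) by (simp add: rpoly_altdef d_def)
  finally have rel: "(\<Sum>j\<le>d. c j * f ^ j) = 0" by (simp add: Zero_fract_def eq_fract)
  show ?thesis
  proof (cases d)
    case 0
    with rel cd show ?thesis by simp
  next
    case (Suc k)
    define y where "y = c d * f"
    \<comment> \<open>Multiplying the relation by c_d^(d-1) makes \<open>y\<close> = c_d f a root of
      a monic polynomial; these are its lower coefficients.\<close>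
    define g where "g = (\<lambda>z j. eval_entire (c j) z * eval_entire (c d) z ^ (k - j))"
    have y_bound: "norm (eval_entire y z) \<le> 1 + (\<Sum>j<d. norm (g z j))" for z
    proof -
      define Q where "Q = monom 1 d + (\<Sum>j<d. monom (g z j) j)"
      have cQ: "coeff Q j = (if j = d then 1 else if j < d then g z j else 0)" for j
      proof -
        have "(\<Sum>i<d. coeff (monom (g z i) i) j) = (if j < d then g z j else 0)"
          unfolding coeff_monom by (subst sum.delta) auto
        thus ?thesis by (simp add: Q_def coeff_sum)
      qed
      have "degree Q \<le> d" by (rule degree_le) (simp add: cQ)
      moreover have "coeff Q d \<noteq> 0" by (simp add: cQ)
      ultimately have dQ: "degree Q = d" by (simp add: le_antisym le_degree)
      have "poly Q (eval_entire y z) = eval_entire (c d) z ^ k * (\<Sum>j\<le>d. eval_entire (c j) z * eval_entire f z ^ j)"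
      proof -
        have "(\<Sum>j<d. g z j * eval_entire y z ^ j) =
            (\<Sum>j<d. eval_entire (c d) z ^ k * (eval_entire (c j) z * eval_entire f z ^ j))"
        proof (intro sum.cong refl)
          fix j assume "j \<in> {..<d}"
          hence "j \<le> k" using Suc by simp
          hence "eval_entire (c d) z ^ (k - j) * eval_entire (c d) z ^ j = eval_entire (c d) z ^ k"
            by (simp flip: power_add)
          thus "g z j * eval_entire y z ^ j = eval_entire (c d) z ^ k * (eval_entire (c j) z * eval_entire f z ^ j)"
            unfolding g_def y_def times_entire.rep_eq power_mult_distrib by (metis mult.assoc mult.left_commute)
        qed
        moreover have "eval_entire y z ^ d = eval_entire (c d) z ^ k * (eval_entire (c d) z * eval_entire f z ^ d)"
          unfolding y_def times_entire.rep_eq power_mult_distrib by (simp add: Suc)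
        moreover have "{..d} = insert d {..<d}" by auto
        ultimately show ?thesis
          by (simp add: Q_def poly_sum poly_monom distrib_left sum_distrib_left)
      qed
      also have "(\<Sum>j\<le>d. eval_entire (c j) z * eval_entire f z ^ j) = eval_entire (\<Sum>j\<le>d. c j * f ^ j) z"
        by (simp add: eval_entire_sum times_entire.rep_eq eval_entire_power)
      also have "\<dots> = 0" unfolding rel by (simp add: zero_entire.rep_eq)
      finally have "poly Q (eval_entire y z) = 0" by simp
      moreover have "lead_coeff Q = 1" by (simp add: dQ cQ)
      ultimately have "norm (eval_entire y z) \<le> 1 + (\<Sum>j<degree Q. norm (coeff Q j))"
        by (intro monic_root_bound)
      also have "(\<Sum>j<degree Q. norm (coeff Q j)) = (\<Sum>j<d. norm (g z j))"
        unfolding dQ by (intro sum.cong) (simp_all add: cQ)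
      finally show ?thesis .
    qed
    have "poly_bounded (\<lambda>z. 1 + (\<Sum>j<d. norm (g z j)))"
    proof (intro poly_bounded_add poly_bounded_const poly_bounded_sum)
      fix j
      have "polynomial_fun (\<lambda>z. g z j)"
        unfolding g_def using c(1) by (intro polynomial_fun_mult polynomial_fun_power) (simp_all add: polynomials_def)
      thus "poly_bounded (\<lambda>z. norm (g z j))" by (rule poly_bounded_polynomial_fun)
    qed
    hence "poly_bounded (\<lambda>z. norm (eval_entire y z))"
      by (rule poly_bounded_mono) (rule y_bound)
    hence "polynomial_fun (eval_entire y)"
      by (rule polynomial_fun_if_poly_bounded[OF entire_fun_eval])
    hence "y \<in> polynomials" by (simp add: polynomials_def)
    moreover have "Fract f 1 = Fract y (c d)" using cd by (simp add: y_def eq_fract mult.commute)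
    ultimately show ?thesis using rational_functionsI[OF _ c(1) cd] by simp
  qed
qed

lemma stable_inI:
  assumes "is_subalgebra B" "B \<subseteq> A"
    and "\<And>g h. g \<in> B \<Longrightarrow> h \<in> B \<Longrightarrow> g \<noteq> 0 \<Longrightarrow> h / g \<in> A \<Longrightarrow> h / g \<in> B"
  shows "stable_in B A"
  unfolding stable_in_def using assms(1,2) by (intro conjI ballI impI) (auto intro: assms(3))

lemma of_ratfun_eq_0_iff: "of_ratfun a = 0 \<longleftrightarrow> a = 0"
  by (metis of_ratfun_inject zero_ratfun.rep_eq)

lemma of_ratfun_inverse: "of_ratfun (inverse a) = inverse (of_ratfun a)"
  by (rule inverse_ratfun.rep_eq)

lemma rder_mult: "rder i (a * b) = rder i a * b + a * rder i b"
  by transfer (rule der_mult)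

lemma rder_add: "rder i (a + b) = rder i a + rder i b"
  by transfer (rule der_add)

lemma rder_one: "rder i 1 = 0"
  using rder_mult[of i 1 1] by simp

lemma rder_of_nat: "rder i (of_nat n) = 0"
  by (induction n) (simp_all add: rder_zero rder_add rder_one)

lemma rder_uminus: "rder i (- a) = - rder i a"
  using rder_add[of i a "- a"] by (simp add: rder_zero add_eq_0_iff)

section \<open>Polynomial expressions in a transcendental entire function\<close>

locale transcendental_entire =
  fixes f :: "'n::finite entire" and x :: "'n meromorphic"
  defines "x \<equiv> Fract f 1"
  assumes growth: "exp_poly_bounded (eval_entire f)" and not_rational: "x \<notin> rational_functions"
begin

text \<open>An entire function algebraic over K is already in K. Excluding rational \<open>x\<close>
  therefore makes evaluation at \<open>x\<close> injective, and identities between values can be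
  read as identities in K[X].\<close>

lemma rpoly_eq_0_iff: "rpoly P x = 0 \<longleftrightarrow> P = 0"
  using rational_if_algebraic[of P f] not_rational by (auto simp: x_def)

lemma rpoly_inject: "rpoly P x = rpoly Q x \<longleftrightarrow> P = Q"
  using rpoly_eq_0_iff[of "P - Q"] by (simp add: rpoly_diff)

lemma x_in_merom: "x \<in> merom_alg_poles"
  unfolding x_def by (rule entire_in_merom_alg_poles)

lemma der_x_in_merom: "der i x \<in> merom_alg_poles"
  unfolding x_def der_Fract_one by (rule entire_in_merom_alg_poles)

lemma exp_form:
  assumes "P \<noteq> 0" "inverse (rpoly P x) \<in> merom_alg_poles"
  obtains a u where "a \<noteq> 0" "u \<in> polynomials" "rpoly P x = of_ratfun a * Fract (exp_entire u) 1"
proof -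
  obtain E q where "rpoly P x = Fract E q" "exp_poly_bounded (eval_entire E)" "q \<in> polynomials" "q \<noteq> 0"
    using rpoly_finite_order[OF growth, of P] unfolding x_def by blast
  from exp_form_if_inverse_in_merom[OF this _ assms(2)] assms(1) that show ?thesis
    by (metis rpoly_eq_0_iff)
qed

lemma log_derivative:
  assumes "P \<noteq> 0" "inverse (rpoly P x) \<in> merom_alg_poles"
  shows "\<exists>s. der i (rpoly P x) = of_ratfun s * rpoly P x"
  using exp_form[OF assms] log_derivative_exp_form by metis

text \<open>
  Differentiating, $P'(x)\,\partial_i x = N(x)$. After cancelling the common factor of $P'$ and $N$, the
  remaining factor $P_1$ of $P'$ again satisfies the hypothesis on $P$, and differentiating $P_1(x)$
  shows that $P_1$ divides $P_1'$, so that $P_1$ is constant and $P'$ divides $N$.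
\<close>

lemma der_x_linear:
  assumes lead: "lead_coeff P = 1" and deg: "degree P = Suc e"
    and inv: "inverse (rpoly P x) \<in> merom_alg_poles"
  shows "\<exists>\<alpha> s. s = of_nat (Suc e) * \<alpha> \<and> der i (rpoly P x) = of_ratfun s * rpoly P x \<and>
           der i (x - of_ratfun (- coeff P e / of_nat (Suc e))) =
             of_ratfun \<alpha> * (x - of_ratfun (- coeff P e / of_nat (Suc e)))"
proof -
  have P0: "P \<noteq> 0" using deg by auto
  obtain s where s: "der i (rpoly P x) = of_ratfun s * rpoly P x"
    using log_derivative[OF P0 inv] by blast
  define PD where "PD = map_poly (rder i) P"
  define N where "N = smult s P - PD"
  have coeff_PD: "coeff PD j = rder i (coeff P j)" for j
    unfolding PD_def by (simp add: coeff_map_poly rder_zero)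
  have N: "rpoly N x = rpoly (pderiv P) x * der i x"
  proof -
    have "of_ratfun s * rpoly P x = rpoly PD x + rpoly (pderiv P) x * der i x"
      using s der_rpoly[of i P x] unfolding PD_def by (simp only:)
    thus ?thesis unfolding N_def rpoly_diff rpoly_smult by (simp only: add_diff_cancel_left')
  qed
  have dP: "pderiv P \<noteq> 0" using deg by (simp add: pderiv_eq_0_iff)
  define G where "G = gcd (pderiv P) N"
  have G0: "G \<noteq> 0" using dP by (simp add: G_def)
  obtain P1 N1 where PN: "pderiv P = P1 * G" "N = N1 * G" "coprime P1 N1"
    using gcd_coprime_exists[of "pderiv P" N] G0 unfolding G_def by blast
  have P10: "P1 \<noteq> 0" using dP PN by auto
  have N1: "rpoly N1 x = rpoly P1 x * der i x"
  proof -
    have "rpoly G x * rpoly N1 x = rpoly G x * (rpoly P1 x * der i x)"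
      using N unfolding PN(1,2) rpoly_mult by (simp only: mult_ac)
    thus ?thesis using G0 rpoly_eq_0_iff[of G] by simp
  qed
  \<comment> \<open>Evaluating a P1 + b N1 = 1 at \<open>x\<close> and replacing N1(x) by P1(x)
    times the derivative of \<open>x\<close> exhibits the inverse of P1(x). It has algebraic poles
    because the derivative of \<open>x\<close> is entire.\<close>
  have "inverse (rpoly P1 x) \<in> merom_alg_poles"
  proof -
    obtain a b where "a * P1 + b * N1 = gcd P1 N1"
      using bezout_coefficients_fst_snd[of P1 N1] by blast
    hence "a * P1 + b * N1 = 1" using PN(3) by simp
    hence "rpoly (a * P1 + b * N1) x = 1" by simp
    hence "rpoly P1 x * (rpoly a x + rpoly b x * der i x) = 1"
      unfolding rpoly_add rpoly_mult N1 by (simp add: algebra_simps)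
    hence "inverse (rpoly P1 x) = rpoly a x + rpoly b x * der i x" by (rule inverse_unique)
    thus ?thesis by (simp add: merom_closed rpoly_in_merom x_in_merom der_x_in_merom)
  qed
  from log_derivative[OF P10 this] obtain s1 where s1: "der i (rpoly P1 x) = of_ratfun s1 * rpoly P1 x"
    by blast
  \<comment> \<open>The formula for the derivative of P1(x) is multiplied by P1(x), so that the
    derivative of \<open>x\<close> disappears in favour of N1(x) and injectivity leads back to
    polynomials.\<close>
  have "P1 * (smult s1 P1 - map_poly (rder i) P1) = pderiv P1 * N1"
  proof -
    have "rpoly (pderiv P1) x * der i x = of_ratfun s1 * rpoly P1 x - rpoly (map_poly (rder i) P1) x"
    proof -
      have "of_ratfun s1 * rpoly P1 x = rpoly (map_poly (rder i) P1) x + rpoly (pderiv P1) x * der i x"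
        using s1 der_rpoly[of i P1 x] by (simp only:)
      thus ?thesis by (simp only: add_diff_cancel_left')
    qed
    hence "rpoly (P1 * (smult s1 P1 - map_poly (rder i) P1)) x = rpoly (pderiv P1 * N1) x"
      unfolding rpoly_mult rpoly_diff rpoly_smult N1 by (metis mult.left_commute)
    thus ?thesis by (simp only: rpoly_inject)
  qed
  hence "P1 dvd pderiv P1 * N1" by (metis dvd_triv_left)
  hence "P1 dvd pderiv P1" using PN(3) by (simp add: coprime_dvd_mult_left_iff)
  have "degree P1 = 0"
  proof (rule ccontr)
    assume "degree P1 \<noteq> 0"
    hence "pderiv P1 \<noteq> 0" by (simp add: pderiv_eq_0_iff)
    with \<open>P1 dvd pderiv P1\<close> have "degree P1 \<le> degree (pderiv P1)" by (rule dvd_imp_degree_le)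
    thus False using \<open>degree P1 \<noteq> 0\<close> by (simp add: degree_pderiv)
  qed
  then obtain c where c: "P1 = [:c:]" by (rule degree_eq_zeroE)
  have c0: "c \<noteq> 0" using P10 c by simp
  \<comment> \<open>The quotient of N by P'. As N has degree at most e + 1 and P' has degree e, it
    is at most linear, which makes the derivative of \<open>x\<close> affine in
    \<open>x\<close>.\<close>
  define L where "L = smult (inverse c) N1"
  have NL: "N = L * pderiv P" unfolding PN(1,2) L_def c using c0 by simp
  have "degree L \<le> 1"
  proof (cases "L = 0")
    case False
    have "degree N \<le> Suc e"
      unfolding N_def by (rule degree_le) (use deg in \<open>simp add: coeff_PD coeff_eq_0 rder_zero\<close>)
    moreover have "degree N = degree L + e"
      unfolding NL using False dP deg by (simp add: degree_mult_eq degree_pderiv)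
    ultimately show ?thesis by simp
  qed simp
  then obtain \<alpha> \<beta> where L: "L = [:\<beta>, \<alpha>:]"
    by (metis One_nat_def degree_eq_zeroE le_Suc_eq le_zero_eq degree1_coeffs pCons_0_0 pCons_eq_iff degree_pCons_eq_if)
  have "rpoly (pderiv P) x * der i x = rpoly (pderiv P) x * rpoly L x"
    unfolding N[symmetric] NL rpoly_mult by (rule mult.commute)
  hence "der i x = rpoly L x" using dP rpoly_eq_0_iff[of "pderiv P"] by simp
  hence der_x: "der i x = of_ratfun \<beta> + x * of_ratfun \<alpha>" by (simp add: L)
  define c where "c = coeff P e"
  \<comment> \<open>The two top coefficients of N are computed from s P - PD and from L P'.
    Comparing them expresses \<open>s\<close> and \<beta> by \<alpha> and the coefficient of X^e in
    P.\<close>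
  have NL': "N = smult \<beta> (pderiv P) + pCons 0 (smult \<alpha> (pderiv P))"
    unfolding NL L by (simp add: mult_pCons_left)
  have cP: "coeff P (Suc e) = 1" "coeff P (Suc (Suc e)) = 0"
    using lead deg by (simp_all add: coeff_eq_0)
  have "coeff N (Suc e) = s" unfolding N_def by (simp add: coeff_PD cP rder_one)
  moreover have "coeff N (Suc e) = of_nat (Suc e) * \<alpha>"
    unfolding NL' by (simp add: coeff_pderiv cP del: of_nat_Suc)
  ultimately have s\<alpha>: "s = of_nat (Suc e) * \<alpha>" by simp
  have "coeff N e = s * c - rder i c" unfolding N_def by (simp add: coeff_PD c_def)
  moreover have "coeff N e = of_nat (Suc e) * \<beta> + \<alpha> * of_nat e * c"
    unfolding NL' using cP(1) by (cases e) (simp_all add: coeff_pderiv c_def del: of_nat_Suc)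
  ultimately have c_eq: "of_nat (Suc e) * \<beta> = \<alpha> * c - rder i c"
    unfolding s\<alpha> by (simp add: algebra_simps)
  \<comment> \<open>The only candidate: in (X - b)^(e+1) the coefficient of X^e is -(e+1) b.\<close>
  define b where "b = - c / of_nat (Suc e)"
  have nz: "(of_nat (Suc e) :: 'n ratfun) \<noteq> 0" by (simp del: of_nat_Suc)
  have bc: "of_nat (Suc e) * b = - c" using nz unfolding b_def by (simp del: of_nat_Suc)
  have "of_nat (Suc e) * rder i b = - rder i c"
    using arg_cong[OF bc, of "rder i"] unfolding rder_mult rder_of_nat rder_uminus by simp
  hence "of_nat (Suc e) * (\<beta> + \<alpha> * b - rder i b) = (\<alpha> * c - rder i c) + \<alpha> * (- c) - (- rder i c)"
    unfolding bc[symmetric] c_eq[symmetric] by (simp add: algebra_simps)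
  hence "of_nat (Suc e) * (\<beta> + \<alpha> * b - rder i b) = 0" by simp
  hence "\<beta> + \<alpha> * b - rder i b = 0" using nz by (simp only: mult_eq_0_iff) blast
  hence \<beta>: "\<beta> = rder i b - \<alpha> * b" by (simp add: algebra_simps)
  have "der i x = der i (x - of_ratfun b) + der i (of_ratfun b)"
    unfolding der_add[symmetric] by simp
  hence "der i (x - of_ratfun b) = der i x - of_ratfun (rder i b)" by (simp add: rder.rep_eq)
  also have "\<dots> = of_ratfun \<alpha> * (x - of_ratfun b)"
    unfolding der_x \<beta> by (simp add: minus_ratfun.rep_eq times_ratfun.rep_eq algebra_simps)
  finally show ?thesis using s s\<alpha> unfolding b_def c_def by blast
qed

text \<open>P(x) and (x - b)^d have the same logarithmic derivative in every direction, so they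
  differ by a constant factor. Injectivity of evaluation transfers this to K[X], and comparing
  leading coefficients shows that the factor is 1.\<close>

lemma power_of_linear:
  assumes lead: "lead_coeff P = 1" and deg: "degree P \<noteq> 0"
    and inv: "inverse (rpoly P x) \<in> merom_alg_poles"
  shows "\<exists>b. P = [:- b, 1:] ^ degree P"
proof -
  obtain e where e: "degree P = Suc e" using deg not0_implies_Suc by blast
  define b where "b = - coeff P e / of_nat (Suc e)"
  define u where "u = x - of_ratfun b"
  have u_eq: "u = rpoly [:- b, 1:] x" unfolding u_def rpoly_linear ..
  have u0: "u \<noteq> 0" unfolding u_eq rpoly_eq_0_iff by simp
  have "der i (rpoly P x / u ^ Suc e) = 0" for i
  proof -
    obtain \<alpha> s where *: "s = of_nat (Suc e) * \<alpha>" "der i (rpoly P x) = of_ratfun s * rpoly P x"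
      "der i u = of_ratfun \<alpha> * u"
      using der_x_linear[OF lead e inv, of i] unfolding u_def b_def by blast
    have of_nat: "of_ratfun (of_nat n) = of_nat n" for n
      by (induction n) (simp_all add: zero_ratfun.rep_eq one_ratfun.rep_eq plus_ratfun.rep_eq)
    have "der i (u ^ Suc e) = of_ratfun s * u ^ Suc e"
      unfolding der_power *(1,3) times_ratfun.rep_eq of_nat by (simp add: mult_ac)
    with u0 *(2) show ?thesis by (intro der_divide_eq_zero) simp_all
  qed
  then obtain k where k: "rpoly P x / u ^ Suc e = Fract (const_entire k) 1"
    using constant_if_ders_zero by blast
  obtain k' where k': "(Fract (const_entire k) 1 :: 'n meromorphic) = of_ratfun k'"
    using rational_functionsI[OF const_in_polynomials one_in_polynomials one_neq_zero, of k]
    unfolding rational_functions_eq_range by blast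
  have "rpoly P x = of_ratfun k' * u ^ Suc e" using k k' u0 by (simp add: field_simps)
  hence "rpoly P x = rpoly (smult k' ([:- b, 1:] ^ Suc e)) x"
    unfolding rpoly_smult rpoly_power u_eq .
  hence P: "P = smult k' ([:- b, 1:] ^ Suc e)" unfolding rpoly_inject .
  have "lead_coeff P = k'" unfolding P lead_coeff_smult lead_coeff_power by simp
  with lead P have "P = [:- b, 1:] ^ Suc e" by simp
  thus ?thesis unfolding e ..
qed

text \<open>After cancelling the gcd, Bezout's identity a P1 + b Q1 = 1 is divided by P1: the
  inverse of P1(x) is a(x) plus b(x) times the given quotient.\<close>

lemma coprime_quotient:
  assumes "P \<noteq> 0" "rpoly Q x / rpoly P x \<in> merom_alg_poles"
  obtains P1 Q1 where "P1 \<noteq> 0" "rpoly Q x / rpoly P x = rpoly Q1 x / rpoly P1 x"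
    "inverse (rpoly P1 x) \<in> merom_alg_poles"
proof -
  define G where "G = gcd P Q"
  have G0: "G \<noteq> 0" using assms(1) by (simp add: G_def)
  obtain P1 Q1 where PQ: "P = P1 * G" "Q = Q1 * G" "coprime P1 Q1"
    using gcd_coprime_exists[of P Q] G0 unfolding G_def by blast
  have P10: "P1 \<noteq> 0" using assms(1) PQ by auto
  have nz: "rpoly G x \<noteq> 0" "rpoly P1 x \<noteq> 0" using G0 P10 by (simp_all add: rpoly_eq_0_iff)
  have eq: "rpoly Q x / rpoly P x = rpoly Q1 x / rpoly P1 x"
    unfolding PQ(1,2) rpoly_mult using nz by simp
  obtain a b where "a * P1 + b * Q1 = gcd P1 Q1"
    using bezout_coefficients_fst_snd[of P1 Q1] by blast
  hence "a * P1 + b * Q1 = 1" using PQ(3) by simp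
  hence "rpoly (a * P1 + b * Q1) x = 1" by simp
  hence "rpoly a x * rpoly P1 x + rpoly b x * rpoly Q1 x = 1" by (simp only: rpoly_add rpoly_mult)
  hence "rpoly P1 x * (rpoly a x + rpoly b x * (rpoly Q1 x / rpoly P1 x)) = 1"
    using nz by (simp add: field_simps)
  hence inv: "inverse (rpoly P1 x) = rpoly a x + rpoly b x * (rpoly Q1 x / rpoly P1 x)" by (rule inverse_unique)
  have "inverse (rpoly P1 x) \<in> merom_alg_poles"
    unfolding inv
    by (rule merom_closed(1)[OF rpoly_in_merom[OF x_in_merom] merom_closed(2)[OF rpoly_in_merom[OF x_in_merom]
          assms(2)[unfolded eq]]])
  with P10 eq show ?thesis by (rule that)
qed

text \<open>If the second alternative fails, the reduced denominator of every quotient with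
  algebraic poles, once made monic, must be constant; the quotient then lies in the algebra.\<close>

lemma stable_or_monic:
  "stable_in (rational_alg {x}) merom_alg_poles \<or>
   (\<exists>P. lead_coeff P = 1 \<and> degree P \<noteq> 0 \<and> inverse (rpoly P x) \<in> merom_alg_poles)"
proof (cases "\<exists>P. lead_coeff P = 1 \<and> degree P \<noteq> 0 \<and> inverse (rpoly P x) \<in> merom_alg_poles")
  case False
  have "h / g \<in> rational_alg {x}"
    if gh: "g \<in> rational_alg {x}" "h \<in> rational_alg {x}" "g \<noteq> 0" "h / g \<in> merom_alg_poles" for g h
  proof -
    obtain P Q where PQ: "g = rpoly P x" "h = rpoly Q x"
      using gh(1,2) unfolding rational_alg_single by blast
    have "P \<noteq> 0" using gh(3) PQ by (auto simp: rpoly_eq_0_iff)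
    then obtain P1 Q1 where 1: "P1 \<noteq> 0" "h / g = rpoly Q1 x / rpoly P1 x"
      "inverse (rpoly P1 x) \<in> merom_alg_poles"
      using coprime_quotient[of P Q] gh(4) unfolding PQ by blast
    define c where "c = lead_coeff P1"
    have c0: "c \<noteq> 0" using 1(1) by (simp add: c_def)
    have "inverse (rpoly (smult (inverse c) P1) x) = of_ratfun c * inverse (rpoly P1 x)"
      by (simp add: rpoly_smult of_ratfun_inverse)
    hence "inverse (rpoly (smult (inverse c) P1) x) \<in> merom_alg_poles"
      using 1(3) by (simp add: merom_closed of_ratfun_in_merom)
    moreover have "lead_coeff (smult (inverse c) P1) = 1" using c0 by (simp add: c_def)
    ultimately have "degree (smult (inverse c) P1) = 0" using False by blast
    hence "degree P1 = 0" using c0 by simp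
    then obtain k where k: "P1 = [:k:]" by (rule degree_eq_zeroE)
    have "h / g = rpoly (smult (inverse k) Q1) x"
      unfolding 1(2) k rpoly_smult of_ratfun_inverse by (simp add: divide_inverse mult.commute)
    thus ?thesis unfolding rational_alg_single by simp
  qed
  moreover have "rational_alg {x} \<subseteq> merom_alg_poles"
    by (rule rational_alg_subset) (simp add: x_in_merom)
  ultimately have "stable_in (rational_alg {x}) merom_alg_poles"
    by (intro stable_inI is_subalgebra_rational_alg)
  thus ?thesis ..
qed blast

end

section \<open>The rational case, the exponential algebra and the conclusion\<close>

lemma stable_in_rational_functions: "stable_in rational_functions merom_alg_poles"
  unfolding stable_in_def
proof (intro conjI ballI impI)
  show "is_subalgebra rational_functions"
    by (rule is_subalgebraI) (simp_all add: rational_functions_closed)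
  show "rational_functions \<subseteq> merom_alg_poles" by (rule rational_functions_subset)
  fix g h :: "'a meromorphic" assume "g \<in> rational_functions" "h \<in> rational_functions"
  thus "h / g \<in> rational_functions" by (simp add: divide_inverse rational_functions_closed)
qed

lemma rational_alg_rational:
  assumes "x \<in> rational_functions" shows "rational_alg {x} = rational_functions"
proof
  have "is_subalgebra rational_functions"
    by (rule is_subalgebraI) (simp_all add: rational_functions_closed)
  thus "rational_alg {x} \<subseteq> rational_functions"
    unfolding rational_alg_def using assms by (intro hull_minimal) auto
qed (rule rational_alg_generators)

lemma exp_poly_bounded_exp:
  assumes "u \<in> polynomials" shows "exp_poly_bounded (eval_entire (exp_entire u))"
proof -
  have "norm (eval_entire (exp_entire u) z) \<le> exp (norm (eval_entire u z))" for z
    using complex_Re_le_cmod[of "eval_entire u z"] by (simp add: exp_entire.rep_eq)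
  moreover have "poly_bounded (\<lambda>z. norm (eval_entire u z))"
    using assms by (intro poly_bounded_polynomial_fun) (simp add: polynomials_def)
  ultimately show ?thesis unfolding exp_poly_bounded_def by blast
qed

lemma inverse_exp_entire: "inverse (Fract (exp_entire u) 1) = Fract (exp_entire (- u)) 1"
proof -
  have "exp_entire u * exp_entire (- u) = 1"
    by (rule eval_entire_eqI) (simp add: times_entire.rep_eq exp_entire.rep_eq uminus_entire.rep_eq one_entire.rep_eq exp_minus)
  hence "Fract (exp_entire u) 1 * Fract (exp_entire (- u)) 1 = 1" by (simp add: One_fract_def)
  thus ?thesis by (rule inverse_unique)
qed

text \<open>
  If $1/P(e^u)$ has algebraic poles, then so has $1/(e^u P(e^u))$, and $X P$ can only be a power of a
  linear polynomial if $P$ is a monomial.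
\<close>

lemma stable_in_exp_pair:
  assumes u: "u \<in> polynomials" and "Fract (exp_entire u) 1 \<notin> rational_functions"
  shows "stable_in (rational_alg {Fract (exp_entire u) 1, Fract (exp_entire (- u)) 1}) merom_alg_poles"
proof -
  define y where "y = Fract (exp_entire u) 1"
  interpret Y: transcendental_entire "exp_entire u" y
    by unfold_locales (use assms exp_poly_bounded_exp in \<open>simp_all add: y_def\<close>)
  have y0: "y \<noteq> 0" using Y.rpoly_eq_0_iff[of "[:0, 1:]"] unfolding rpoly_X by simp
  have yi: "Fract (exp_entire (- u)) 1 = inverse y"
    unfolding y_def by (rule inverse_exp_entire[symmetric])
  have yi_merom: "inverse y \<in> merom_alg_poles"
    unfolding yi[symmetric] by (rule entire_in_merom_alg_poles)
  let ?B = "rational_alg {y, inverse y}"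
  have B: "?B = {rpoly P y / y ^ k | P k. True}" by (rule rational_alg_inverse_pair[OF y0])
  have "h / g \<in> ?B" if gh: "g \<in> ?B" "h \<in> ?B" "g \<noteq> 0" "h / g \<in> merom_alg_poles" for g h
  proof -
    obtain P k where g: "g = rpoly P y / y ^ k" using gh(1) unfolding B by blast
    obtain Q l where h: "h = rpoly Q y / y ^ l" using gh(2) unfolding B by blast
    have P0: "P \<noteq> 0" using gh(3) g by auto
    have hg: "h / g = (rpoly Q y / rpoly P y) * (y ^ k / y ^ l)"
      unfolding g h by (simp add: divide_simps)
    \<comment> \<open>Both y and 1/y are entire, so multiplication by their powers keeps the poles
      algebraic and only the numerators P and Q have to be treated.\<close>
    hence "rpoly Q y / rpoly P y = (h / g) * (y ^ l * inverse y ^ k)"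
      using y0 by (simp add: field_simps power_inverse)
    hence "rpoly Q y / rpoly P y \<in> merom_alg_poles"
      using gh(4) by (simp only: merom_closed merom_power Y.x_in_merom yi_merom)
    from Y.coprime_quotient[OF P0 this] obtain P1 Q1 where 1: "P1 \<noteq> 0"
      "rpoly Q y / rpoly P y = rpoly Q1 y / rpoly P1 y" "inverse (rpoly P1 y) \<in> merom_alg_poles" by blast
    define c where "c = lead_coeff P1"
    have c0: "c \<noteq> 0" using 1(1) by (simp add: c_def)
    define P2 where "P2 = smult (inverse c) (P1 * [:0, 1:])"
    have "lead_coeff P2 = 1"
      unfolding P2_def lead_coeff_smult lead_coeff_mult using c0 by (simp add: c_def)
    moreover have "degree P2 \<noteq> 0"
      unfolding P2_def using c0 1(1) by (simp add: degree_mult_eq)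
    moreover have "inverse (rpoly P2 y) = of_ratfun c * (inverse (rpoly P1 y) * inverse y)"
      unfolding P2_def rpoly_smult rpoly_mult rpoly_X of_ratfun_inverse
      by (simp add: mult_ac)
    hence "inverse (rpoly P2 y) \<in> merom_alg_poles"
      by (simp only: merom_closed of_ratfun_in_merom 1(3) yi_merom)
    ultimately obtain b where b: "P2 = [:- b, 1:] ^ degree P2"
      using Y.power_of_linear by blast
    have "poly P2 0 = 0" by (simp add: P2_def)
    hence "(- b) ^ degree P2 = 0" by (subst (asm) b) (simp add: poly_power)
    hence b0: "b = 0" by simp
    obtain d where d: "degree P2 = Suc d" using \<open>degree P2 \<noteq> 0\<close> not0_implies_Suc by blast
    have "rpoly P2 y = y ^ Suc d"
      by (subst b) (simp only: rpoly_power d b0 minus_zero rpoly_X)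
    moreover have "rpoly P1 y * y = of_ratfun c * rpoly P2 y"
      using c0 unfolding P2_def rpoly_smult rpoly_mult rpoly_X of_ratfun_inverse
      by (simp add: of_ratfun_eq_0_iff)
    ultimately have "rpoly P1 y * y = (of_ratfun c * y ^ d) * y" by simp
    hence "rpoly P1 y = of_ratfun c * y ^ d" using y0 by simp
    hence "h / g = rpoly (smult (inverse c) (Q1 * [:0, 1:] ^ k)) y / y ^ (d + l)"
      unfolding hg 1(2) rpoly_smult rpoly_mult rpoly_power rpoly_X of_ratfun_inverse
      by (simp add: power_add divide_inverse mult_ac)
    thus ?thesis unfolding B by blast
  qed
  moreover have "?B \<subseteq> merom_alg_poles"
    by (rule rational_alg_subset) (simp add: Y.x_in_merom yi_merom)
  ultimately have "stable_in ?B merom_alg_poles"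
    by (intro stable_inI is_subalgebra_rational_alg)
  thus ?thesis unfolding y_def[symmetric] yi .
qed

theorem theorem1p1:
  fixes f :: "'n::finite entire"
  assumes "finite_order f"
  shows "stable_in (rational_alg {Fract f 1}) merom_alg_poles \<or>
    (\<exists>p\<in>polynomials.
       rational_alg {Fract f 1} = rational_alg {Fract (exp_entire p) 1} \<and>
       stable_in (rational_alg {Fract (exp_entire p) 1, Fract (exp_entire (- p)) 1}) merom_alg_poles)"
proof (cases "Fract f 1 \<in> rational_functions")
  case True
  \<comment> \<open>A rational f generates nothing beyond the rational functions, and a field is
    stable.\<close>
  thus ?thesis by (simp add: rational_alg_rational stable_in_rational_functions)
next
  case False
  define x where "x = Fract f 1"
  interpret X: transcendental_entire f x
    by unfold_locales (use False exp_poly_bounded_if_finite_order[OF assms] in \<open>simp_all add: x_def\<close>)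
  show ?thesis
  proof (cases "stable_in (rational_alg {x}) merom_alg_poles")
    case True
    thus ?thesis by (simp add: x_def)
  next
    case False
    then obtain P where P: "lead_coeff P = 1" "degree P \<noteq> 0" "inverse (rpoly P x) \<in> merom_alg_poles"
      using X.stable_or_monic by blast
    obtain b where b: "P = [:- b, 1:] ^ degree P" using X.power_of_linear[OF P] by blast
    define z where "z = rpoly [:- b, 1:] x"
    have z: "z = x - of_ratfun b" unfolding z_def by (rule rpoly_linear)
    have z0: "z \<noteq> 0" unfolding z_def X.rpoly_eq_0_iff by simp
    obtain e where e: "degree P = Suc e" using P(2) not0_implies_Suc by blast
    have "rpoly P x = z ^ Suc e" by (subst b) (simp only: rpoly_power e z_def)
    \<comment> \<open>All but one power of z cancel, so the linear factor z = f - b inherits from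
      P(f) that its inverse has algebraic poles.\<close>
    hence "inverse z = z ^ e * inverse (rpoly P x)" using z0 by simp
    moreover have "z \<in> merom_alg_poles" unfolding z_def by (rule rpoly_in_merom[OF X.x_in_merom])
    ultimately have "inverse (rpoly [:- b, 1:] x) \<in> merom_alg_poles"
      unfolding z_def[symmetric] using P(3) by (simp only: merom_closed merom_power)
    then obtain a u where au: "a \<noteq> 0" "u \<in> polynomials" "z = of_ratfun a * Fract (exp_entire u) 1"
      using X.exp_form[of "[:- b, 1:]"] unfolding z_def by auto
    define y where "y = Fract (exp_entire u) 1"
    have xy: "x = of_ratfun b + of_ratfun a * y" using z au(3) by (simp add: y_def algebra_simps)
    have a0: "of_ratfun a \<noteq> 0" using au(1) by (simp add: of_ratfun_eq_0_iff)
    \<comment> \<open>Over K, \<open>x\<close> and \<open>y\<close> are affine functions of each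
      other with nonzero slope, hence generate the same algebra.\<close>
    have yx: "y = rpoly (smult (inverse a) [:- b, 1:]) x"
      unfolding rpoly_smult of_ratfun_inverse rpoly_linear using xy a0 by simp
    have "x = rpoly [:b, a:] y" by (simp add: xy mult.commute)
    hence "x \<in> rational_alg {y}" unfolding rational_alg_single by (rule range_eqI)
    moreover have "y \<in> rational_alg {x}" unfolding rational_alg_single using yx by (rule range_eqI)
    ultimately have "rational_alg {x} = rational_alg {y}"
      by (intro subset_antisym rational_alg_subsetI) simp_all
    moreover have "y \<notin> rational_functions"
    proof
      assume "y \<in> rational_functions"
      hence "x \<in> rational_functions"
        unfolding xy by (intro rational_functions_closed(1,2) of_ratfun_in_rational)
      with X.not_rational show False by contradiction
    qed
    ultimately show ?thesis
      using au(2) stable_in_exp_pair[OF au(2)] unfolding x_def y_def by blast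
  qed
qed

end
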